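(* Consider the following problem $(P_3)$, where $s\ge 1$ is a number of features. There are $n$ items $1,\dots,n$ to be partitioned into $p$ clusters. Each item $j$ has a utility matrix $C^j\in\mathbb{R}^{d\times p}$ with columns $C^j_1,\dots,C^j_p$ and a weight matrix $W^j\in\mathbb{Z}^{s\times p}$ with columns $W^j_1,\dots,W^j_p\in\mathbb{Z}^s$; each cluster $i\in[p]$ has lower and upper bound vectors $B_i^-,B_i^+\in\mathbb{Z}^s$ on its total weight; and $f:\mathbb{R}^{d\times p}\to\mathbb{R}$ is a convex function. The task is $$(P_3)\qquad \max_{\pi\in\Pi}\ f\Bigl(\sum_{j\in\pi_1}C^j_1,\dots,\sum_{j\in\pi_p}C^j_p\Bigr)$$ subject to, with slack vectors $S_i^{\pm}\in\mathbb{Z}^s$, $$\Bigl(\sum_{j\in\pi_i}W_i^j\Bigr)+S_i^+=B_i^+,\qquad \Bigl(\sum_{j\in\pi_i}W_i^j\Bigr)-S_i^-=B_i^-,\qquad S_i^{\pm}\ge 0\qquad (i\in[p]),$$ that is, subject to the componentwise inequalities $B_i^-\le\sum_{j\in\pi_i}W^j_i\le B_i^+$ for all $i\in[p]$, where $\Pi$ is the set of all partitions $\pi=(\pi_1,\dots,\pi_p)$ of $\{1,\dots,n\}$ into $p$ clusters. Suppose $d$ and $p$ are fixed and suppose there is a fixed, finite set $\Omega\subset\mathbb{Z}^{s\times p}$ such that all $W^j\in\Omega$. Then for every convex $f$ presented by a comparison oracle, problem $(P_3)$ can be solved in polynomial time.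
   Context: Notation: $[p]=\{1,\dots,p\}$. A partition of $\{1,\dots,n\}$ into $p$ clusters is an ordered tuple $\pi=(\pi_1,\dots,\pi_p)$ of pairwise disjoint (possibly empty) subsets whose union is $\{1,\dots,n\}$. The column $C^j_i\in\mathbb{R}^d$ is the vector of utility values gained if item $j$ is assigned to cluster $\pi_i$, and $W^j_i\in\mathbb{Z}^s$ is the vector of weights, with respect to the $s$ features, that item $j$ contributes to $\pi_i$ if assigned to it. The tuple $(\sum_{j\in\pi_1}C^j_1,\dots,\sum_{j\in\pi_p}C^j_p)$ is viewed as the $d\times p$ matrix with these columns. A comparison oracle for $f$ is a routine that, when queried on two arguments $y,z$, returns whether $f(y)\le f(z)$ or not. Polynomial time means polynomial in the size of the input, in particular in the number $n$ of items; $d$, $p$ and $\Omega$ (hence also $s$) are constants. *)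

theory Defs
  imports
    "HOL-Analysis.Analysis"
    "HOL-Computational_Algebra.Polynomial"
    "HOL-Library.Log_Nat"
    "HOL-Library.Disjoint_Sets"
begin

section \<open>Oracle programs over the reals\<close>

text \<open>
  The machine model is a real RAM with a binary oracle, presented as a small imperative language.
  There are two separate memories, one for natural numbers (used for addressing, control and
  combinatorial output) and one for real numbers. A memory cell is addressed by an array name and
  a list of indices; a scalar variable is a cell with index list \<open>[]\<close>.

  Program constants are integers. There is no rounding and no conversion from reals to naturals.
  Naturals can only be added and subtracted (truncated), so that \<open>t\<close> steps produce
  naturals of \<open>O(t)\<close> additional binary digits and charging unit cost for them is harmless.
\<close>

record state =
  nats :: "string \<Rightarrow> nat list \<Rightarrow> nat"
  reals :: "string \<Rightarrow> nat list \<Rightarrow> real"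

datatype nexp =
    NConst nat
  | NGet string "nexp list"
  | NAdd nexp nexp
  | NSub nexp nexp

datatype rexp =
    RConst int
  | RGet string "nexp list"
  | RAdd rexp rexp
  | RSub rexp rexp
  | RMul rexp rexp
  | RDiv rexp rexp

datatype bexp =
    NLe nexp nexp
  | RLe rexp rexp
  | BNot bexp
  | BAnd bexp bexp

datatype com =
    Skip
  | NSet string "nexp list" nexp
  | RSet string "nexp list" rexp
  | Query string "nexp list" string string
  | Seq com com
  | Cond bexp com com
  | While bexp com

fun nval :: "state \<Rightarrow> nexp \<Rightarrow> nat" where
  "nval st (NConst c) = c"
| "nval st (NGet x es) = nats st x (map (nval st) es)"
| "nval st (NAdd a b) = nval st a + nval st b"
| "nval st (NSub a b) = nval st a - nval st b"

fun rval :: "state \<Rightarrow> rexp \<Rightarrow> real" where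
  "rval st (RConst c) = of_int c"
| "rval st (RGet x es) = reals st x (map (nval st) es)"
| "rval st (RAdd a b) = rval st a + rval st b"
| "rval st (RSub a b) = rval st a - rval st b"
| "rval st (RMul a b) = rval st a * rval st b"
| "rval st (RDiv a b) = rval st a / rval st b"

fun bval :: "state \<Rightarrow> bexp \<Rightarrow> bool" where
  "bval st (NLe a b) = (nval st a \<le> nval st b)"
| "bval st (RLe a b) = (rval st a \<le> rval st b)"
| "bval st (BNot b) = (\<not> bval st b)"
| "bval st (BAnd a b) = (bval st a \<and> bval st b)"

text \<open>
  The cost of evaluation is relative to a size measure \<open>sz\<close> for reals: every real that is read or
  computed costs its size. With \<open>sz = (\<lambda>_. 1)\<close> this counts operations (unit cost, real
  arithmetic model); with the bit size of rationals, defined below, it is the logarithmic cost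
  measure, which for rational data is polynomially equivalent to Turing machine time.
\<close>

fun ncost :: "nexp \<Rightarrow> nat" where
  "ncost (NConst c) = 1"
| "ncost (NGet x es) = 1 + sum_list (map ncost es)"
| "ncost (NAdd a b) = 1 + ncost a + ncost b"
| "ncost (NSub a b) = 1 + ncost a + ncost b"

fun rcost :: "(real \<Rightarrow> nat) \<Rightarrow> state \<Rightarrow> rexp \<Rightarrow> nat" where
  "rcost sz st (RConst c) = sz (of_int c)"
| "rcost sz st (RGet x es) = sz (rval st (RGet x es)) + sum_list (map ncost es)"
| "rcost sz st (RAdd a b) = sz (rval st (RAdd a b)) + rcost sz st a + rcost sz st b"
| "rcost sz st (RSub a b) = sz (rval st (RSub a b)) + rcost sz st a + rcost sz st b"
| "rcost sz st (RMul a b) = sz (rval st (RMul a b)) + rcost sz st a + rcost sz st b"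
| "rcost sz st (RDiv a b) = sz (rval st (RDiv a b)) + rcost sz st a + rcost sz st b"

fun bcost :: "(real \<Rightarrow> nat) \<Rightarrow> state \<Rightarrow> bexp \<Rightarrow> nat" where
  "bcost sz st (NLe a b) = 1 + ncost a + ncost b"
| "bcost sz st (RLe a b) = 1 + rcost sz st a + rcost sz st b"
| "bcost sz st (BNot b) = 1 + bcost sz st b"
| "bcost sz st (BAnd a b) = 1 + bcost sz st a + bcost sz st b"

definition set_nat :: "string \<Rightarrow> nat list \<Rightarrow> nat \<Rightarrow> state \<Rightarrow> state" where
  "set_nat x is v st = st\<lparr>nats := (nats st)(x := (nats st x)(is := v))\<rparr>"

definition set_real :: "string \<Rightarrow> nat list \<Rightarrow> real \<Rightarrow> state \<Rightarrow> state" where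
  "set_real x is v st = st\<lparr>reals := (reals st)(x := (reals st x)(is := v))\<rparr>"

text \<open>
  \<open>exec orc sz c st t st'\<close>: started in \<open>st\<close>, program \<open>c\<close> with oracle \<open>orc\<close> terminates in \<open>st'\<close> at
  cost \<open>t\<close>. An oracle is asked about the contents of two named real arrays and answers one bit.
\<close>

type_synonym oracle2 = "(nat list \<Rightarrow> real) \<Rightarrow> (nat list \<Rightarrow> real) \<Rightarrow> bool"

inductive exec :: "oracle2 \<Rightarrow> (real \<Rightarrow> nat) \<Rightarrow> com \<Rightarrow> state \<Rightarrow> nat \<Rightarrow> state \<Rightarrow> bool"
  for orc :: oracle2 and sz :: "real \<Rightarrow> nat" where
  exec_Skip: "exec orc sz Skip st 1 st"
| exec_NSet: "exec orc sz (NSet x es e) st (1 + sum_list (map ncost es) + ncost e)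
    (set_nat x (map (nval st) es) (nval st e) st)"
| exec_RSet: "exec orc sz (RSet x es e) st (1 + sum_list (map ncost es) + rcost sz st e)
    (set_real x (map (nval st) es) (rval st e) st)"
| exec_Query: "exec orc sz (Query x es a b) st (1 + sum_list (map ncost es))
    (set_nat x (map (nval st) es) (if orc (reals st a) (reals st b) then 1 else 0) st)"
| exec_Seq: "exec orc sz c1 st t1 st1 \<Longrightarrow> exec orc sz c2 st1 t2 st2 \<Longrightarrow>
    exec orc sz (Seq c1 c2) st (1 + t1 + t2) st2"
| exec_Cond_true: "bval st b \<Longrightarrow> exec orc sz c1 st t st1 \<Longrightarrow>
    exec orc sz (Cond b c1 c2) st (1 + bcost sz st b + t) st1"
| exec_Cond_false: "\<not> bval st b \<Longrightarrow> exec orc sz c2 st t st1 \<Longrightarrow>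
    exec orc sz (Cond b c1 c2) st (1 + bcost sz st b + t) st1"
| exec_While_false: "\<not> bval st b \<Longrightarrow> exec orc sz (While b c) st (1 + bcost sz st b) st"
| exec_While_true: "bval st b \<Longrightarrow> exec orc sz c st t1 st1 \<Longrightarrow>
    exec orc sz (While b c) st1 t2 st2 \<Longrightarrow>
    exec orc sz (While b c) st (1 + bcost sz st b + t1 + t2) st2"

inductive_cases exec_SkipE: "exec orc sz Skip st t st'"
inductive_cases exec_NSetE: "exec orc sz (NSet x es e) st t st'"
inductive_cases exec_RSetE: "exec orc sz (RSet x es e) st t st'"
inductive_cases exec_QueryE: "exec orc sz (Query x es a b) st t st'"
inductive_cases exec_SeqE: "exec orc sz (Seq c1 c2) st t st'"
inductive_cases exec_CondE: "exec orc sz (Cond b c1 c2) st t st'"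
inductive_cases exec_WhileE: "exec orc sz (While b c) st t st'"

lemma exec_deterministic:
  "exec orc sz c st t st1 \<Longrightarrow> exec orc sz c st t' st2 \<Longrightarrow> t' = t \<and> st2 = st1"
proof (induction arbitrary: t' st2 rule: exec.induct)
  case (exec_Skip st)
  from exec_Skip.prems show ?case by (rule exec_SkipE) simp
next
  case (exec_NSet x es e st)
  from exec_NSet.prems show ?case by (rule exec_NSetE) simp
next
  case (exec_RSet x es e st)
  from exec_RSet.prems show ?case by (rule exec_RSetE) simp
next
  case (exec_Query x es a b st)
  from exec_Query.prems show ?case by (rule exec_QueryE) simp
next
  case (exec_Seq c1 st t1 st1 c2 t2 st2')
  from exec_Seq.prems obtain u1 v u2 where
    "t' = Suc (u1 + u2)" and *: "exec orc sz c1 st u1 v" "exec orc sz c2 v u2 st2"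
    by (rule exec_SeqE)
  then show ?case using exec_Seq.IH(1)[OF *(1)] exec_Seq.IH(2)[of u2 st2] by simp
next
  case (exec_Cond_true st b c1 t st1 c2)
  from exec_Cond_true.prems obtain u where "t' = Suc (bcost sz st b + u)" "exec orc sz c1 st u st2"
    by (rule exec_CondE) (use exec_Cond_true.hyps(1) in simp_all)
  then show ?case using exec_Cond_true.IH[of u st2] by simp
next
  case (exec_Cond_false st b c2 t st1 c1)
  from exec_Cond_false.prems obtain u where "t' = Suc (bcost sz st b + u)" "exec orc sz c2 st u st2"
    by (rule exec_CondE) (use exec_Cond_false.hyps(1) in simp_all)
  then show ?case using exec_Cond_false.IH[of u st2] by simp
next
  case (exec_While_false st b c)
  from exec_While_false.prems show ?case
    by (rule exec_WhileE) (use exec_While_false.hyps in simp_all)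
next
  case (exec_While_true st b c t1 st1 t2 st2')
  from exec_While_true.prems obtain u1 v u2 where "t' = Suc (bcost sz st b + u1 + u2)"
    and *: "exec orc sz c st u1 v" "exec orc sz (While b c) v u2 st2"
    by (rule exec_WhileE) (use exec_While_true.hyps(1) in simp_all)
  then show ?case using exec_While_true.IH(1)[OF *(1)] exec_While_true.IH(2)[of u2 st2] by simp
qed

text \<open>Meaningful for rational arguments only; \<open>quotient_of\<close> gives the reduced fraction.\<close>

definition bit_size :: "real \<Rightarrow> nat" where
  "bit_size x = (let (a, b) = quotient_of (THE r. of_rat r = x)
     in 1 + floorlog 2 (nat \<bar>a\<bar>) + floorlog 2 (nat b))"

section \<open>The partition problem\<close>

text \<open>
  Type \<open>'p\<close> indexes the clusters, \<open>'d\<close> the rows of utility matrices and \<open>'s\<close> the features.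
\<close>

record ('d, 'p, 's) problem =
  items :: nat
  utility :: "nat \<Rightarrow> real^'p^'d"
  weight :: "nat \<Rightarrow> int^'p^'s"
  lower :: "'p \<Rightarrow> int^'s"
  upper :: "'p \<Rightarrow> int^'s"

definition partitions :: "nat \<Rightarrow> ('p \<Rightarrow> nat set) set" where
  "partitions n = {\<pi>. disjoint_family \<pi> \<and> (\<Union>i. \<pi> i) = {1..n}}"

definition total_utility ::
    "('d::finite, 'p::finite, 's::finite) problem \<Rightarrow> ('p \<Rightarrow> nat set) \<Rightarrow> real^'p^'d" where
  "total_utility I \<pi> = (\<chi> k i. (\<Sum>j\<in>\<pi> i. column i (utility I j)) $ k)"

text \<open>The order on vectors is componentwise.\<close>

definition feasible ::
    "('d::finite, 'p::finite, 's::finite) problem \<Rightarrow> ('p \<Rightarrow> nat set) \<Rightarrow> bool" where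
  "feasible I \<pi> \<longleftrightarrow> \<pi> \<in> partitions (items I) \<and>
     (\<forall>i. lower I i \<le> (\<Sum>j\<in>\<pi> i. column i (weight I j)) \<and>
          (\<Sum>j\<in>\<pi> i. column i (weight I j)) \<le> upper I i)"

definition optimal ::
    "('d::finite, 'p::finite, 's::finite) problem \<Rightarrow> (real^'p^'d \<Rightarrow> real) \<Rightarrow>
     ('p \<Rightarrow> nat set) \<Rightarrow> bool" where
  "optimal I f \<pi> \<longleftrightarrow> feasible I \<pi> \<and>
     (\<forall>\<rho>. feasible I \<rho> \<longrightarrow> f (total_utility I \<rho>) \<le> f (total_utility I \<pi>))"

section \<open>Input, oracle and output\<close>

text \<open>
  \<open>idx\<close> is a fixed numbering of a finite type by \<open>0, \<dots>, CARD('a) - 1\<close>, with inverse \<open>elt\<close>.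
\<close>

definition idx :: "'a::finite \<Rightarrow> nat" where
  "idx = to_nat_on UNIV"

definition elt :: "nat \<Rightarrow> 'a::finite" where
  "elt = from_nat_into UNIV"

text \<open>All memory cells that do not hold input data are initially \<open>0\<close>.\<close>

definition input_state :: "('d::finite, 'p::finite, 's::finite) problem \<Rightarrow> state" where
  "input_state I = \<lparr>
     nats = (\<lambda>x is. if x = ''n'' \<and> is = [] then items I else 0),
     reals = (\<lambda>x is.
       case is of
         [j, k, i] \<Rightarrow>
           if x = ''C'' \<and> j \<in> {1..items I} \<and> k < CARD('d) \<and> i < CARD('p)
             then utility I j $ elt k $ elt i
           else if x = ''W'' \<and> j \<in> {1..items I} \<and> k < CARD('s) \<and> i < CARD('p)
             then of_int (weight I j $ elt k $ elt i)
           else 0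
       | [i, k] \<Rightarrow>
           if x = ''Bmin'' \<and> i < CARD('p) \<and> k < CARD('s)
             then of_int (lower I (elt i) $ elt k)
           else if x = ''Bmax'' \<and> i < CARD('p) \<and> k < CARD('s)
             then of_int (upper I (elt i) $ elt k)
           else 0
       | _ \<Rightarrow> 0)\<rparr>"

definition input_size ::
    "(real \<Rightarrow> nat) \<Rightarrow> ('d::finite, 'p::finite, 's::finite) problem \<Rightarrow> nat" where
  "input_size sz I = items I
     + (\<Sum>j\<in>{1..items I}. \<Sum>k\<in>UNIV. \<Sum>i\<in>UNIV. sz (utility I j $ k $ i))
     + (\<Sum>j\<in>{1..items I}. \<Sum>k\<in>UNIV. \<Sum>i\<in>UNIV. sz (of_int (weight I j $ k $ i)))
     + (\<Sum>i\<in>UNIV. \<Sum>k\<in>UNIV. sz (of_int (lower I i $ k)) + sz (of_int (upper I i $ k)))"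

definition comparison_oracle :: "(real^'p::finite^'d::finite \<Rightarrow> real) \<Rightarrow> oracle2" where
  "comparison_oracle f a b \<longleftrightarrow> f (\<chi> k i. a [idx k, idx i]) \<le> f (\<chi> k i. b [idx k, idx i])"

text \<open>
  A correct final state reports either infeasibility or an optimal partition, given by the number
  of the cluster of each item.
\<close>

definition output_partition :: "nat \<Rightarrow> state \<Rightarrow> 'p::finite \<Rightarrow> nat set" where
  "output_partition n st i = {j \<in> {1..n}. nats st ''cluster'' [j] = idx i}"

definition correct_output ::
    "('d::finite, 'p::finite, 's::finite) problem \<Rightarrow> (real^'p^'d \<Rightarrow> real) \<Rightarrow> state \<Rightarrow> bool" where
  "correct_output I f st \<longleftrightarrow>
     (if \<exists>\<pi>. feasible I \<pi>
      then nats st ''feasible'' [] = 1 \<and> optimal I f (output_partition (items I) st)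
      else nats st ''feasible'' [] = 0)"

text \<open>
  \<open>c\<close> solves, in time polynomial in the input size as measured by \<open>sz\<close>, all problems whose weight
  matrices lie in \<open>\<Omega>\<close> and whose utilities lie in \<open>K\<close>, for all convex \<open>f\<close>. The polynomial depends
  on neither the problem nor \<open>f\<close>.
\<close>

definition solves_in_poly_time ::
    "(real \<Rightarrow> nat) \<Rightarrow> real set \<Rightarrow> (int^'p^'s) set \<Rightarrow> 'd::finite itself \<Rightarrow> com \<Rightarrow> bool" where
  "solves_in_poly_time sz K \<Omega> (_ :: 'd itself) c \<longleftrightarrow>
     (\<exists>q :: nat poly. \<forall>(I :: ('d, 'p::finite, 's::finite) problem) (f :: real^'p^'d \<Rightarrow> real).
        (\<forall>j\<in>{1..items I}. weight I j \<in> \<Omega>) \<longrightarrow>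
        (\<forall>j\<in>{1..items I}. \<forall>k i. utility I j $ k $ i \<in> K) \<longrightarrow>
        convex_on UNIV f \<longrightarrow>
        (\<exists>t st. exec (comparison_oracle f) sz c (input_state I) t st \<and>
           t \<le> poly q (input_size sz I) \<and> correct_output I f st))"

end

theory Submission
  imports Defs "HOL-Combinatorics.Transposition"
begin

text \<open>
  Append to the utility matrix of item \<open>j\<close> the number \<open>j\<close> as a further coordinate. Among the
  feasible partitions maximizing \<open>f\<close>, one whose lifted total has the largest norm has a lifted total
  that is exposed by some linear functional. Exchanging two items with the same weight
  matrix between clusters \<open>i\<close> and \<open>i'\<close> preserves feasibility and changes the lifted total, hence
  strictly decreases that functional; so in this optimal partition, for every weight type, the
  lifted utilities of the items in \<open>i\<close> and in \<open>i'\<close> are strictly separated by a hyperplane. A normal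
  vector of such a hyperplane is the point of least norm in the convex hull of the differences of
  items, and by Caratheodory's theorem it is determined by a number of pairs of items that depends
  only on \<open>d\<close> and \<open>p\<close>: it is the residual of a Gram--Schmidt process and therefore the value of
  a fixed arithmetic expression. The algorithm enumerates all choices of such pairs for all
  weight types and pairs of clusters, reconstructs the partition, and keeps the best feasible one.
\<close>

section \<open>Loop-free programs\<close>

text \<open>The largest norm breaks ties because \<open>f\<close> is only convex: a maximizer may be
  an average of other maximizers, and then no functional exposes it, but one of largest norm is
  never such an average. Strictness makes the decoding unambiguous: items lying on a hyperplane
  would not be assigned by it, and without the appended coordinate two items with equal utilities
  could be exchanged with no effect on the total. The lifted space has dimension dp + 1, so dp + 2
  pairs suffice for each hyperplane; for a fixed set of weight types the number of item numbers to
  guess is constant, and each takes at most n + 1 values. A guess need not be consistent: each one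
  decodes to some partition, which is then tested for feasibility. The other obstacle is the size of
  the numbers. A loop-free program may enlarge them by a constant factor, which would compound over
  the rounds of the enumeration. Hence every round starts afresh from the input, and the only reals
  kept, apart from the item numbers, are totals over items, bounded independently of the
  round.\<close>

fun loop_free :: "com \<Rightarrow> bool" where
  "loop_free (Seq c1 c2) \<longleftrightarrow> loop_free c1 \<and> loop_free c2"
| "loop_free (Cond b c1 c2) \<longleftrightarrow> loop_free c1 \<and> loop_free c2"
| "loop_free (While b c) \<longleftrightarrow> False"
| "loop_free _ \<longleftrightarrow> True"

text \<open>The \<open>While\<close> clause is a dummy that makes the function total;
  \<open>sem\<close> is related to \<open>exec\<close> for loop-free programs only.\<close>

fun sem :: "oracle2 \<Rightarrow> com \<Rightarrow> state \<Rightarrow> state" where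
  "sem orc Skip st = st"
| "sem orc (NSet x es e) st = set_nat x (map (nval st) es) (nval st e) st"
| "sem orc (RSet x es e) st = set_real x (map (nval st) es) (rval st e) st"
| "sem orc (Query x es a b) st =
     set_nat x (map (nval st) es) (if orc (reals st a) (reals st b) then 1 else 0) st"
| "sem orc (Seq c1 c2) st = sem orc c2 (sem orc c1 st)"
| "sem orc (Cond b c1 c2) st = (if bval st b then sem orc c1 st else sem orc c2 st)"
| "sem orc (While b c) st = st"

text \<open>
  \<open>mu\<close> plays the role of a logarithmic height: unlike the bit size it is subadditive under all
  arithmetic operations, so that it controls sums of unboundedly many terms.
\<close>

locale size_measure =
  fixes sz :: "real \<Rightarrow> nat" and K :: "real set" and mu :: "real \<Rightarrow> real" and r0 :: nat
  assumes K_int: "of_int z \<in> K"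
    and K_add: "x \<in> K \<Longrightarrow> y \<in> K \<Longrightarrow> x + y \<in> K"
    and K_diff: "x \<in> K \<Longrightarrow> y \<in> K \<Longrightarrow> x - y \<in> K"
    and K_mult: "x \<in> K \<Longrightarrow> y \<in> K \<Longrightarrow> x * y \<in> K"
    and K_divide: "x \<in> K \<Longrightarrow> y \<in> K \<Longrightarrow> x / y \<in> K"
    and mu_add: "x \<in> K \<Longrightarrow> y \<in> K \<Longrightarrow> mu (x + y) \<le> mu x + mu y"
    and mu_diff: "x \<in> K \<Longrightarrow> y \<in> K \<Longrightarrow> mu (x - y) \<le> mu x + mu y"
    and mu_mult: "x \<in> K \<Longrightarrow> y \<in> K \<Longrightarrow> mu (x * y) \<le> mu x + mu y"
    and mu_divide: "x \<in> K \<Longrightarrow> y \<in> K \<Longrightarrow> mu (x / y) \<le> mu x + mu y"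
    and mu_0: "mu 0 = 0"
    and mu_1: "mu 1 \<le> 1"
    and sz_le_mu: "x \<in> K \<Longrightarrow> real (sz x) \<le> r0 * (1 + mu x)"
    and mu_le_sz: "x \<in> K \<Longrightarrow> mu x \<le> sz x"
begin

definition small :: "real \<Rightarrow> real \<Rightarrow> bool" where
  "small B r \<longleftrightarrow> r \<in> K \<and> mu r \<le> B"

definition bounded_state :: "real \<Rightarrow> state \<Rightarrow> bool" where
  "bounded_state B st \<longleftrightarrow> (\<forall>x is. small B (reals st x is))"

lemma small_mono: "small B r \<Longrightarrow> B \<le> B' \<Longrightarrow> small B' r"
  by (auto simp: small_def)

lemma small_sz:
  assumes "small B r"
  shows "real (sz r) \<le> real r0 * (1 + B)"
proof -
  have "real r0 * (1 + mu r) \<le> real r0 * (1 + B)"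
    using assms by (intro mult_left_mono) (auto simp: small_def)
  then show ?thesis using sz_le_mu[of r] assms by (auto simp: small_def)
qed

lemma small_0: "0 \<le> B \<Longrightarrow> small B 0"
  using K_int[of 0] by (simp add: small_def mu_0)

lemma small_add: "small A x \<Longrightarrow> small B y \<Longrightarrow> small (A + B) (x + y)"
  unfolding small_def using K_add[of x y] mu_add[of x y] by linarith

lemma small_sum:
  fixes B :: real
  assumes "finite A" "\<And>j. j \<in> A \<Longrightarrow> small B (h j)"
  shows "small (card A * B) (\<Sum>j\<in>A. h j)"
  using assms
proof (induction A rule: finite_induct)
  case (insert x F)
  then have "small (B + card F * B) (h x + sum h F)"
    by (intro small_add) auto
  then show ?case using insert by (simp add: algebra_simps)
qed (simp add: small_0)

lemma small_of_nat: "small (real j) (of_nat j)"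
proof -
  have 1: "small 1 1" using K_int[of 1] mu_1 by (simp add: small_def)
  show ?thesis
  proof (induction j)
    case (Suc j)
    from small_add[OF 1 this] show ?case by (simp add: algebra_simps)
  qed (simp add: small_0)
qed

lemma small_diff: "small A x \<Longrightarrow> small B y \<Longrightarrow> small (A + B) (x - y)"
  unfolding small_def using K_diff[of x y] mu_diff[of x y] by linarith

lemma small_mult: "small A x \<Longrightarrow> small B y \<Longrightarrow> small (A + B) (x * y)"
  unfolding small_def using K_mult[of x y] mu_mult[of x y] by linarith

lemma small_divide: "small A x \<Longrightarrow> small B y \<Longrightarrow> small (A + B) (x / y)"
  unfolding small_def using K_divide[of x y] mu_divide[of x y] by linarith

lemma one_le_scaled:
  fixes k B :: real
  assumes "1 \<le> k" "0 \<le> B"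
  shows "k \<le> k * (1 + B)" "B \<le> k * (1 + B)"
proof -
  show "k \<le> k * (1 + B)" using assms by simp
  have "B \<le> 1 * (1 + B)" by simp
  also have "\<dots> \<le> k * (1 + B)" using assms by (intro mult_right_mono) auto
  finally show "B \<le> k * (1 + B)" .
qed

section \<open>Linear bounds on sizes and costs of expressions and loop-free programs\<close>

definition rexp_bound :: "rexp \<Rightarrow> real \<Rightarrow> bool" where
  "rexp_bound e k \<longleftrightarrow> 0 \<le> k \<and> (\<forall>st B. 0 \<le> B \<longrightarrow> bounded_state B st \<longrightarrow>
     small (k * (1 + B)) (rval st e) \<and> real (rcost sz st e) \<le> k * (1 + B))"

definition bexp_bound :: "bexp \<Rightarrow> real \<Rightarrow> bool" where
  "bexp_bound e k \<longleftrightarrow> 0 \<le> k \<and> (\<forall>st B. 0 \<le> B \<longrightarrow> bounded_state B st \<longrightarrow>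
     real (bcost sz st e) \<le> k * (1 + B))"

definition com_bound :: "com \<Rightarrow> real \<Rightarrow> bool" where
  "com_bound c k \<longleftrightarrow> 1 \<le> k \<and> (\<forall>orc st B. 0 \<le> B \<longrightarrow> bounded_state B st \<longrightarrow>
     (\<exists>t. exec orc sz c st t (sem orc c st) \<and> real t \<le> k * (1 + B)) \<and>
     bounded_state (k * (1 + B)) (sem orc c st))"

text \<open>With s = (k + l)(1 + B) bounding the height of the result, its size is at most r0 (1 +
  s), and evaluating the operands costs at most s more; this is the origin of the constant.\<close>

lemma rexp_bound_op:
  fixes k l :: real
  assumes op: "\<And>A B x y. small A x \<Longrightarrow> small B y \<Longrightarrow> small (A + B) (ff x y)"
    and val: "\<And>st. rval st e = ff (rval st e1) (rval st e2)"
    and cost: "\<And>st. rcost sz st e = sz (rval st e) + rcost sz st e1 + rcost sz st e2"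
    and 1: "rexp_bound e1 k" and 2: "rexp_bound e2 l"
  shows "rexp_bound e (real r0 + (real r0 + 1) * (k + l))" (is "rexp_bound e ?m")
  unfolding rexp_bound_def
proof (intro conjI allI impI)
  have kl: "0 \<le> k" "0 \<le> l" using 1 2 by (auto simp: rexp_bound_def)
  then show "0 \<le> ?m" by simp
  fix st and B :: real assume B: "0 \<le> B" "bounded_state B st"
  let ?s = "k * (1 + B) + l * (1 + B)"
  have 3: "small (k * (1 + B)) (rval st e1)" "real (rcost sz st e1) \<le> k * (1 + B)"
      "small (l * (1 + B)) (rval st e2)" "real (rcost sz st e2) \<le> l * (1 + B)"
    using 1 2 B by (auto simp: rexp_bound_def)
  have s: "small ?s (rval st e)" unfolding val by (intro op 3)
  have nn: "0 \<le> ?s" and bB: "0 \<le> real r0 * B" "0 \<le> real r0 * ?s" using kl B by simp_all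
  have e: "?m * (1 + B) = real r0 + real r0 * B + real r0 * ?s + ?s" by (simp add: algebra_simps)
  show "small (?m * (1 + B)) (rval st e)"
    using s unfolding e by (rule small_mono) (use nn bB in linarith)
  have "real (sz (rval st e)) \<le> real r0 + real r0 * ?s" using small_sz[OF s] by (simp add: algebra_simps)
  then show "real (rcost sz st e) \<le> ?m * (1 + B)"
    unfolding e cost of_nat_add using 3(2,4) bB by linarith
qed

lemma rexp_bound_exists: "\<exists>k. rexp_bound e k"
proof (induction e)
  case (RConst c)
  let ?k = "max (max 0 (mu (of_int c))) (real (sz (of_int c)))"
  have "?k \<le> ?k * (1 + B)" if "0 \<le> B" for B
    using that mult_left_mono[of 1 "1 + B" ?k] by simp
  then have "rexp_bound (RConst c) ?k"
    by (auto simp: rexp_bound_def small_def K_int intro: order.trans[of _ ?k])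
  then show ?case ..
next
  case (RGet x es)
  let ?k = "1 + real r0 + real (sum_list (map ncost es))"
  have "rexp_bound (RGet x es) ?k" unfolding rexp_bound_def
  proof (intro conjI allI impI)
    fix st and B :: real assume B: "0 \<le> B" "bounded_state B st"
    have s: "small B (rval st (RGet x es))" using B by (simp add: bounded_state_def)
    have p: "0 \<le> real r0 * B" "0 \<le> real (sum_list (map ncost es)) * B" using B by simp_all
    have "B \<le> ?k * (1 + B)" using B p by (simp add: algebra_simps)
    with s show "small (?k * (1 + B)) (rval st (RGet x es))" by (rule small_mono)
    have "?k * (1 + B) = 1 + B + r0 + r0 * B + sum_list (map ncost es) + sum_list (map ncost es) * B"
      by (simp add: algebra_simps)
    moreover have "real (sz (rval st (RGet x es))) \<le> r0 + r0 * B"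
      using small_sz[OF s] by (simp add: algebra_simps)
    ultimately show "real (rcost sz st (RGet x es)) \<le> ?k * (1 + B)"
      unfolding rcost.simps of_nat_add using p B(1) by linarith
  qed simp
  then show ?case ..
next
  case (RAdd e1 e2)
  then obtain k l where kl: "rexp_bound e1 k" "rexp_bound e2 l" by metis
  show ?case by (rule exI, rule rexp_bound_op[OF small_add _ _ kl]) simp_all
next
  case (RSub e1 e2)
  then obtain k l where kl: "rexp_bound e1 k" "rexp_bound e2 l" by metis
  show ?case by (rule exI, rule rexp_bound_op[OF small_diff _ _ kl]) simp_all
next
  case (RMul e1 e2)
  then obtain k l where kl: "rexp_bound e1 k" "rexp_bound e2 l" by metis
  show ?case by (rule exI, rule rexp_bound_op[OF small_mult _ _ kl]) simp_all
next
  case (RDiv e1 e2)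
  then obtain k l where kl: "rexp_bound e1 k" "rexp_bound e2 l" by metis
  show ?case by (rule exI, rule rexp_bound_op[OF small_divide _ _ kl]) simp_all
qed

lemma bexp_bound_exists: "\<exists>k. bexp_bound e k"
proof (induction e)
  case (NLe e1 e2)
  let ?k = "real (1 + ncost e1 + ncost e2)"
  have "?k \<le> ?k * (1 + B)" if "0 \<le> B" for B
    using that mult_left_mono[of 1 "1 + B" ?k] by simp
  then have "bexp_bound (NLe e1 e2) ?k" by (simp add: bexp_bound_def)
  then show ?case ..
next
  case (RLe e1 e2)
  from rexp_bound_exists obtain k l where kl: "rexp_bound e1 k" "rexp_bound e2 l" by metis
  have "bexp_bound (RLe e1 e2) (1 + k + l)" unfolding bexp_bound_def
  proof (intro conjI allI impI)
    show "0 \<le> 1 + k + l" using kl by (simp add: rexp_bound_def)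
    fix st and B :: real assume B: "0 \<le> B" "bounded_state B st"
    then have "real (rcost sz st e1) \<le> k * (1 + B)" "real (rcost sz st e2) \<le> l * (1 + B)"
      using kl by (auto simp: rexp_bound_def)
    then show "real (bcost sz st (RLe e1 e2)) \<le> (1 + k + l) * (1 + B)"
      using B(1) by (simp add: algebra_simps)
  qed
  then show ?case ..
next
  case (BNot e)
  then obtain k where k: "bexp_bound e k" ..
  have "bexp_bound (BNot e) (1 + k)" unfolding bexp_bound_def
  proof (intro conjI allI impI)
    show "0 \<le> 1 + k" using k by (simp add: bexp_bound_def)
    fix st and B :: real assume B: "0 \<le> B" "bounded_state B st"
    then have "real (bcost sz st e) \<le> k * (1 + B)" using k by (auto simp: bexp_bound_def)
    then show "real (bcost sz st (BNot e)) \<le> (1 + k) * (1 + B)"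
      using B(1) by (simp add: algebra_simps)
  qed
  then show ?case ..
next
  case (BAnd e1 e2)
  then obtain k l where kl: "bexp_bound e1 k" "bexp_bound e2 l" by metis
  have "bexp_bound (BAnd e1 e2) (1 + k + l)" unfolding bexp_bound_def
  proof (intro conjI allI impI)
    show "0 \<le> 1 + k + l" using kl by (simp add: bexp_bound_def)
    fix st and B :: real assume B: "0 \<le> B" "bounded_state B st"
    then have "real (bcost sz st e1) \<le> k * (1 + B)" "real (bcost sz st e2) \<le> l * (1 + B)"
      using kl by (auto simp: bexp_bound_def)
    then show "real (bcost sz st (BAnd e1 e2)) \<le> (1 + k + l) * (1 + B)"
      using B(1) by (simp add: algebra_simps)
  qed
  then show ?case ..
qed

lemma bounded_state_mono: "bounded_state B st \<Longrightarrow> B \<le> B' \<Longrightarrow> bounded_state B' st"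
  by (auto simp: bounded_state_def intro: small_mono)

lemma bounded_state_set_nat [simp]: "bounded_state B (set_nat x is v st) = bounded_state B st"
  by (simp add: bounded_state_def set_nat_def)

lemma bounded_state_set_real:
  "bounded_state B st \<Longrightarrow> small B r \<Longrightarrow> bounded_state B (set_real x is r st)"
  by (simp add: bounded_state_def set_real_def)

text \<open>Each assignment may multiply the memory bound by a constant, and the finitely many
  factors of a fixed program compose to another constant. A loop would compound them without
  limit.\<close>

lemma com_bound_exists: "loop_free c \<Longrightarrow> \<exists>k. com_bound c k"
proof (induction c)
  case Skip
  have "\<exists>t. exec orc sz Skip st t st \<and> real t \<le> 1 + B" if "0 \<le> B" for orc st and B :: real
    using exec_Skip[of orc sz st] that by (intro exI[of _ 1]) simp
  then have "com_bound Skip 1" by (auto simp: com_bound_def intro: bounded_state_mono)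
  then show ?case ..
next
  case (NSet x es e)
  let ?k = "real (1 + sum_list (map ncost es) + ncost e)"
  have k: "?k \<le> ?k * (1 + B)" "B \<le> ?k * (1 + B)" if "0 \<le> B" for B
    using that one_le_scaled[of ?k B] by simp_all
  have "com_bound (NSet x es e) ?k" unfolding com_bound_def
  proof (intro conjI allI impI)
    fix orc st and B :: real assume B: "0 \<le> B" "bounded_state B st"
    show "\<exists>t. exec orc sz (NSet x es e) st t (sem orc (NSet x es e) st) \<and> real t \<le> ?k * (1 + B)"
      using exec_NSet[of orc sz x es e st] k(1)[OF B(1)] by (metis sem.simps(2))
    show "bounded_state (?k * (1 + B)) (sem orc (NSet x es e) st)"
      using bounded_state_mono[OF B(2) k(2)[OF B(1)]] by simp
  qed simp
  then show ?case ..
next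
  case (RSet x es e)
  from rexp_bound_exists obtain l where l: "rexp_bound e l" ..
  then have l0: "0 \<le> l" by (simp add: rexp_bound_def)
  let ?k = "1 + real (sum_list (map ncost es)) + l"
  have "com_bound (RSet x es e) ?k" unfolding com_bound_def
  proof (intro conjI allI impI)
    show "1 \<le> ?k" using l0 by simp
    fix orc st and B :: real assume B: "0 \<le> B" "bounded_state B st"
    have p: "0 \<le> real (sum_list (map ncost es)) * B" "0 \<le> l * B" using l0 B by simp_all
    have e: "small (l * (1 + B)) (rval st e)" "real (rcost sz st e) \<le> l * (1 + B)"
      using l B by (auto simp: rexp_bound_def)
    have "?k * (1 + B) = 1 + B + sum_list (map ncost es) + sum_list (map ncost es) * B + l * (1 + B)"
      by (simp add: algebra_simps)
    then have "real (1 + sum_list (map ncost es) + rcost sz st e) \<le> ?k * (1 + B)"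
      unfolding of_nat_add using e(2) p B by linarith
    then show "\<exists>t. exec orc sz (RSet x es e) st t (sem orc (RSet x es e) st) \<and> real t \<le> ?k * (1 + B)"
      using exec_RSet[of orc sz x es e st] by fastforce
    have "B \<le> ?k * (1 + B)" "l * (1 + B) \<le> ?k * (1 + B)" 
      using p B l0 by (simp_all add: algebra_simps)
    then show "bounded_state (?k * (1 + B)) (sem orc (RSet x es e) st)"
      using bounded_state_set_real[OF bounded_state_mono[OF B(2)] small_mono[OF e(1)]] by simp
  qed
  then show ?case ..
next
  case (Query x es a c)
  let ?k = "real (1 + sum_list (map ncost es))"
  have k: "?k \<le> ?k * (1 + B)" "B \<le> ?k * (1 + B)" if "0 \<le> B" for B
    using that one_le_scaled[of ?k B] by simp_all
  have "\<exists>t. exec orc sz (Query x es a c) st t (sem orc (Query x es a c) st) \<and> real t \<le> ?k * (1 + B)"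
    if "0 \<le> B" for B st orc
    using exec_Query[of orc sz x es a c st] k(1)[OF that] by (metis sem.simps(4))
  moreover have "bounded_state (?k * (1 + B)) (sem orc (Query x es a c) st)"
    if "0 \<le> B" "bounded_state B st" for B st orc
    using bounded_state_mono[OF that(2) k(2)[OF that(1)]] by simp
  moreover have "1 \<le> ?k" by simp
  ultimately have "com_bound (Query x es a c) ?k" unfolding com_bound_def by blast
  then show ?case ..
next
  case (Seq c1 c2)
  then obtain k l where k: "com_bound c1 k" and l: "com_bound c2 l" by auto
  then have kl: "1 \<le> k" "1 \<le> l" by (auto simp: com_bound_def)
  \<comment> \<open>\<open>c2\<close> starts from memory bounded by \<open>k * (1 + B)\<close>, so
    \<open>l\<close> multiplies \<open>1 + k * (1 + B)\<close>, which is at most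
    \<open>(1 + k) * (1 + B)\<close>.\<close>
  let ?m = "1 + k + l * (1 + k)"
  have "com_bound (Seq c1 c2) ?m" unfolding com_bound_def
  proof (intro conjI allI impI)
    show "1 \<le> ?m" using kl by simp
    fix orc st and B :: real assume B: "0 \<le> B" "bounded_state B st"
    let ?st = "sem orc c1 st" and ?B = "k * (1 + B)"
    have B': "0 \<le> ?B" using kl B by simp
    obtain t1 where t1: "exec orc sz c1 st t1 ?st" "real t1 \<le> ?B" and bd: "bounded_state ?B ?st"
      using k B unfolding com_bound_def by blast
    obtain t2 where t2: "exec orc sz c2 ?st t2 (sem orc c2 ?st)" "real t2 \<le> l * (1 + ?B)"
      and bd2: "bounded_state (l * (1 + ?B)) (sem orc c2 ?st)"
      using l B' bd unfolding com_bound_def by blast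
    have lb: "l * (1 + ?B) \<le> l * (1 + k) * (1 + B)" and kb: "0 \<le> (1 + k) * (1 + B)"
      using kl B by (simp_all add: algebra_simps)
    have "real (1 + t1 + t2) \<le> ?m * (1 + B)"
      using t1(2) t2(2) lb B by (simp add: algebra_simps)
    with exec_Seq[OF t1(1) t2(1)]
    show "\<exists>t. exec orc sz (Seq c1 c2) st t (sem orc (Seq c1 c2) st) \<and> real t \<le> ?m * (1 + B)"
      by (metis sem.simps(5))
    have "l * (1 + ?B) \<le> ?m * (1 + B)" using lb kb by (simp add: algebra_simps)
    with bd2 show "bounded_state (?m * (1 + B)) (sem orc (Seq c1 c2) st)"
      by (auto intro: bounded_state_mono)
  qed
  then show ?case ..
next
  case (Cond e c1 c2)
  then obtain k l where k: "com_bound c1 k" and l: "com_bound c2 l" by auto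
  from bexp_bound_exists obtain h where h: "bexp_bound e h" ..
  have klh: "1 \<le> k" "1 \<le> l" "0 \<le> h" using k l h by (auto simp: com_bound_def bexp_bound_def)
  let ?m = "1 + h + k + l"
  have "com_bound (Cond e c1 c2) ?m" unfolding com_bound_def
  proof (intro conjI allI impI)
    show "1 \<le> ?m" using klh by simp
    fix orc st and B :: real assume B: "0 \<le> B" "bounded_state B st"
    have p: "0 \<le> k * (1 + B)" "0 \<le> l * (1 + B)" "0 \<le> h * (1 + B)" using B(1) klh by auto
    have e: "?m * (1 + B) = 1 + B + h * (1 + B) + k * (1 + B) + l * (1 + B)"
      by (simp add: algebra_simps)
    have kl: "k * (1 + B) \<le> ?m * (1 + B)" "l * (1 + B) \<le> ?m * (1 + B)"
      unfolding e using p B(1) by linarith+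
    have he: "real (bcost sz st e) \<le> h * (1 + B)" using h B by (auto simp: bexp_bound_def)
    obtain t1 where t1: "exec orc sz c1 st t1 (sem orc c1 st)" "real t1 \<le> k * (1 + B)"
      and b1: "bounded_state (k * (1 + B)) (sem orc c1 st)"
      using k B unfolding com_bound_def by blast
    obtain t2 where t2: "exec orc sz c2 st t2 (sem orc c2 st)" "real t2 \<le> l * (1 + B)"
      and b2: "bounded_state (l * (1 + B)) (sem orc c2 st)"
      using l B unfolding com_bound_def by blast
    have "real (1 + bcost sz st e + t1) \<le> ?m * (1 + B)" "real (1 + bcost sz st e + t2) \<le> ?m * (1 + B)"
      unfolding e of_nat_add using p t1(2) t2(2) he B(1) by linarith+
    then show "\<exists>t. exec orc sz (Cond e c1 c2) st t (sem orc (Cond e c1 c2) st) \<and> real t \<le> ?m * (1 + B)"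
      using exec_Cond_true[OF _ t1(1), of e c2] exec_Cond_false[OF _ t2(1), of e c1]
      by (cases "bval st e") (metis sem.simps(6))+
    show "bounded_state (?m * (1 + B)) (sem orc (Cond e c1 c2) st)"
      using b1 b2 kl by (auto intro: bounded_state_mono)
  qed
  then show ?case ..
qed simp

end

section \<open>Total correctness within polynomial time\<close>

text \<open>
  The variable \<open>x\<close> ranges over problem instances together with logical variables; \<open>N x\<close> is the
  size of the instance. The polynomial bound is uniform in \<open>x\<close>.
\<close>

definition ptriple :: "(real \<Rightarrow> nat) \<Rightarrow> ('x \<Rightarrow> nat) \<Rightarrow> ('x \<Rightarrow> oracle2) \<Rightarrow>
    ('x \<Rightarrow> state \<Rightarrow> bool) \<Rightarrow> com \<Rightarrow> ('x \<Rightarrow> state \<Rightarrow> bool) \<Rightarrow> bool" where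
  "ptriple sz N orc P c Q \<longleftrightarrow> (\<exists>a. \<forall>x st. P x st \<longrightarrow>
     (\<exists>t st'. exec (orc x) sz c st t st' \<and> t \<le> a * Suc (N x) ^ a \<and> Q x st'))"

text \<open>The logical variable may be re-instantiated depending on the start state, so that ghost
  values can be chosen anew at each call; size and oracle must stay the same.\<close>

lemma ptriple_conseq:
  assumes "ptriple sz N orc P c Q"
    and "\<And>x st. P' x st \<Longrightarrow> \<exists>y. P y st \<and> N y = N' x \<and> orc y = orc' x \<and> (\<forall>st'. Q y st' \<longrightarrow> Q' x st')"
  shows "ptriple sz N' orc' P' c Q'"
proof -
  from assms(1) obtain a where a: "\<And>x st. P x st \<Longrightarrow>
      \<exists>t st'. exec (orc x) sz c st t st' \<and> t \<le> a * Suc (N x) ^ a \<and> Q x st'"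
    unfolding ptriple_def by blast
  show ?thesis unfolding ptriple_def
  proof (rule exI[of _ a], intro allI impI)
    fix x st assume "P' x st"
    from assms(2)[OF this] obtain y where y: "P y st" "N y = N' x" "orc y = orc' x"
      "\<And>st'. Q y st' \<Longrightarrow> Q' x st'" by blast
    from a[OF y(1)] y(2-4) show "\<exists>t st'. exec (orc' x) sz c st t st' \<and> t \<le> a * Suc (N' x) ^ a \<and> Q' x st'"
      by auto
  qed
qed

lemma ptriple_seq:
  assumes "ptriple sz N orc P c1 Q" "ptriple sz N orc Q c2 R"
  shows "ptriple sz N orc P (Seq c1 c2) R"
proof -
  from assms(1) obtain a where a: "\<And>x st. P x st \<Longrightarrow>
      \<exists>t st'. exec (orc x) sz c1 st t st' \<and> t \<le> a * Suc (N x) ^ a \<and> Q x st'"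
    unfolding ptriple_def by blast
  from assms(2) obtain d where d: "\<And>x st. Q x st \<Longrightarrow>
      \<exists>t st'. exec (orc x) sz c2 st t st' \<and> t \<le> d * Suc (N x) ^ d \<and> R x st'"
    unfolding ptriple_def by blast
  show ?thesis unfolding ptriple_def
  \<comment> \<open>One number is both coefficient and exponent, so the sum of the two, plus 1 for
    the sequencing step, dominates both bounds at once.\<close>
  proof (rule exI[of _ "1 + a + d"], intro allI impI)
    fix x st assume "P x st"
    from a[OF this] obtain t st1 where
      1: "exec (orc x) sz c1 st t st1" "t \<le> a * Suc (N x) ^ a" "Q x st1" by blast
    from d[OF 1(3)] obtain u st2 where
      2: "exec (orc x) sz c2 st1 u st2" "u \<le> d * Suc (N x) ^ d" "R x st2" by blast
    let ?S = "Suc (N x) ^ (1 + a + d)"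
    have "a * Suc (N x) ^ a \<le> a * ?S" "d * Suc (N x) ^ d \<le> d * ?S" "1 \<le> ?S"
      by (intro mult_left_mono power_increasing; simp)+ (intro one_le_power; simp)
    then have "1 + t + u \<le> (1 + a + d) * ?S"
      unfolding distrib_right using 1(2) 2(2) by linarith
    with exec_Seq[OF 1(1) 2(1)] 2(3)
    show "\<exists>t st'. exec (orc x) sz (Seq c1 c2) st t st' \<and> t \<le> (1 + a + d) * ?S \<and> R x st'"
      by blast
  qed
qed

section \<open>Counting loops\<close>

text \<open>The counter may be an array cell, because the entries of a guess will themselves be loop
  counters.\<close>

definition For :: "string \<Rightarrow> nat list \<Rightarrow> nat \<Rightarrow> com \<Rightarrow> com" where
  "For y is lo c = Seq (NSet y (map NConst is) (NConst lo))
     (While (NLe (NGet y (map NConst is)) (NGet ''n'' []))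
        (Seq c (NSet y (map NConst is) (NAdd (NGet y (map NConst is)) (NConst 1)))))"

lemma nval_NConst [simp]: "map (nval st) (map NConst is) = is" "map (nval st \<circ> NConst) is = is"
  by (induction "is") auto

lemma ncost_NConst [simp]: "sum_list (map ncost (map NConst is)) = length is"
  "sum_list (map (ncost \<circ> NConst) is) = length is"
  by (induction "is") auto

lemma nats_set_nat: "nats (set_nat x is v st) y js = (if y = x \<and> js = is then v else nats st y js)"
  by (auto simp: set_nat_def)

lemma reals_set_nat [simp]: "reals (set_nat x is v st) = reals st"
  by (simp add: set_nat_def)

text \<open>There are at most \<open>Suc (N x)\<close> rounds, and the bound for the body is uniform
  in the counter because \<open>v\<close> belongs to its logical variable. \<open>I x v\<close>
  describes the state before round \<open>v\<close>; by \<open>lo \<le> 1\<close> the counter ends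
  at \<open>Suc (n x)\<close> even if there is no round.\<close>

lemma ptriple_For:
  fixes N :: "'x \<Rightarrow> nat"
  assumes init: "\<And>x st. P x st \<Longrightarrow> I x lo (set_nat y is lo st)"
    and body: "ptriple sz (\<lambda>(x, v). N x) (\<lambda>(x, v). orc x)
       (\<lambda>(x, v) st. lo \<le> v \<and> v \<le> n x \<and> nats st y is = v \<and> I x v st) c
       (\<lambda>(x, v) st. nats st y is = v \<and> I x (Suc v) (set_nat y is (Suc v) st))"
    and n: "\<And>x v st. I x v st \<Longrightarrow> nats st ''n'' [] = n x \<and> n x \<le> N x"
    and lo: "lo \<le> 1"
    and fin: "\<And>x st. I x (Suc (n x)) st \<Longrightarrow> nats st y is = Suc (n x) \<Longrightarrow> Q x st"
  shows "ptriple sz N orc P (For y is lo c) Q"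
proof -
  let ?c = "Seq c (NSet y (map NConst is) (NAdd (NGet y (map NConst is)) (NConst 1)))"
  let ?b = "NLe (NGet y (map NConst is)) (NGet ''n'' [])"
  let ?w = "While ?b ?c"
  from body obtain a where a: "\<And>x v st. lo \<le> v \<Longrightarrow> v \<le> n x \<Longrightarrow> nats st y is = v \<Longrightarrow> I x v st \<Longrightarrow>
      \<exists>t st'. exec (orc x) sz c st t st' \<and> t \<le> a * Suc (N x) ^ a \<and>
        nats st' y is = v \<and> I x (Suc v) (set_nat y is (Suc v) st')"
    unfolding ptriple_def split_paired_All split by blast
  \<comment> \<open>Generous room for one test and one increment, whose costs are linear in
    \<open>length is\<close>, plus the coefficient of the body.\<close>
  define D where "D = 20 + 5 * length is + a"
  have w: "\<exists>t st'. exec (orc x) sz ?w st t st' \<and>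
       t \<le> (Suc (n x) - v) * (D * Suc (N x) ^ a) + D \<and>
       I x (Suc (n x)) st' \<and> nats st' y is = Suc (n x)"
    if "lo \<le> v" "v \<le> Suc (n x)" "nats st y is = v" "I x v st" for x v st
    using that
  proof (induction "Suc (n x) - v" arbitrary: v st)
    case 0
    then have v: "v = Suc (n x)" by simp
    with n[OF 0(5)] 0 have "\<not> bval st ?b" by simp
    note ex = exec_While_false[OF this, of "orc x" sz ?c]
    show ?case using 0 v
      by (intro exI conjI) (rule ex, auto simp: D_def)
  next
    case (Suc m)
    then have v: "v \<le> n x" by simp
    with n[OF Suc.prems(4)] Suc.prems have bt: "bval st ?b" by simp
    from a[OF \<open>lo \<le> v\<close> v Suc.prems(3,4)] obtain t st1 where
      1: "exec (orc x) sz c st t st1" "t \<le> a * Suc (N x) ^ a" "nats st1 y is = v"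
         "I x (Suc v) (set_nat y is (Suc v) st1)" by blast
    let ?st2 = "set_nat y is (Suc v) st1"
    have inc: "exec (orc x) sz (NSet y (map NConst is) (NAdd (NGet y (map NConst is)) (NConst 1)))
       st1 (1 + length is + (1 + (1 + length is) + 1)) ?st2"
      using exec_NSet[of "orc x" sz y "map NConst is" "NAdd (NGet y (map NConst is)) (NConst 1)" st1]
        1(3) by simp
    have "\<exists>u st3. exec (orc x) sz ?w ?st2 u st3 \<and>
        u \<le> (Suc (n x) - Suc v) * (D * Suc (N x) ^ a) + D \<and>
        I x (Suc (n x)) st3 \<and> nats st3 y is = Suc (n x)"
      by (rule Suc.hyps(1)) (use Suc.hyps(2) Suc.prems v 1(4) in \<open>auto simp: nats_set_nat\<close>)
    then obtain u st3 where
      3: "exec (orc x) sz ?w ?st2 u st3"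
        "u \<le> (Suc (n x) - Suc v) * (D * Suc (N x) ^ a) + D"
        "I x (Suc (n x)) st3" "nats st3 y is = Suc (n x)"
      by blast
    note ex = exec_While_true[OF bt exec_Seq[OF 1(1) inc] 3(1)]
    have p: "1 \<le> Suc (N x) ^ a" by (intro one_le_power) simp
    have "(20 + 5 * length is) * 1 + t \<le> (20 + 5 * length is) * Suc (N x) ^ a + a * Suc (N x) ^ a"
      by (intro add_mono mult_le_mono2 p 1(2))
    also have "\<dots> = D * Suc (N x) ^ a" by (simp add: D_def algebra_simps)
    finally have le: "20 + 5 * length is + t \<le> D * Suc (N x) ^ a" by simp
    have "Suc (n x) - v = Suc (Suc (n x) - Suc v)" using v by simp
    then have e: "(Suc (n x) - v) * (D * Suc (N x) ^ a) =
        D * Suc (N x) ^ a + (Suc (n x) - Suc v) * (D * Suc (N x) ^ a)" by simp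
    have "1 + bcost sz st ?b + (1 + t + (1 + length is + (1 + (1 + length is) + 1))) + u
       \<le> (Suc (n x) - v) * (D * Suc (N x) ^ a) + D"
      unfolding e using le 3(2) by simp
    with ex 3 show ?case by blast
  qed
  \<comment> \<open>Three terms with coefficient \<open>D\<close>: the rounds, the last test and the
    initialization. The exponent rises by one for the number of rounds.\<close>
  define A where "A = 3 * D + Suc a"
  show ?thesis unfolding ptriple_def
  proof (rule exI[of _ A], intro allI impI)
    fix x st assume "P x st"
    then have I: "I x lo (set_nat y is lo st)" by (rule init)
    have 1: "exec (orc x) sz (NSet y (map NConst is) (NConst lo)) st (2 + length is) (set_nat y is lo st)"
      using exec_NSet[of "orc x" sz y "map NConst is" "NConst lo" st] by simp
    from w[of lo x "set_nat y is lo st"] I lo obtain t st' where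
      2: "exec (orc x) sz ?w (set_nat y is lo st) t st'"
         "t \<le> (Suc (n x) - lo) * (D * Suc (N x) ^ a) + D"
         "I x (Suc (n x)) st'" "nats st' y is = Suc (n x)"
      by (auto simp: nats_set_nat)
    have nN: "Suc (n x) - lo \<le> Suc (N x)" using n[OF I] by linarith
    have p: "1 \<le> Suc (N x) ^ Suc a" by (intro one_le_power) simp
    have "1 + (2 + length is) + t \<le> (Suc (n x) - lo) * (D * Suc (N x) ^ a) + 2 * D"
      using 2(2) by (simp add: D_def)
    also have "\<dots> \<le> Suc (N x) * (D * Suc (N x) ^ a) + 2 * D"
      using mult_right_mono[OF nN, of "D * Suc (N x) ^ a"] by simp
    also have "\<dots> = D * Suc (N x) ^ Suc a + D + D"
      by (simp only: power_Suc mult_2 mult.left_commute add.assoc)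
    also have "\<dots> \<le> 3 * D * Suc (N x) ^ Suc a"
    proof -
      have "D * 1 \<le> D * Suc (N x) ^ Suc a" by (rule mult_le_mono2[OF p])
      then show ?thesis by (simp only: mult.assoc mult_1_right)
    qed
    also have "\<dots> \<le> (3 * D + Suc a) * Suc (N x) ^ (3 * D + Suc a)"
      by (intro mult_mono power_increasing) auto
    finally have "1 + (2 + length is) + t \<le> A * Suc (N x) ^ A" unfolding A_def .
    with exec_Seq[OF 1 2(1)] fin[OF 2(3,4)]
    show "\<exists>t st'. exec (orc x) sz (For y is lo c) st t st' \<and> t \<le> A * Suc (N x) ^ A \<and> Q x st'"
      unfolding For_def by blast
  qed
qed

text \<open>The memory bound is demanded of the start state instead of being derived from what ran
  before. In a loop it comes from the invariant, so the factor in \<open>com_bound\<close> never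
  compounds.\<close>

lemma (in size_measure) ptriple_loop_free:
  assumes "loop_free c"
    and "\<And>x st. P x st \<Longrightarrow> bounded_state (real (Suc (N x) ^ e)) st"
    and "\<And>x st. P x st \<Longrightarrow> Q x (sem (orc x) c st)"
  shows "ptriple sz N orc P c Q"
proof -
  from com_bound_exists[OF assms(1)] obtain k where k: "k \<ge> 1"
    "\<And>orc st B. 0 \<le> B \<Longrightarrow> bounded_state B st \<Longrightarrow>
       \<exists>t. exec orc sz c st t (sem orc c st) \<and> real t \<le> k * (1 + B)"
    unfolding com_bound_def by blast
  define a where "a = 2 * nat \<lceil>k\<rceil> + e"
  show ?thesis unfolding ptriple_def
  proof (rule exI[of _ a], intro allI impI)
    fix x st assume P: "P x st"
    let ?S = "Suc (N x)"
    from k(2)[OF _ assms(2)[OF P]] obtain t where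
      t: "exec (orc x) sz c st t (sem (orc x) c st)" "real t \<le> k * (1 + real (?S ^ e))"
      by (metis of_nat_0_le_iff)
    have p: "1 \<le> ?S ^ e" by (intro one_le_power) simp
    have "k * (1 + real (?S ^ e)) \<le> real (nat \<lceil>k\<rceil>) * real (2 * ?S ^ e)"
      using k(1) p by (intro mult_mono) linarith+
    with t(2) have "t \<le> real (nat \<lceil>k\<rceil> * (2 * ?S ^ e))" by simp
    then have "t \<le> (2 * nat \<lceil>k\<rceil>) * ?S ^ e" by linarith
    also have "\<dots> \<le> a * ?S ^ a" by (intro mult_mono power_increasing) (auto simp: a_def)
    finally show "\<exists>t st'. exec (orc x) sz c st t st' \<and> t \<le> a * ?S ^ a \<and> Q x st'"
      using t(1) assms(3)[OF P] by blast
  qed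
qed

section \<open>Logarithmic height of rational numbers\<close>

text \<open>Numerator plus denominator instead of their maximum: the product of two such sums
  expands into all terms of the sum of the fractions, so heights are submultiplicative without a
  constant factor, and 0 has height 1.\<close>

definition height :: "rat \<Rightarrow> int" where
  "height r = \<bar>fst (quotient_of r)\<bar> + snd (quotient_of r)"

lemma height_ge_1: "1 \<le> height r"
  using quotient_of_denom_pos'[of r] by (simp add: height_def)

text \<open>Cancelling a common factor \<open>k \<ge> 1\<close> divides
  \<open>\<bar>a\<bar> + b\<close> by \<open>k\<close>. So heights can be estimated from unreduced
  fractions.\<close>

lemma height_le:
  assumes "b > 0"
  shows "height (of_int a / of_int b) \<le> \<bar>a\<bar> + b"
proof -
  obtain p q where pq: "quotient_of (of_int a / of_int b) = (p, q)" by fastforce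
  have q: "q > 0" using quotient_of_denom_pos[OF pq] .
  have "(of_int a :: rat) / of_int b = of_int p / of_int q" using quotient_of_div[OF pq] .
  then have "(of_int (a * q) :: rat) = of_int (p * b)" using q assms by (simp add: field_simps)
  then have e: "a * q = p * b" by (simp only: of_int_eq_iff)
  have cop: "coprime q p" using quotient_of_coprime[OF pq] by (simp add: coprime_commute)
  have "q dvd p * b" unfolding e[symmetric] by simp
  then have "q dvd b" using cop coprime_dvd_mult_right_iff by blast
  then obtain k where k: "b = q * k" by (elim dvdE)
  have k0: "k > 0" using k q assms by (simp add: zero_less_mult_iff)
  have "a = p * k" using e k q by simp
  then have "\<bar>a\<bar> + b = k * (\<bar>p\<bar> + q)" using k k0 by (simp add: abs_mult algebra_simps)
  moreover have "1 * (\<bar>p\<bar> + q) \<le> k * (\<bar>p\<bar> + q)" using k0 q by (intro mult_right_mono) auto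
  ultimately show ?thesis unfolding height_def pq by simp
qed

lemma height_rep:
  obtains a b where "r = of_int a / of_int b" "b > 0" "height r = \<bar>a\<bar> + b"
  using quotient_of_div[of r] quotient_of_denom_pos[of r] unfolding height_def
  by (metis fst_conv prod.exhaust snd_conv)

lemma height_binop:
  fixes ff :: "rat \<Rightarrow> rat \<Rightarrow> rat"
  assumes "\<And>a b c d. b > 0 \<Longrightarrow> d > 0 \<Longrightarrow> \<exists>p q. ff (of_int a / of_int b) (of_int c / of_int d) = of_int p / of_int q
      \<and> q > 0 \<and> \<bar>p\<bar> + q \<le> (\<bar>a\<bar> + b) * (\<bar>c\<bar> + d)"
  shows "height (ff r s) \<le> height r * height s"
proof -
  obtain a b where 1: "r = of_int a / of_int b" "b > 0" "height r = \<bar>a\<bar> + b" by (rule height_rep)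
  obtain c d where 2: "s = of_int c / of_int d" "d > 0" "height s = \<bar>c\<bar> + d" by (rule height_rep)
  from assms[OF 1(2) 2(2), of a c] obtain p q where "ff r s = of_int p / of_int q" "q > 0"
    "\<bar>p\<bar> + q \<le> height r * height s" unfolding 1(1)[symmetric] 2(1)[symmetric] 1(3) 2(3) by blast
  then show ?thesis using height_le[of q p] by simp
qed

lemma height_add: "height (r + s) \<le> height r * height s"
proof (rule height_binop)
  fix a b c d :: int assume p: "b > 0" "d > 0"
  have "\<bar>a * d + c * b\<bar> \<le> \<bar>a\<bar> * d + \<bar>c\<bar> * b"
    using p abs_triangle_ineq[of "a * d" "c * b"] by (simp add: abs_mult)
  moreover have "(\<bar>a\<bar> + b) * (\<bar>c\<bar> + d) = \<bar>a\<bar> * d + \<bar>c\<bar> * b + b * d + \<bar>a\<bar> * \<bar>c\<bar>"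
    by (simp add: algebra_simps)
  ultimately have "\<bar>a * d + c * b\<bar> + b * d \<le> (\<bar>a\<bar> + b) * (\<bar>c\<bar> + d)"
    using mult_nonneg_nonneg[OF abs_ge_zero[of a] abs_ge_zero[of c]] by linarith
  moreover have "(of_int a / of_int b :: rat) + of_int c / of_int d = of_int (a * d + c * b) / of_int (b * d)"
    using p by (simp add: field_simps)
  ultimately show "\<exists>p q. (of_int a / of_int b :: rat) + of_int c / of_int d = of_int p / of_int q
      \<and> q > 0 \<and> \<bar>p\<bar> + q \<le> (\<bar>a\<bar> + b) * (\<bar>c\<bar> + d)" using p by (metis mult_pos_pos)
qed

lemma height_minus: "height (- r) = height r"
proof -
  have le: "height (- r) \<le> height r" for r
  proof -
    obtain a b where 1: "r = of_int a / of_int b" "b > 0" "height r = \<bar>a\<bar> + b" by (rule height_rep)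
    have "- r = of_int (- a) / of_int b" using 1 by simp
    then show ?thesis using height_le[OF 1(2), of "- a"] 1(3) by simp
  qed
  from le[of r] le[of "- r"] show ?thesis by simp
qed

lemma height_diff: "height (r - s) \<le> height r * height s"
  using height_add[of r "- s"] by (simp add: height_minus)

lemma height_mult: "height (r * s) \<le> height r * height s"
proof (rule height_binop)
  fix a b c d :: int assume p: "b > 0" "d > 0"
  have "0 \<le> \<bar>a\<bar> * d + \<bar>c\<bar> * b" using p by simp
  then have "\<bar>a * c\<bar> + b * d \<le> (\<bar>a\<bar> + b) * (\<bar>c\<bar> + d)"
    by (simp add: algebra_simps abs_mult)
  moreover have "(of_int a / of_int b :: rat) * (of_int c / of_int d) = of_int (a * c) / of_int (b * d)"
    by simp
  ultimately show "\<exists>p q. (of_int a / of_int b :: rat) * (of_int c / of_int d) = of_int p / of_int q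
      \<and> q > 0 \<and> \<bar>p\<bar> + q \<le> (\<bar>a\<bar> + b) * (\<bar>c\<bar> + d)" using p by (metis mult_pos_pos)
qed

lemma height_inverse: "height (inverse r) \<le> height r"
proof -
  obtain a b where 1: "r = of_int a / of_int b" "b > 0" "height r = \<bar>a\<bar> + b" by (rule height_rep)
  consider "a = 0" | "a > 0" | "a < 0" by linarith
  then show ?thesis
  proof cases
    case 1
    then show ?thesis using \<open>r = _\<close> by simp
  next
    case 2
    have "inverse r = of_int b / of_int a" using 1 by simp
    then show ?thesis using height_le[OF 2, of b] 1 2 by simp
  next
    case 3
    \<comment> \<open>The sign moves to the numerator, since the denominator has to be
      positive.\<close>
    have "inverse r = of_int (- b) / of_int (- a)" using 1 by simp
    then show ?thesis using height_le[of "- a" "- b"] 1 3 by simp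
  qed
qed

lemma height_divide: "height (r / s) \<le> height r * height s"
proof -
  have "height (r * inverse s) \<le> height r * height (inverse s)" by (rule height_mult)
  also have "\<dots> \<le> height r * height s"
    using height_inverse[of s] height_ge_1[of r] by (intro mult_left_mono) auto
  finally show ?thesis by (simp add: divide_inverse)
qed

definition log_height :: "real \<Rightarrow> real" where
  "log_height x = log 2 (height (THE r. of_rat r = x))"

lemma log_height_of_rat: "log_height (of_rat r) = log 2 (height r)"
  by (simp add: log_height_def)

lemma log_height_mono:
  assumes "height t \<le> height r * height s"
  shows "log_height (of_rat t) \<le> log_height (of_rat r) + log_height (of_rat s)"
proof -
  have p: "real_of_int (height x) > 0" for x using height_ge_1[of x] by linarith
  have "log 2 (height t) \<le> log 2 (of_int (height r) * of_int (height s))"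
    using assms p[of t] by (subst log_le_cancel_iff) (auto simp: p simp flip: of_int_mult)
  then show ?thesis using p[of r] p[of s] by (simp add: log_height_of_rat log_mult)
qed

lemma bit_size_of_rat:
  "bit_size (of_rat r) =
     1 + floorlog 2 (nat \<bar>fst (quotient_of r)\<bar>) + floorlog 2 (nat (snd (quotient_of r)))"
  by (simp add: bit_size_def case_prod_unfold) (simp add: Let_def)

lemma less_two_power_floorlog: "0 \<le> z \<Longrightarrow> z < 2 ^ floorlog 2 (nat z)"
  using floorlog_bounds[of "nat z" 2] by (cases "z = 0") (auto simp: nat_less_iff)

lemma log_height_le_bit_size: "log_height (of_rat r) \<le> bit_size (of_rat r)"
proof -
  let ?a = "\<bar>fst (quotient_of r)\<bar>" and ?b = "snd (quotient_of r)"
  let ?m = "floorlog 2 (nat ?a)" and ?n = "floorlog 2 (nat ?b)"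
  have b: "?b > 0" by (rule quotient_of_denom_pos')
  \<comment> \<open>\<open>?b \<ge> 1\<close> turns the sum into a product, to which the two digit
    counts apply separately.\<close>
  have "?a + ?b \<le> (?a + 1) * ?b" using b mult_left_mono[of 1 ?b ?a] by (simp add: algebra_simps)
  also have "\<dots> \<le> 2 ^ ?m * 2 ^ ?n"
    using less_two_power_floorlog[of ?a] less_two_power_floorlog[of ?b] b
    by (intro mult_mono) auto
  finally have "height r \<le> 2 ^ (?m + ?n)" by (simp add: height_def power_add)
  then have "real_of_int (height r) \<le> 2 ^ (?m + ?n)" by (metis of_int_le_iff of_int_numeral of_int_power)
  then have "log 2 (height r) \<le> log 2 (2 ^ (?m + ?n))"
    using height_ge_1[of r] by (subst log_le_cancel_iff) auto
  then have "log 2 (height r) \<le> real (?m + ?n)" by (subst (asm) log_pow_cancel) auto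
  then show ?thesis by (simp add: log_height_of_rat bit_size_of_rat)
qed

lemma floorlog_le_log:
  assumes "0 \<le> z" "z \<le> h" "1 \<le> h"
  shows "real (floorlog 2 (nat z)) \<le> 1 + log 2 h"
proof (cases "z = 0")
  case True
  then show ?thesis using assms by (simp add: floorlog_def)
next
  case False
  then have z: "z \<ge> 1" using assms by simp
  then have "0 \<le> log 2 (real_of_int z)" by simp
  then have "real (floorlog 2 (nat z)) \<le> 1 + log 2 (real_of_int z)"
    using z by (simp add: floorlog_def)
  also have "log 2 (real_of_int z) \<le> log 2 (real_of_int h)" using z assms by simp
  finally show ?thesis by simp
qed

text \<open>Numerator and denominator are both at most the height, so each has at most
  \<open>1 + log 2 (height r)\<close> digits; with the leading 1 of \<open>bit_size\<close> the
  constants add up to 3.\<close>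

lemma bit_size_le_log_height: "bit_size (of_rat r) \<le> 3 * (1 + log_height (of_rat r))"
proof -
  have b: "snd (quotient_of r) > 0" by (rule quotient_of_denom_pos')
  have "0 \<le> log 2 (height r)" using height_ge_1[of r] by simp
  moreover have "floorlog 2 (nat \<bar>fst (quotient_of r)\<bar>) \<le> 1 + log 2 (height r)"
    "floorlog 2 (nat (snd (quotient_of r))) \<le> 1 + log 2 (height r)"
    using b height_ge_1[of r] by (intro floorlog_le_log; simp add: height_def)+
  ultimately show ?thesis unfolding bit_size_of_rat log_height_of_rat by simp
qed

section \<open>Separating hyperplanes spanned by few points\<close>

text \<open>Gram--Schmidt; the convention \<open>x / 0 = 0\<close> makes it work for dependent vectors.\<close>

fun residual :: "'a::real_inner list \<Rightarrow> 'a \<Rightarrow> 'a" where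
  "residual [] v = v"
| "residual (u # us) v =
     residual us v - (residual us v \<bullet> residual us u / (residual us u \<bullet> residual us u)) *\<^sub>R residual us u"

lemma residual_orthogonal: "u \<in> set us \<Longrightarrow> residual us v \<bullet> u = 0"
  and residual_diff_in_span: "v - residual us v \<in> span (set us)"
proof (induction us arbitrary: u v)
  case Nil
  { case 1 then show ?case by simp next case 2 show ?case by simp }
next
  case (Cons x us)
  let ?r = "residual us x" and ?v = "\<lambda>v. residual us v"
  have sp: "w \<in> span (set us) \<Longrightarrow> residual us v \<bullet> w = 0" for w v
    by (rule orthogonal_to_span[unfolded orthogonal_def, of w "set us" "residual us v"])
      (auto simp: Cons.IH(1))
  \<comment> \<open>\<open>x\<close> and its residual differ by an element of the span of
    \<open>us\<close>, to which the residual of \<open>v\<close> is orthogonal. So removing the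
    component along \<open>?r\<close> also makes the result orthogonal to \<open>x\<close>.\<close>
  have xr: "residual us v \<bullet> x = residual us v \<bullet> ?r" for v
    using sp[OF Cons.IH(2)[of x], of v] by (simp add: inner_diff_right)
  have m: "span (set us) \<subseteq> span (set (x # us))" by (rule span_mono) auto
  have r: "?r \<in> span (set (x # us))"
  proof -
    have "x - (x - ?r) \<in> span (set (x # us))"
      by (rule span_diff[OF span_base subsetD[OF m Cons.IH(2)]]) simp
    then show ?thesis by simp
  qed
  have "v - residual (x # us) v \<in> span (set (x # us))" for v
  proof -
    have "v - residual (x # us) v =
        (v - residual us v) + (residual us v \<bullet> ?r / (?r \<bullet> ?r)) *\<^sub>R ?r" by simp
    also have "\<dots> \<in> span (set (x # us))"
      using Cons.IH(2)[of v] by (intro span_add span_mul r subsetD[OF m]) simp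
    finally show ?thesis .
  qed
  moreover have "residual (x # us) v \<bullet> u = 0" if "u \<in> set (x # us)" for u v
    using that Cons.IH(1)[of u] by (auto simp: inner_diff_left xr)
  ultimately show "u \<in> set (x # us) \<Longrightarrow> residual (x # us) v \<bullet> u = 0"
    and "w - residual (x # us) w \<in> span (set (x # us))" for u v w by blast+
qed

text \<open>The difference of two candidates lies in the span and is orthogonal to it, hence
  vanishes.\<close>

lemma residual_unique:
  assumes "\<And>u. u \<in> set us \<Longrightarrow> z \<bullet> u = 0" "v - z \<in> span (set us)"
  shows "residual us v = z"
proof -
  let ?d = "residual us v - z"
  have "(v - z) - (v - residual us v) \<in> span (set us)"
    by (rule span_diff[OF assms(2) residual_diff_in_span])
  then have "?d \<in> span (set us)" by simp
  moreover have "?d \<bullet> u = 0" if "u \<in> set us" for u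
    using that assms(1) residual_orthogonal by (simp add: inner_diff_left)
  ultimately have "?d \<bullet> ?d = 0"
    using orthogonal_to_span[of ?d "set us" ?d] by (auto simp: orthogonal_def)
  then show ?thesis by simp
qed

text \<open>The point of least norm in the affine hull.\<close>

fun foot :: "'a::real_inner list \<Rightarrow> 'a" where
  "foot [] = 0"
| "foot (u # us) = residual (map (\<lambda>v. v - u) us) u"

lemma foot_replicate_0: "foot (replicate n 0) = 0"
  by (cases n) (auto intro!: residual_unique span_zero)

text \<open>Relative to the first point this is the uniqueness of the residual. The list may contain
  repetitions and dependent points, so it can be padded to a prescribed length.\<close>

lemma foot_unique:
  assumes "us \<noteq> []" "\<And>u. u \<in> set us \<Longrightarrow> z \<bullet> u = z \<bullet> z"
    and "(\<Sum>u\<in>set us. c u) = 1" "z = (\<Sum>u\<in>set us. c u *\<^sub>R u)"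
  shows "foot us = z"
proof -
  obtain x xs where us: "us = x # xs" using assms(1) by (cases us) auto
  have "residual (map (\<lambda>v. v - x) xs) x = z"
  proof (rule residual_unique)
    show "z \<bullet> u = 0" if "u \<in> set (map (\<lambda>v. v - x) xs)" for u
      using that assms(2) unfolding us by (auto simp: inner_diff_right)
    have "x - z = (\<Sum>u\<in>set us. c u *\<^sub>R x) - (\<Sum>u\<in>set us. c u *\<^sub>R u)"
      unfolding scaleR_sum_left[symmetric] assms(3) assms(4)[symmetric] by simp
    also have "\<dots> = - (\<Sum>u\<in>set us. c u *\<^sub>R (u - x))"
      by (simp add: sum_subtractf scaleR_diff_right)
    also have "\<dots> \<in> span (set (map (\<lambda>v. v - x) xs))"
    proof (intro span_neg span_sum span_mul)
      fix u assume "u \<in> set us"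
      then show "u - x \<in> span (set (map (\<lambda>v. v - x) xs))"
        unfolding us by (auto intro: span_zero span_base)
    qed
    finally show "x - z \<in> span (set (map (\<lambda>v. v - x) xs))" .
  qed
  then show ?thesis by (simp add: us)
qed

text \<open>As 0 is not in the hull of the differences, its point \<open>w\<close> of least norm
  satisfies \<open>w \<bullet> u \<ge> w \<bullet> w > 0\<close> on the hull. The points of positive
  weight in a convex combination equal to \<open>w\<close> attain equality, so \<open>w\<close> is
  also the point of least norm in their affine hull, which \<open>foot\<close> computes. The second
  component of such a tight pair maximizes \<open>w\<close> on \<open>B\<close> and serves as
  threshold, so the threshold need not be guessed separately.\<close>

lemma separating_foot:
  fixes A B :: "'a::euclidean_space set"
  assumes "finite A" "finite B" "A \<noteq> {}" "B \<noteq> {}"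
    and sep: "\<And>a b. a \<in> A \<Longrightarrow> b \<in> B \<Longrightarrow> z \<bullet> b < z \<bullet> a"
  obtains ps where "length ps = Suc DIM('a)" "set ps \<subseteq> A \<times> B"
    "\<And>a. a \<in> A \<Longrightarrow> foot (map (\<lambda>(a, b). a - b) ps) \<bullet> snd (hd ps) < foot (map (\<lambda>(a, b). a - b) ps) \<bullet> a"
    "\<And>b. b \<in> B \<Longrightarrow> foot (map (\<lambda>(a, b). a - b) ps) \<bullet> b \<le> foot (map (\<lambda>(a, b). a - b) ps) \<bullet> snd (hd ps)"
proof -
  define U where "U = (\<lambda>(a, b). a - b) ` (A \<times> B)"
  have fU: "finite U" "U \<noteq> {}" using assms by (auto simp: U_def)
  let ?H = "convex hull U"
  have cl: "closed ?H" "?H \<noteq> {}" "convex ?H"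
    using fU by (auto simp: compact_convex_hull compact_imp_closed finite_imp_compact)
  have "U \<subseteq> {u. z \<bullet> u > 0}" using sep by (auto simp: U_def inner_diff_right)
  then have "?H \<subseteq> {u. z \<bullet> u > 0}"
    by (rule hull_minimal) (rule convex_halfspace_gt)
  then have 0: "0 \<notin> ?H" by auto
  define w where "w = closest_point ?H 0"
  have wH: "w \<in> ?H" unfolding w_def using cl by (intro closest_point_in_set)
  then have w0: "w \<noteq> 0" using 0 by auto
  have wu: "w \<bullet> w \<le> w \<bullet> u" if "u \<in> ?H" for u
    using closest_point_dot[OF cl(3,1) that, of 0] unfolding w_def[symmetric]
    by (simp add: inner_diff_right)
  obtain S c where S: "finite S" "S \<subseteq> U" "card S \<le> DIM('a) + 1"
    and c: "\<And>u. u \<in> S \<Longrightarrow> 0 \<le> c u" "sum c S = 1" "(\<Sum>u\<in>S. c u *\<^sub>R u) = w"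
    using wH[unfolded convex_hull_caratheodory mem_Collect_eq] by blast
  \<comment> \<open>Only points of positive weight are forced onto the supporting hyperplane
    below.\<close>
  define T where "T = {u \<in> S. c u > 0}"
  have fT: "finite T" and TS: "T \<subseteq> S" using S(1) by (auto simp: T_def)
  have cT: "sum c T = 1" "(\<Sum>u\<in>T. c u *\<^sub>R u) = w"
  proof -
    have z: "c u = 0" if "u \<in> S - T" for u using that c(1)[of u] by (auto simp: T_def)
    show "sum c T = 1"
      unfolding c(2)[symmetric] by (rule sum.mono_neutral_left[OF S(1) TS]) (use z in blast)
    show "(\<Sum>u\<in>T. c u *\<^sub>R u) = w"
      unfolding c(3)[symmetric] by (rule sum.mono_neutral_left[OF S(1) TS]) (use z in auto)
  qed
  have "T \<noteq> {}" using cT(1) by auto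
  have TH: "u \<in> T \<Longrightarrow> u \<in> ?H" for u using TS S(2) hull_subset[of U convex] by auto
  \<comment> \<open>A vanishing sum of nonnegative terms, as in complementary slackness.\<close>
  have "(\<Sum>u\<in>T. c u * (w \<bullet> u - w \<bullet> w)) = w \<bullet> (\<Sum>u\<in>T. c u *\<^sub>R u) - w \<bullet> w * sum c T"
    by (simp add: inner_sum_right right_diff_distrib sum_subtractf sum_distrib_left)
      (simp add: sum_distrib_right mult.commute)
  also have "\<dots> = 0" using cT by simp
  finally have "c u * (w \<bullet> u - w \<bullet> w) = 0" if "u \<in> T" for u
    using that fT wu[OF TH] by (subst (asm) sum_nonneg_eq_0_iff) (auto simp: T_def)
  then have tight: "w \<bullet> u = w \<bullet> w" if "u \<in> T" for u
    using that by (fastforce simp: T_def)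
  obtain xs where xs: "set xs = T" "distinct xs" using finite_distinct_list[OF fT] by auto
  have len: "length xs \<le> Suc DIM('a)"
    using distinct_card[OF xs(2)] card_mono[OF S(1) TS] S(3) xs(1) by simp
  \<comment> \<open>Padding with repetitions gives all guesses the same shape.\<close>
  define us where "us = xs @ replicate (Suc DIM('a) - length xs) (hd xs)"
  have us: "set us = T" "length us = Suc DIM('a)" "us \<noteq> []"
    using xs len \<open>T \<noteq> {}\<close> by (auto simp: us_def)
  have foot: "foot us = w"
    by (rule foot_unique[of _ _ c]) (use us tight cT in auto)
  have "\<forall>u\<in>T. \<exists>p\<in>A \<times> B. u = (\<lambda>(a, b). a - b) p"
    using TS S(2) unfolding U_def by blast
  then obtain g where g: "\<And>u. u \<in> T \<Longrightarrow> g u \<in> A \<times> B \<and> u = (\<lambda>(a, b). a - b) (g u)" by metis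
  define ps where "ps = map g us"
  have ps: "map (\<lambda>(a, b). a - b) ps = us"
    unfolding ps_def map_map using g us(1) by (intro map_idI) (simp add: comp_def)
  have psAB: "set ps \<subseteq> A \<times> B" unfolding ps_def set_map us(1) using g by blast
  have lps: "length ps = Suc DIM('a)" by (simp add: ps_def us)
  obtain a0 b0 where h: "hd ps = (a0, b0)" by fastforce
  have "hd ps \<in> set ps" using lps by (intro list.set_sel) auto
  then have ab0: "a0 \<in> A" "b0 \<in> B" "(a0, b0) \<in> set ps" using psAB h by auto
  then have "a0 - b0 \<in> T" unfolding us(1)[symmetric] ps[symmetric] by force
  then have t0: "w \<bullet> a0 - w \<bullet> b0 = w \<bullet> w" using tight by (simp flip: inner_diff_right)
  have ge: "w \<bullet> w \<le> w \<bullet> a - w \<bullet> b" if "a \<in> A" "b \<in> B" for a b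
    using wu[of "a - b"] that hull_subset[of U convex] by (auto simp: U_def inner_diff_right)
  have pos: "w \<bullet> w > 0" using w0 by simp
  show thesis
  proof (rule that[OF lps psAB])
    show "foot (map (\<lambda>(a, b). a - b) ps) \<bullet> snd (hd ps) < foot (map (\<lambda>(a, b). a - b) ps) \<bullet> a"
      if "a \<in> A" for a
      unfolding ps foot h using ge[OF that ab0(2)] pos by (simp del: inner_gt_zero_iff)
    show "foot (map (\<lambda>(a, b). a - b) ps) \<bullet> b \<le> foot (map (\<lambda>(a, b). a - b) ps) \<bullet> snd (hd ps)"
      if "b \<in> B" for b
      unfolding ps foot h using ge[OF ab0(1) that] t0 by simp
  qed
qed

section \<open>An optimal partition with separable clusters\<close>

text \<open>If \<open>x\<close> were a convex combination of other points, convexity of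
  \<open>f\<close> would make those of positive weight maximizers too. Their norms would be at most
  that of \<open>x\<close>, so each would have a strictly smaller inner product with
  \<open>x\<close> than \<open>x\<close> itself has, and so would their average, which is
  \<open>x\<close>. Hence \<open>x\<close> lies outside the closed hull of the other points and is
  separated from it.\<close>

lemma exposed_maximizer:
  fixes S :: "'a::euclidean_space set"
  assumes S: "finite S" "S \<noteq> {}" and f: "convex_on UNIV f"
  obtains x c where "x \<in> S" "\<And>y. y \<in> S \<Longrightarrow> f y \<le> f x" "\<And>y. y \<in> S \<Longrightarrow> y \<noteq> x \<Longrightarrow> c \<bullet> y < c \<bullet> x"
proof -
  define M where "M = {x \<in> S. \<forall>y\<in>S. f y \<le> f x}"
  have "Max (f ` S) \<in> f ` S" using S by (intro Max_in) auto
  then obtain y where "y \<in> S" "f y = Max (f ` S)" by auto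
  then have "y \<in> M" using S(1) by (simp add: M_def)
  then have "M \<noteq> {}" by blast
  moreover have fM: "finite M" using S by (simp add: M_def)
  ultimately have "Max (norm ` M) \<in> norm ` M" by (intro Max_in) auto
  then obtain x where x: "x \<in> M" "norm x = Max (norm ` M)" by auto
  have nx: "norm y \<le> norm x" if "y \<in> M" for y using that fM x(2) by simp
  have xS: "x \<in> S" "\<And>y. y \<in> S \<Longrightarrow> f y \<le> f x" using x(1) by (auto simp: M_def)
  let ?T = "S - {x}"
  have fT: "finite ?T" using S by simp
  have "x \<notin> convex hull ?T"
  proof
    assume "x \<in> convex hull ?T"
    then obtain u where u: "\<And>y. y \<in> ?T \<Longrightarrow> 0 \<le> u y" "sum u ?T = 1" "(\<Sum>y\<in>?T. u y *\<^sub>R y) = x"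
      unfolding convex_hull_finite[OF fT] by blast
    have nonempty: "?T \<noteq> {}" using u(2) by (metis sum.empty zero_neq_one)
    have "f x \<le> (\<Sum>y\<in>?T. u y * f y)"
      using convex_on_sum[OF fT nonempty f u(2), of "\<lambda>y. y"] u by simp
    moreover have "(\<Sum>y\<in>?T. u y * f x) = f x" using u(2) by (simp flip: sum_distrib_right)
    ultimately have le: "(\<Sum>y\<in>?T. u y * (f x - f y)) \<le> 0"
      by (simp add: right_diff_distrib sum_subtractf)
    have nn: "0 \<le> u y * (f x - f y)" if "y \<in> ?T" for y
      using u(1)[OF that] xS(2)[of y] that by simp
    have "(\<Sum>y\<in>?T. u y * (f x - f y)) = 0"
      using le sum_nonneg[of ?T "\<lambda>y. u y * (f x - f y)", OF nn] by simp
    then have fy: "u y * (f x - f y) = 0" if "y \<in> ?T" for y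
      using sum_nonneg_eq_0_iff[where f = "\<lambda>y. u y * (f x - f y)", OF fT nn] that by blast
    have lt: "0 < u y * (x \<bullet> x - x \<bullet> y)" if y: "y \<in> ?T" "u y \<noteq> 0" for y
    proof -
      have "f y = f x" using fy[OF y(1)] y(2) by simp
      then have "y \<in> M" using y(1) xS(2) by (auto simp: M_def)
      then have "norm y ^ 2 \<le> norm x ^ 2" using nx by (intro power_mono) auto
      then have "y \<bullet> y \<le> x \<bullet> x" by (simp add: power2_norm_eq_inner)
      moreover have "0 < (x - y) \<bullet> (x - y)" using y(1) by auto
      \<comment> \<open>Twice this quantity is the squared distance of \<open>x\<close> and
        \<open>y\<close> plus the difference of their squared norms.\<close>
      ultimately have "0 < x \<bullet> x - x \<bullet> y"
        by (simp add: inner_diff_left inner_diff_right inner_commute)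
      then show ?thesis using u(1)[OF y(1)] y(2) by simp
    qed
    have "0 < (\<Sum>y\<in>?T. u y * (x \<bullet> x - x \<bullet> y))"
    proof -
      obtain y where y: "y \<in> ?T" "u y \<noteq> 0" using u(2) by (metis sum.neutral zero_neq_one)
      have "0 \<le> u y * (x \<bullet> x - x \<bullet> y)" if "y \<in> ?T" for y
        using lt[OF that] by (cases "u y = 0") auto
      then show ?thesis using sum_pos2[of ?T y "\<lambda>y. u y * (x \<bullet> x - x \<bullet> y)"] fT y(1) lt[OF y] by blast
    qed
    also have "(\<Sum>y\<in>?T. u y * (x \<bullet> x - x \<bullet> y)) = (x \<bullet> x) * sum u ?T - x \<bullet> (\<Sum>y\<in>?T. u y *\<^sub>R y)"
      by (simp only: right_diff_distrib sum_subtractf inner_sum_right inner_scaleR_right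
          sum_distrib_left mult.commute)
    also have "\<dots> = 0" unfolding u(2,3) by simp
    finally show False by simp
  qed
  moreover have "closed (convex hull ?T)"
    using fT by (simp add: compact_convex_hull compact_imp_closed finite_imp_compact)
  ultimately obtain a b where ab: "a \<bullet> x < b" "\<And>y. y \<in> convex hull ?T \<Longrightarrow> b < a \<bullet> y"
    using separating_hyperplane_closed_point[of "convex hull ?T" x] by auto
  have "(- a) \<bullet> y < (- a) \<bullet> x" if "y \<in> S" "y \<noteq> x" for y
    using ab(1) ab(2)[of y] that hull_subset[of ?T convex] by auto
  with xS show thesis by (rule that)
qed

section \<open>Partitions as assignments of items to clusters\<close>

definition clusters :: "nat \<Rightarrow> (nat \<Rightarrow> 'p) \<Rightarrow> 'p \<Rightarrow> nat set" where
  "clusters n \<sigma> i = {j \<in> {1..n}. \<sigma> j = i}"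

lemma clusters_in_partitions: "clusters n \<sigma> \<in> partitions n"
  by (auto simp: clusters_def partitions_def disjoint_family_on_def)

lemma partition_is_clusters:
  assumes "\<pi> \<in> partitions n"
  obtains \<sigma> where "\<pi> = clusters n \<sigma>"
proof -
  have d: "\<And>i i'. i \<noteq> i' \<Longrightarrow> \<pi> i \<inter> \<pi> i' = {}" and u: "(\<Union>i. \<pi> i) = {1..n}"
    using assms by (auto simp: partitions_def disjoint_family_on_def)
  have "\<forall>j\<in>{1..n}. \<exists>i. j \<in> \<pi> i" unfolding u[symmetric] by blast
  then obtain \<sigma> where \<sigma>: "\<And>j. j \<in> {1..n} \<Longrightarrow> j \<in> \<pi> (\<sigma> j)" by metis
  have "\<pi> i = clusters n \<sigma> i" for i
  proof (intro equalityI subsetI)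
    fix j assume j: "j \<in> \<pi> i"
    then have "j \<in> {1..n}" using u by blast
    moreover from \<sigma>[OF this] j d[of "\<sigma> j" i] have "\<sigma> j = i" by blast
    ultimately show "j \<in> clusters n \<sigma> i" by (simp add: clusters_def)
  qed (use \<sigma> in \<open>auto simp: clusters_def\<close>)
  then show thesis by (intro that ext)
qed

lemma finite_partitions: "finite (partitions n :: ('p::finite \<Rightarrow> nat set) set)"
proof -
  have "(partitions n :: ('p \<Rightarrow> nat set) set) \<subseteq> (UNIV :: 'p set) \<rightarrow>\<^sub>E Pow {1..n}"
    by (fastforce simp: partitions_def)
  then show ?thesis by (rule finite_subset) (intro finite_PiE; simp)
qed

lemma sum_clusters: "(\<Sum>j\<in>clusters n \<sigma> i. h j) = (\<Sum>j\<in>{1..n}. if \<sigma> j = i then h j else 0)"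
  unfolding clusters_def by (rule sum.inter_filter) simp

lemma total_utility_clusters:
  "total_utility I (clusters n \<sigma>) $ k $ i = (\<Sum>j\<in>{1..n}. if \<sigma> j = i then utility I j $ k $ i else 0)"
  by (simp add: total_utility_def sum_clusters column_def if_distrib[of "\<lambda>v. v $ k"] cong: if_cong)

lemma feasible_clusters:
  "feasible I (clusters (items I) \<sigma>) \<longleftrightarrow>
     (\<forall>i k. lower I i $ k \<le> (\<Sum>j\<in>{1..items I}. if \<sigma> j = i then weight I j $ k $ i else 0) \<and>
        (\<Sum>j\<in>{1..items I}. if \<sigma> j = i then weight I j $ k $ i else 0) \<le> upper I i $ k)"
  by (auto simp: feasible_def clusters_in_partitions less_eq_vec_def sum_clusters column_def
      if_distrib[of "\<lambda>v. v $ _"] cong: if_cong)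

text \<open>
  The additional last coordinate makes the lifted total change whenever two items in different
  clusters are exchanged.
\<close>

definition lift :: "('d::finite, 'p::finite, 's::finite) problem \<Rightarrow> nat \<Rightarrow> (real^'p^'d) \<times> real" where
  "lift I j = (if j \<in> {1..items I} then (utility I j, real j) else 0)"

text \<open>The contribution of item \<open>j\<close> to the lifted total. Weighting
  \<open>j\<close> by the cluster number makes an exchange of \<open>a\<close> and \<open>b\<close>
  between \<open>i\<close> and \<open>i'\<close> change the last coordinate by
  \<open>(idx i - idx i') * (b - a)\<close>, which is nonzero.\<close>

definition placed :: "('d::finite, 'p::finite, 's::finite) problem \<Rightarrow> nat \<Rightarrow> 'p \<Rightarrow> (real^'p^'d) \<times> real" where
  "placed I j i = (\<chi> k l. if l = i then utility I j $ k $ l else 0, real (idx i) * real j)"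

lemma fst_sum_placed:
  "fst (\<Sum>j\<in>{1..n}. placed I j (\<sigma> j)) = total_utility I (clusters n \<sigma>)"
proof -
  have "fst (\<Sum>j\<in>{1..n}. placed I j (\<sigma> j)) $ k $ i = total_utility I (clusters n \<sigma>) $ k $ i" for k i
    unfolding total_utility_clusters fst_sum sum_component
    by (rule sum.cong) (auto simp: placed_def)
  then show ?thesis by (simp add: vec_eq_iff)
qed

lemma idx_eq_iff [simp]: "idx i = idx i' \<longleftrightarrow> i = i'"
  unfolding idx_def by (simp add: countable_finite)

text \<open>For fixed \<open>i\<close> and \<open>i'\<close> the gain of one placement over the
  other is linear in the lifted item, with the same \<open>z\<close> for all items. This turns
  exchange inequalities into a linear separation of items.\<close>

lemma inner_placed_diff:
  fixes c :: "(real^'p::finite^'d::finite) \<times> real"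
  assumes "i \<noteq> i'"
  obtains z where "\<And>j. j \<in> {1..items I} \<Longrightarrow> z \<bullet> lift I j = c \<bullet> placed I j i - c \<bullet> placed I j i'"
proof
  let ?z = "(\<chi> k l. (if l = i then fst c $ k $ l else 0) - (if l = i' then fst c $ k $ l else 0),
     snd c * (real (idx i) - real (idx i')))"
  fix j assume "j \<in> {1..items I}"
  then show "?z \<bullet> lift I j = c \<bullet> placed I j i - c \<bullet> placed I j i'"
    unfolding lift_def placed_def inner_prod_def inner_vec_def
    by (simp add: sum_subtractf algebra_simps if_distrib[of "\<lambda>x. _ * x"] if_distrib[of "\<lambda>x. x * _"]
        cong: if_cong)
qed

lemma exchange:
  fixes I :: "('d::finite, 'p::finite, 's::finite) problem"
  assumes feas: "feasible I (clusters (items I) \<sigma>)"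
    and max: "\<And>\<sigma>'. feasible I (clusters (items I) \<sigma>') \<Longrightarrow>
      (\<Sum>j\<in>{1..items I}. placed I j (\<sigma>' j)) \<noteq> (\<Sum>j\<in>{1..items I}. placed I j (\<sigma> j)) \<Longrightarrow>
      c \<bullet> (\<Sum>j\<in>{1..items I}. placed I j (\<sigma>' j)) < c \<bullet> (\<Sum>j\<in>{1..items I}. placed I j (\<sigma> j))"
    and ab: "a \<in> {1..items I}" "b \<in> {1..items I}" "weight I a = weight I b" "\<sigma> a \<noteq> \<sigma> b"
  shows "c \<bullet> placed I b (\<sigma> a) - c \<bullet> placed I b (\<sigma> b) < c \<bullet> placed I a (\<sigma> a) - c \<bullet> placed I a (\<sigma> b)"
proof -
  let ?A = "{1..items I}"
  define \<tau> where "\<tau> = Transposition.transpose a b"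
  define \<sigma>' where "\<sigma>' = \<sigma> \<circ> \<tau>"
  have bij: "bij_betw \<tau> ?A ?A" unfolding \<tau>_def using ab by (simp add: bij_betw_transpose_iff)
  have w: "weight I (\<tau> j) = weight I j" for j
    using ab(3) by (auto simp: \<tau>_def Transposition.transpose_def)
  \<comment> \<open>\<open>\<tau>\<close> permutes the items without changing weight matrices, so
    all cluster weights are preserved by reindexing.\<close>
  have "(\<Sum>j\<in>?A. if \<sigma>' j = i then weight I j $ k $ i else 0) =
      (\<Sum>j\<in>?A. if \<sigma> j = i then weight I j $ k $ i else 0)" for i k
    using sum.reindex_bij_betw[OF bij, of "\<lambda>j. if \<sigma> j = i then weight I j $ k $ i else 0"]
    unfolding \<sigma>'_def comp_apply w .
  then have feas': "feasible I (clusters (items I) \<sigma>')"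
    using feas by (simp add: feasible_clusters)
  have neq: "a \<noteq> b" using ab(4) by auto
  have "(\<Sum>j\<in>?A. placed I j (\<sigma>' j)) - (\<Sum>j\<in>?A. placed I j (\<sigma> j)) =
      (\<Sum>j\<in>?A. placed I j (\<sigma>' j) - placed I j (\<sigma> j))" by (simp add: sum_subtractf)
  also have "\<dots> = (\<Sum>j\<in>{a, b}. placed I j (\<sigma>' j) - placed I j (\<sigma> j))"
    by (rule sum.mono_neutral_right) (use ab in \<open>auto simp: \<sigma>'_def \<tau>_def Transposition.transpose_def\<close>)
  also have "\<dots> = placed I a (\<sigma> b) - placed I a (\<sigma> a) + (placed I b (\<sigma> a) - placed I b (\<sigma> b))"
    using neq by (simp add: \<sigma>'_def \<tau>_def)
  finally have d: "(\<Sum>j\<in>?A. placed I j (\<sigma>' j)) - (\<Sum>j\<in>?A. placed I j (\<sigma> j)) = \<dots>" .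
  have "snd (placed I a (\<sigma> b) - placed I a (\<sigma> a) + (placed I b (\<sigma> a) - placed I b (\<sigma> b))) =
      (real (idx (\<sigma> a)) - real (idx (\<sigma> b))) * (real b - real a)"
    by (simp add: placed_def algebra_simps)
  also have "\<dots> \<noteq> 0" using ab(4) neq by simp
  finally have "snd ((\<Sum>j\<in>?A. placed I j (\<sigma>' j)) - (\<Sum>j\<in>?A. placed I j (\<sigma> j))) \<noteq> 0"
    unfolding d .
  then have "(\<Sum>j\<in>?A. placed I j (\<sigma>' j)) \<noteq> (\<Sum>j\<in>?A. placed I j (\<sigma> j))" by auto
  from max[OF feas' this]
  have "c \<bullet> ((\<Sum>j\<in>?A. placed I j (\<sigma>' j)) - (\<Sum>j\<in>?A. placed I j (\<sigma> j))) < 0"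
    by (simp add: inner_diff_right)
  then show ?thesis unfolding d by (simp add: inner_diff_right inner_add_right)
qed

lemma convex_on_fst: "convex_on UNIV f \<Longrightarrow> convex_on UNIV (\<lambda>x. f (fst x))"
  by (auto simp: convex_on_def)

lemma separable_optimum:
  fixes I :: "('d::finite, 'p::finite, 's::finite) problem"
  assumes feas: "feasible I \<rho>" and f: "convex_on UNIV f"
  obtains \<sigma> where "optimal I f (clusters (items I) \<sigma>)"
    "\<And>i i' w. i \<noteq> i' \<Longrightarrow> \<exists>z. \<forall>a b. a \<in> {1..items I} \<and> \<sigma> a = i \<and> weight I a = w \<longrightarrow>
       b \<in> {1..items I} \<and> \<sigma> b = i' \<and> weight I b = w \<longrightarrow> z \<bullet> lift I b < z \<bullet> lift I a"
proof -
  let ?n = "items I"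
  let ?L = "\<lambda>\<sigma>. \<Sum>j\<in>{1..?n}. placed I j (\<sigma> j)"
  define S where "S = ?L ` {\<sigma>. feasible I (clusters ?n \<sigma>)}"
  have Lcong: "?L \<sigma> = ?L \<sigma>'" if "clusters ?n \<sigma> = clusters ?n \<sigma>'" for \<sigma> \<sigma>'
  proof (rule sum.cong)
    fix j assume "j \<in> {1..?n}"
    then have "j \<in> clusters ?n \<sigma> (\<sigma> j)" by (simp add: clusters_def)
    then show "placed I j (\<sigma> j) = placed I j (\<sigma>' j)" unfolding that by (simp add: clusters_def)
  qed simp
  \<comment> \<open>There are infinitely many assignments, but the lifted total depends only on the
    partition that they induce.\<close>
  have "S \<subseteq> (\<lambda>\<pi>. ?L (SOME \<sigma>. clusters ?n \<sigma> = \<pi>)) ` partitions ?n"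
  proof
    fix x assume "x \<in> S"
    then obtain \<sigma> where \<sigma>: "x = ?L \<sigma>" by (auto simp: S_def)
    have "clusters ?n (SOME \<sigma>'. clusters ?n \<sigma>' = clusters ?n \<sigma>) = clusters ?n \<sigma>"
      by (rule someI[of "\<lambda>\<sigma>'. clusters ?n \<sigma>' = clusters ?n \<sigma>"]) simp
    from Lcong[OF this] show "x \<in> (\<lambda>\<pi>. ?L (SOME \<sigma>. clusters ?n \<sigma> = \<pi>)) ` partitions ?n"
      unfolding \<sigma> by (intro image_eqI[OF _ clusters_in_partitions[of ?n \<sigma>]]) simp
  qed
  then have "finite S" using finite_partitions finite_surj by blast
  moreover have "S \<noteq> {}"
  proof -
    from feas have "\<rho> \<in> partitions ?n" by (simp add: feasible_def)
    then obtain \<sigma> where "\<rho> = clusters ?n \<sigma>" by (rule partition_is_clusters)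
    with feas show ?thesis by (auto simp: S_def)
  qed
  \<comment> \<open>Applied to \<open>f\<close> composed with \<open>fst\<close>, which is still
    convex and ignores the added coordinate.\<close>
  ultimately obtain x c where x: "x \<in> S" "\<And>y. y \<in> S \<Longrightarrow> f (fst y) \<le> f (fst x)"
    "\<And>y. y \<in> S \<Longrightarrow> y \<noteq> x \<Longrightarrow> c \<bullet> y < c \<bullet> x"
    by (rule exposed_maximizer[OF _ _ convex_on_fst[OF f]]) blast
  from x(1) obtain \<sigma> where \<sigma>: "feasible I (clusters ?n \<sigma>)" "x = ?L \<sigma>" by (auto simp: S_def)
  show thesis
  proof (rule that[of \<sigma>])
    have "f (total_utility I \<pi>) \<le> f (total_utility I (clusters ?n \<sigma>))" if "feasible I \<pi>" for \<pi>
    proof -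
      from that have "\<pi> \<in> partitions ?n" by (simp add: feasible_def)
      then obtain \<sigma>' where \<sigma>': "\<pi> = clusters ?n \<sigma>'" by (rule partition_is_clusters)
      then have "?L \<sigma>' \<in> S" using that by (auto simp: S_def)
      from x(2)[OF this] show ?thesis unfolding \<sigma>(2) \<sigma>' fst_sum_placed .
    qed
    with \<sigma>(1) show "optimal I f (clusters ?n \<sigma>)" by (simp add: optimal_def)
  next
    fix i i' :: 'p and w assume "i \<noteq> i'"
    then obtain z where z: "\<And>j. j \<in> {1..?n} \<Longrightarrow> z \<bullet> lift I j = c \<bullet> placed I j i - c \<bullet> placed I j i'"
      using inner_placed_diff by blast
    have "z \<bullet> lift I b < z \<bullet> lift I a"
      if "a \<in> {1..?n}" "\<sigma> a = i" "weight I a = w" "b \<in> {1..?n}" "\<sigma> b = i'" "weight I b = w" for a b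
    proof -
      have "c \<bullet> placed I b (\<sigma> a) - c \<bullet> placed I b (\<sigma> b) < c \<bullet> placed I a (\<sigma> a) - c \<bullet> placed I a (\<sigma> b)"
      proof (rule exchange[OF \<sigma>(1)])
        show "c \<bullet> ?L \<sigma>' < c \<bullet> ?L \<sigma>" if "feasible I (clusters ?n \<sigma>')" "?L \<sigma>' \<noteq> ?L \<sigma>" for \<sigma>'
          using x(3)[of "?L \<sigma>'"] that unfolding \<sigma>(2) S_def by blast
      qed (use that \<open>i \<noteq> i'\<close> in auto)
      then show ?thesis using that by (simp add: z)
    qed
    then show "\<exists>z. \<forall>a b. a \<in> {1..?n} \<and> \<sigma> a = i \<and> weight I a = w \<longrightarrow>
       b \<in> {1..?n} \<and> \<sigma> b = i' \<and> weight I b = w \<longrightarrow> z \<bullet> lift I b < z \<bullet> lift I a"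
      by blast
  qed
qed

section \<open>Recovering a partition from a guess\<close>

type_synonym guess = "nat list \<Rightarrow> nat"

text \<open>
  For the weight type number \<open>t\<close> and clusters \<open>i\<close>, \<open>i'\<close>, a guess consists of pairs
  \<open>g [t, i, i', k, 0]\<close>, \<open>g [t, i, i', k, 1]\<close> of items in cluster \<open>i\<close> and \<open>i'\<close>, respectively,
  for \<open>k\<close> from \<open>0\<close> to the dimension of the lifted space. The convention \<open>g [t, i, i', 0, 1] = 0\<close> encodes
  that cluster \<open>i'\<close> contains no item of this type.
\<close>

definition normal_vec :: "('d::finite, 'p::finite, 's::finite) problem \<Rightarrow> (nat \<Rightarrow> nat \<Rightarrow> nat) \<Rightarrow>
    (real^'p^'d) \<times> real" where
  "normal_vec I h = foot (map (\<lambda>k. lift I (h k 0) - lift I (h k 1)) [0..<Suc (Suc (CARD('d) * CARD('p)))])"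

text \<open>The threshold is the second item of the first pair, as in
  \<open>separating_foot\<close>.\<close>

definition side :: "('d::finite, 'p::finite, 's::finite) problem \<Rightarrow> (nat \<Rightarrow> nat \<Rightarrow> nat) \<Rightarrow> nat \<Rightarrow> bool" where
  "side I h j \<longleftrightarrow> h 0 1 = 0 \<or> normal_vec I h \<bullet> lift I (h 0 1) < normal_vec I h \<bullet> lift I j"

lemma side_exists:
  fixes I :: "('d::finite, 'p::finite, 's::finite) problem"
  assumes AB: "A \<subseteq> {1..items I}" "B \<subseteq> {1..items I}"
    and sep: "\<And>a b. a \<in> A \<Longrightarrow> b \<in> B \<Longrightarrow> z \<bullet> lift I b < z \<bullet> lift I a"
  obtains h where "\<And>k l. h k l \<le> items I" "\<And>a. a \<in> A \<Longrightarrow> side I h a" "\<And>b. b \<in> B \<Longrightarrow> \<not> side I h b"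
proof -
  consider "B = {}" | "B \<noteq> {}" "A = {}" | "B \<noteq> {}" "A \<noteq> {}" by blast
  then show thesis
  proof cases
    case 1
    \<comment> \<open>The number 0 is no item; it encodes that \<open>B\<close> is empty and puts
      every item on the side of \<open>A\<close>.\<close>
    show thesis by (rule that[of "\<lambda>_ _. 0"]) (use 1 in \<open>auto simp: side_def\<close>)
  next
    case 2
    \<comment> \<open>Pairing an item with itself makes the normal vector 0, and then the strict
      inequality fails for every item. Item 1 exists because \<open>B\<close> is nonempty.\<close>
    then have "1 \<le> items I" using AB(2) by fastforce
    moreover have "normal_vec I (\<lambda>_ _. 1) = 0"
      by (simp add: normal_vec_def map_replicate_const foot_replicate_0 del: upt_Suc replicate_Suc foot.simps)
    ultimately show thesis by (intro that[of "\<lambda>_ _. 1"]) (use 2 in \<open>auto simp: side_def\<close>)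
  next
    case 3
    let ?V = "lift I"
    have fin: "finite A" "finite B" using AB finite_subset by blast+
    obtain ps where ps: "length ps = Suc DIM((real^'p^'d) \<times> real)" "set ps \<subseteq> ?V ` A \<times> ?V ` B"
      "\<And>a. a \<in> ?V ` A \<Longrightarrow> foot (map (\<lambda>(a, b). a - b) ps) \<bullet> snd (hd ps) < foot (map (\<lambda>(a, b). a - b) ps) \<bullet> a"
      "\<And>b. b \<in> ?V ` B \<Longrightarrow> foot (map (\<lambda>(a, b). a - b) ps) \<bullet> b \<le> foot (map (\<lambda>(a, b). a - b) ps) \<bullet> snd (hd ps)"
      by (rule separating_foot[of "?V ` A" "?V ` B" z]) (use fin 3 sep in auto)
    let ?D = "Suc (Suc (CARD('d) * CARD('p)))"
    have len: "length ps = ?D" using ps(1) by simp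
    have "\<forall>k<?D. \<exists>a b. a \<in> A \<and> b \<in> B \<and> ps ! k = (?V a, ?V b)"
    proof (intro allI impI)
      fix k assume "k < ?D"
      then have "ps ! k \<in> set ps" using len by simp
      then have "ps ! k \<in> ?V ` A \<times> ?V ` B" using ps(2) by blast
      then have "fst (ps ! k) \<in> ?V ` A" "snd (ps ! k) \<in> ?V ` B"
        unfolding mem_Times_iff by blast+
      then show "\<exists>a b. a \<in> A \<and> b \<in> B \<and> ps ! k = (?V a, ?V b)"
        by (metis imageE prod.collapse)
    qed
    then obtain p q where pq: "\<And>k. k < ?D \<Longrightarrow> p k \<in> A \<and> q k \<in> B \<and> ps ! k = (?V (p k), ?V (q k))"
      by metis
    define h where "h k l = (if k < ?D then if l = 0 then p k else if l = 1 then q k else 0 else 0)" for k l :: nat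
    have "map (\<lambda>(a, b). a - b) ps = map (\<lambda>k. ?V (h k 0) - ?V (h k 1)) [0..<?D]"
      by (rule nth_equalityI) (use len pq in \<open>auto simp: h_def simp del: upt_Suc\<close>)
    then have nv: "foot (map (\<lambda>(a, b). a - b) ps) = normal_vec I h"
      by (simp only: normal_vec_def)
    have "hd ps = ps ! 0" using len by (intro hd_conv_nth) auto
    then have hd: "snd (hd ps) = ?V (h 0 1)" using pq[of 0] by (simp add: h_def)
    have "h 0 1 \<noteq> 0" using pq[of 0] AB(2) by (auto simp: h_def)
    show thesis
    proof (rule that[of h])
      show "h k l \<le> items I" for k l using pq[of k] AB by (auto simp: h_def)
      show "side I h a" if "a \<in> A" for a
        using ps(3)[of "?V a"] that unfolding nv hd side_def by blast
      show "\<not> side I h b" if "b \<in> B" for b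
        using ps(4)[of "?V b"] that \<open>h 0 1 \<noteq> 0\<close> unfolding nv hd side_def by auto
    qed
  qed
qed

section \<open>Decoding a guess\<close>

text \<open>Comparing with smaller clusters is enough: for a correct guess the true cluster of
  \<open>j\<close> is accepted, and every larger \<open>i\<close> is rejected by the hyperplane
  between \<open>i\<close> and the true cluster. So the true cluster is the largest accepted
  one.\<close>

definition accepts :: "('d::finite, 'p::finite, 's::finite) problem \<Rightarrow> (int^'p^'s) list \<Rightarrow> guess \<Rightarrow> nat \<Rightarrow> nat \<Rightarrow> bool" where
  "accepts I ws g j i \<longleftrightarrow> (\<forall>t<length ws. \<forall>i'<i. weight I j = ws ! t \<longrightarrow>
     side I (\<lambda>k l. g [t, i, i', k, l]) j)"

text \<open>Cluster 0 is accepted vacuously, so the default agrees with the rule, and every guess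
  decodes to some partition.\<close>

fun place :: "('d::finite, 'p::finite, 's::finite) problem \<Rightarrow> (int^'p^'s) list \<Rightarrow> guess \<Rightarrow> nat \<Rightarrow> nat \<Rightarrow> nat" where
  "place I ws g 0 j = 0"
| "place I ws g (Suc m) j = (if accepts I ws g j m then m else place I ws g m j)"

lemma place_less: "0 < m \<Longrightarrow> place I ws g m j < m"
proof (induction m)
  case (Suc m)
  then show ?case by (cases "m = 0") auto
qed simp

lemma place_eq:
  assumes "i < m" "accepts I ws g j i" "\<And>i'. i < i' \<Longrightarrow> i' < m \<Longrightarrow> \<not> accepts I ws g j i'"
  shows "place I ws g m j = i"
  using assms by (induction m) (auto simp: less_Suc_eq)

lemma idx_less [simp]: "idx (i :: 'p::finite) < CARD('p)"
  using bij_betwE[OF to_nat_on_finite[of "UNIV :: 'p set"]] by (auto simp: idx_def)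

lemma elt_idx [simp]: "elt (idx i) = (i :: 'p::finite)"
  by (simp add: elt_def idx_def countable_finite)

lemma idx_elt [simp]: "m < CARD('p) \<Longrightarrow> idx (elt m :: 'p::finite) = m"
  using to_nat_on_finite[of "UNIV :: 'p set"] unfolding elt_def idx_def
  by (intro to_nat_on_from_nat_into) (auto simp: bij_betw_def)

definition decoded :: "('d::finite, 'p::finite, 's::finite) problem \<Rightarrow> (int^'p^'s) list \<Rightarrow> guess \<Rightarrow> 'p \<Rightarrow> nat set" where
  "decoded I ws g = clusters (items I) (\<lambda>j. elt (place I ws g CARD('p) j))"

lemma guess_exists:
  fixes I :: "('d::finite, 'p::finite, 's::finite) problem"
  assumes feas: "feasible I \<rho>" and f: "convex_on UNIV f"
    and ws: "\<And>j. j \<in> {1..items I} \<Longrightarrow> weight I j \<in> set ws"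
  obtains g where "\<And>c. g c \<le> items I" "optimal I f (decoded I ws g)"
proof -
  let ?n = "items I"
  obtain \<sigma> where opt: "optimal I f (clusters ?n \<sigma>)"
    and sep: "\<And>i i' w. i \<noteq> i' \<Longrightarrow> \<exists>z. \<forall>a b. a \<in> {1..?n} \<and> \<sigma> a = i \<and> weight I a = w \<longrightarrow>
       b \<in> {1..?n} \<and> \<sigma> b = i' \<and> weight I b = w \<longrightarrow> z \<bullet> lift I b < z \<bullet> lift I a"
    by (rule separable_optimum[OF feas f]) blast
  have "\<exists>h. (\<forall>k l. h k l \<le> ?n) \<and> (i \<noteq> i' \<longrightarrow>
      (\<forall>a\<in>{1..?n}. \<sigma> a = i \<longrightarrow> weight I a = w \<longrightarrow> side I h a) \<and>
      (\<forall>b\<in>{1..?n}. \<sigma> b = i' \<longrightarrow> weight I b = w \<longrightarrow> \<not> side I h b))" for i i' w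
  proof (cases "i = i'")
    case False
    from sep[OF this, of w] obtain z where z: "\<forall>a b. a \<in> {1..?n} \<and> \<sigma> a = i \<and> weight I a = w \<longrightarrow>
       b \<in> {1..?n} \<and> \<sigma> b = i' \<and> weight I b = w \<longrightarrow> z \<bullet> lift I b < z \<bullet> lift I a" ..
    obtain h where "\<And>k l. h k l \<le> ?n" "\<And>a. a \<in> {a \<in> {1..?n}. \<sigma> a = i \<and> weight I a = w} \<Longrightarrow> side I h a"
      "\<And>b. b \<in> {b \<in> {1..?n}. \<sigma> b = i' \<and> weight I b = w} \<Longrightarrow> \<not> side I h b"
      by (rule side_exists[of "{a \<in> {1..?n}. \<sigma> a = i \<and> weight I a = w}" I
            "{b \<in> {1..?n}. \<sigma> b = i' \<and> weight I b = w}" z]) (use z in auto)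
    then show ?thesis by (intro exI[of _ h]) auto
  qed (intro exI[of _ "\<lambda>_ _. 0"], simp)
  then obtain H where H1: "\<And>i i' w k l. H i i' w k l \<le> ?n"
    and H2: "\<And>i i' w a. i \<noteq> i' \<Longrightarrow> a \<in> {1..?n} \<Longrightarrow> \<sigma> a = i \<Longrightarrow> weight I a = w \<Longrightarrow> side I (H i i' w) a"
    and H3: "\<And>i i' w b. i \<noteq> i' \<Longrightarrow> b \<in> {1..?n} \<Longrightarrow> \<sigma> b = i' \<Longrightarrow> weight I b = w \<Longrightarrow> \<not> side I (H i i' w) b"
    by metis
  define g where "g c = (case c of [t, i, i', k, l] \<Rightarrow> H (elt i) (elt i') (ws ! t) k l | _ \<Rightarrow> 0)" for c
  have side: "side I (\<lambda>k l. g [t, i, i', k, l]) = side I (H (elt i) (elt i') (ws ! t))" for t i i'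
    by (simp add: g_def)
  have "elt (place I ws g CARD('p) j) = \<sigma> j" if j: "j \<in> {1..?n}" for j
  proof -
    have "place I ws g CARD('p) j = idx (\<sigma> j)"
    proof (rule place_eq)
      show "accepts I ws g j (idx (\<sigma> j))" unfolding accepts_def side
      proof (intro allI impI)
        fix t i' assume t: "i' < idx (\<sigma> j)" "weight I j = ws ! t"
        have "i' < CARD('p)" using t(1) idx_less[of "\<sigma> j"] by linarith
        then have "elt i' \<noteq> \<sigma> j" using t(1) by (metis idx_elt less_irrefl)
        then show "side I (H (elt (idx (\<sigma> j))) (elt i') (ws ! t)) j"
          using H2[of "\<sigma> j" "elt i'" j] j t(2) by simp
      qed
      fix i assume i: "idx (\<sigma> j) < i" "i < CARD('p)"
      from ws[OF j] obtain t where t: "t < length ws" "weight I j = ws ! t" by (metis in_set_conv_nth)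
      have "elt i \<noteq> \<sigma> j" using i by (metis idx_elt less_irrefl)
      then have "\<not> side I (H (elt i) (elt (idx (\<sigma> j))) (ws ! t)) j"
        using H3[of "elt i" "\<sigma> j" j] j t(2) by simp
      then show "\<not> accepts I ws g j i" unfolding accepts_def side using t i(1) by blast
    qed simp
    then show ?thesis by simp
  qed
  then have "decoded I ws g = clusters ?n \<sigma>" unfolding decoded_def clusters_def by fastforce
  with opt H1 show thesis
    by (intro that[of g]) (auto simp: g_def split: list.split)
qed

section \<open>Vectors of expressions\<close>

definition grid :: "nat \<Rightarrow> nat \<Rightarrow> (nat \<times> nat) list" where
  "grid m n = List.product [0..<m] [0..<n]"

lemma set_grid: "set (grid m n) = {0..<m} \<times> {0..<n}"
  by (simp add: grid_def)

definition coords :: "(real^'p::finite^'d::finite) \<times> real \<Rightarrow> real list" where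
  "coords v = map (\<lambda>(k, i). fst v $ elt k $ elt i) (grid CARD('d) CARD('p)) @ [snd v]"

lemma sum_elt: "(\<Sum>k\<in>{0..<CARD('a)}. h (elt k)) = (\<Sum>x\<in>(UNIV :: 'a::finite set). h x)"
  by (rule sum.reindex_bij_witness[of _ idx elt]) auto

lemma sum_grid:
  "(\<Sum>(k, i)\<in>{0..<CARD('a)} \<times> {0..<CARD('b)}. F (elt k) (elt i)) =
     (\<Sum>x\<in>(UNIV :: 'a::finite set). \<Sum>y\<in>(UNIV :: 'b::finite set). F x y)"
proof -
  have "(\<Sum>i\<in>{0..<CARD('b)}. F x (elt i)) = (\<Sum>y\<in>(UNIV :: 'b set). F x y)" for x
    by (rule sum_elt)
  then show ?thesis
    unfolding sum.cartesian_product[symmetric]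
    by (simp only: sum_elt[of "\<lambda>x. \<Sum>y\<in>UNIV. F x y"])
qed

lemma map2_map_snoc:
  "map2 h (map f xs @ [a]) (map g xs @ [b]) = map (\<lambda>x. h (f x) (g x)) xs @ [h a b]"
  by (induction xs) auto

lemma map2_coords:
  fixes u v :: "(real^'p::finite^'d::finite) \<times> real"
  shows "map2 h (coords u) (coords v) =
     map (\<lambda>(k, i). h (fst u $ elt k $ elt i) (fst v $ elt k $ elt i)) (grid CARD('d) CARD('p)) @
       [h (snd u) (snd v)]"
  unfolding coords_def map2_map_snoc by (simp add: case_prod_unfold)

lemma coords_diff: "map2 (-) (coords u) (coords v) = coords (u - v)"
  unfolding map2_coords by (simp add: coords_def)

lemma coords_diff_scaleR: "map2 (\<lambda>a b. a - c * b) (coords u) (coords v) = coords (u - c *\<^sub>R v)"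
  unfolding map2_coords by (simp add: coords_def)

lemma inner_coords: "sum_list (map2 (*) (coords u) (coords v)) = u \<bullet> v"
proof -
  have d: "distinct (grid m n)" for m n by (simp add: grid_def distinct_product)
  show ?thesis
    unfolding map2_coords sum_list_append sum_list_distinct_conv_sum_set[OF d] set_grid
      sum_grid[of "\<lambda>k i. fst u $ k $ i * fst v $ k $ i"]
    by (simp add: inner_prod_def inner_vec_def)
qed

definition sub_exp :: "rexp list \<Rightarrow> rexp list \<Rightarrow> rexp list" where
  "sub_exp = map2 RSub"

definition dot_exp :: "rexp list \<Rightarrow> rexp list \<Rightarrow> rexp" where
  "dot_exp es fs = foldr RAdd (map2 RMul es fs) (RConst 0)"

text \<open>Shared subterms are repeated, so the expression grows exponentially with the number of
  vectors. This is harmless, because that number depends only on the dimensions.\<close>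

fun residual_exp :: "rexp list list \<Rightarrow> rexp list \<Rightarrow> rexp list" where
  "residual_exp [] es = es"
| "residual_exp (fs # fss) es =
     map2 (\<lambda>a b. RSub a (RMul (RDiv (dot_exp (residual_exp fss es) (residual_exp fss fs))
         (dot_exp (residual_exp fss fs) (residual_exp fss fs))) b))
       (residual_exp fss es) (residual_exp fss fs)"

fun foot_exp :: "rexp list list \<Rightarrow> rexp list" where
  "foot_exp [] = []"
| "foot_exp (es # ess) = residual_exp (map (\<lambda>fs. sub_exp fs es) ess) es"

definition represents :: "state \<Rightarrow> rexp list \<Rightarrow> (real^'p::finite^'d::finite) \<times> real \<Rightarrow> bool" where
  "represents st es v \<longleftrightarrow> map (rval st) es = coords v"

lemma map_rval_map2:
  assumes "\<And>a b. rval st (ff a b) = gg (rval st a) (rval st b)"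
  shows "map (rval st) (map2 ff es fs) = map2 gg (map (rval st) es) (map (rval st) fs)"
  by (simp add: zip_map_map case_prod_unfold assms)

lemma represents_sub_exp:
  "represents st es u \<Longrightarrow> represents st fs v \<Longrightarrow> represents st (sub_exp es fs) (u - v)"
  using map_rval_map2[of st RSub "(-)" es fs]
  by (simp add: represents_def sub_exp_def coords_diff)

lemma rval_dot_exp:
  assumes "represents st es u" "represents st fs v"
  shows "rval st (dot_exp es fs) = u \<bullet> v"
proof -
  have "rval st (foldr RAdd hs (RConst 0)) = sum_list (map (rval st) hs)" for hs
    by (induction hs) auto
  moreover have "map (rval st) (map2 RMul es fs) = map2 (*) (map (rval st) es) (map (rval st) fs)"
    by (rule map_rval_map2) simp
  ultimately show ?thesis
    using assms by (simp add: dot_exp_def represents_def inner_coords)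
qed

lemma represents_residual_exp:
  "list_all2 (represents st) fss us \<Longrightarrow> represents st es v \<Longrightarrow>
     represents st (residual_exp fss es) (residual us v)"
proof (induction fss us arbitrary: es v rule: list_all2_induct)
  case (Cons fs fss u us)
  note r = Cons.IH[OF Cons.hyps(1)] and e = Cons.IH[OF Cons.prems]
  show ?case
    unfolding represents_def residual_exp.simps residual.simps coords_diff_scaleR[symmetric]
      e[unfolded represents_def, symmetric] r[unfolded represents_def, symmetric]
    by (rule map_rval_map2) (simp add: rval_dot_exp[OF e r] rval_dot_exp[OF r r])
qed simp

lemma represents_foot_exp:
  "list_all2 (represents st) ess us \<Longrightarrow> us \<noteq> [] \<Longrightarrow> represents st (foot_exp ess) (foot us)"
proof (induction ess us rule: list_all2_induct)
  case (Cons es ess u us)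
  have "list_all2 (represents st) (map (\<lambda>fs. sub_exp fs es) ess) (map (\<lambda>v. v - u) us)"
    using Cons.hyps by (auto simp: list_all2_conv_all_nth represents_sub_exp)
  then show ?case using Cons.hyps by (simp add: represents_residual_exp)
qed simp

fun conj_exp :: "bexp list \<Rightarrow> bexp" where
  "conj_exp [] = NLe (NConst 0) (NConst 0)"
| "conj_exp (e # es) = BAnd e (conj_exp es)"

lemma bval_conj_exp [simp]: "bval st (conj_exp es) \<longleftrightarrow> (\<forall>e\<in>set es. bval st e)"
  by (induction es) auto

lemma bval_conj_exp_grid:
  "bval st (conj_exp (map (\<lambda>(k, i). e k i) (grid m n))) \<longleftrightarrow> (\<forall>k<m. \<forall>i<n. bval st (e k i))"
  by (auto simp: set_grid)

section \<open>The state during the enumeration\<close>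

text \<open>No program step: it summarizes the net effect of several cell updates as one update of a
  whole array.\<close>

definition set_array :: "string \<Rightarrow> (nat list \<Rightarrow> real) \<Rightarrow> state \<Rightarrow> state" where
  "set_array a h st = st\<lparr>reals := (reals st)(a := h)\<rparr>"

lemma reals_set_array [simp]:
  "reals (set_array a h st) x = (if x = a then h else reals st x)"
  by (simp add: set_array_def)

lemma nats_set_array [simp]: "nats (set_array a h st) = nats st"
  by (simp add: set_array_def)

lemma set_array_set_array [simp]: "set_array a h (set_array a h' st) = set_array a h st"
  by (simp add: set_array_def)

lemma set_array_eq: "set_array a (reals st a) st = st"
  by (simp add: set_array_def)

lemma set_real_eq_set_array: "set_real x is v st = set_array x ((reals st x)(is := v)) st"
  by (simp add: set_array_def set_real_def)

lemma nats_set_nat_other [simp]: "y \<noteq> x \<Longrightarrow> nats (set_nat x is v st) y = nats st y"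
  by (simp add: set_nat_def)

lemma nats_set_nat_same [simp]: "nats (set_nat x is v st) x = (nats st x)(is := v)"
  by (simp add: set_nat_def)

text \<open>The last coordinate of \<open>lift\<close> needs item numbers as reals, and the machine
  does not convert naturals. The program fills this table by repeated addition of 1;
  \<open>m\<close> is the number of entries filled so far.\<close>

definition J_array :: "nat \<Rightarrow> nat list \<Rightarrow> real" where
  "J_array m is = (case is of [j] \<Rightarrow> if j \<in> {1..m} then real j else 0 | _ \<Rightarrow> 0)"

definition data_state :: "('d::finite, 'p::finite, 's::finite) problem \<Rightarrow> state \<Rightarrow> bool" where
  "data_state I st \<longleftrightarrow> nats st ''n'' [] = items I \<and> reals st ''J'' = J_array (items I) \<and>
     (\<forall>x. x \<notin> {''J'', ''X'', ''Y'', ''best''} \<longrightarrow> reals st x = reals (input_state I) x)"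

lemma data_state_set_nat [simp]:
  "x \<noteq> ''n'' \<Longrightarrow> data_state I (set_nat x is v st) = data_state I st"
  by (simp add: data_state_def)

lemma data_state_set_array [simp]:
  "a \<in> {''X'', ''Y'', ''best''} \<Longrightarrow> data_state I (set_array a h st) = data_state I st"
  by (auto simp: data_state_def)

lemma C_array: "reals (input_state (I :: ('d::finite, 'p::finite, 's::finite) problem)) ''C'' [j, k, i] =
    (if j \<in> {1..items I} \<and> k < CARD('d) \<and> i < CARD('p) then utility I j $ elt k $ elt i else 0)"
  unfolding input_state_def state.select_convs list.case by simp

lemma W_array: "reals (input_state (I :: ('d::finite, 'p::finite, 's::finite) problem)) ''W'' [j, k, i] =
    (if j \<in> {1..items I} \<and> k < CARD('s) \<and> i < CARD('p) then of_int (weight I j $ elt k $ elt i) else 0)"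
  unfolding input_state_def state.select_convs list.case by simp

lemma Bmin_array: "reals (input_state (I :: ('d::finite, 'p::finite, 's::finite) problem)) ''Bmin'' [i, k] =
    (if i < CARD('p) \<and> k < CARD('s) then of_int (lower I (elt i) $ elt k) else 0)"
  unfolding input_state_def state.select_convs list.case by simp

lemma Bmax_array: "reals (input_state (I :: ('d::finite, 'p::finite, 's::finite) problem)) ''Bmax'' [i, k] =
    (if i < CARD('p) \<and> k < CARD('s) then of_int (upper I (elt i) $ elt k) else 0)"
  unfolding input_state_def state.select_convs list.case by simp

text \<open>The array \<open>''Z''\<close> is never written and serves as a source of zeros for
  clearing the totals.\<close>

lemma Z_array: "reals (input_state I) ''Z'' = (\<lambda>_. 0)"
  unfolding input_state_def state.select_convs by (rule ext) (simp split: list.split)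

section \<open>The loop-free parts of the program\<close>

definition item_exp :: "nat \<Rightarrow> nat \<Rightarrow> nexp \<Rightarrow> rexp list" where
  "item_exp d p e = map (\<lambda>(k, i). RGet ''C'' [e, NConst k, NConst i]) (grid d p) @ [RGet ''J'' [e]]"

text \<open>Cells outside the input hold 0, in agreement with the value 0 of \<open>lift\<close> at
  numbers that are no items.\<close>

lemma represents_item_exp:
  fixes I :: "('d::finite, 'p::finite, 's::finite) problem"
  assumes "data_state I st"
  shows "represents st (item_exp CARD('d) CARD('p) e) (lift I (nval st e))"
proof -
  have "reals st ''C'' [nval st e, k, i] = fst (lift I (nval st e)) $ elt k $ elt i"
    if "k < CARD('d)" "i < CARD('p)" for k i
    using assms that by (simp add: data_state_def C_array lift_def)
  then show ?thesis
    using assms by (auto simp: represents_def item_exp_def coords_def set_grid data_state_def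
        J_array_def lift_def)
qed

definition guess_exp :: "nat \<Rightarrow> nat \<Rightarrow> nat \<Rightarrow> nat \<Rightarrow> nat \<Rightarrow> nexp" where
  "guess_exp t i i' k l = NGet ''G'' (map NConst [t, i, i', k, l])"

definition normal_exp :: "nat \<Rightarrow> nat \<Rightarrow> nat \<Rightarrow> nat \<Rightarrow> nat \<Rightarrow> rexp list" where
  "normal_exp d p t i i' = foot_exp (map (\<lambda>k. sub_exp (item_exp d p (guess_exp t i i' k 0))
     (item_exp d p (guess_exp t i i' k 1))) [0..<Suc (Suc (d * p))])"

definition side_exp :: "nat \<Rightarrow> nat \<Rightarrow> nat \<Rightarrow> nat \<Rightarrow> nat \<Rightarrow> bexp" where
  "side_exp d p t i i' = BNot (BAnd (NLe (NConst 1) (guess_exp t i i' 0 1))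
     (RLe (dot_exp (normal_exp d p t i i') (item_exp d p (NGet ''j'' [])))
       (dot_exp (normal_exp d p t i i') (item_exp d p (guess_exp t i i' 0 1)))))"

lemma bval_side_exp:
  fixes I :: "('d::finite, 'p::finite, 's::finite) problem"
  assumes "data_state I st"
  shows "bval st (side_exp CARD('d) CARD('p) t i i') \<longleftrightarrow>
    side I (\<lambda>k l. nats st ''G'' [t, i, i', k, l]) (nats st ''j'' [])"
proof -
  let ?h = "\<lambda>k l. nats st ''G'' [t, i, i', k, l]"
  have g: "nval st (guess_exp t i i' k l) = ?h k l" for k l by (simp add: guess_exp_def)
  note it = represents_item_exp[OF assms]
  have "represents st (normal_exp CARD('d) CARD('p) t i i') (normal_vec I ?h)"
    unfolding normal_exp_def normal_vec_def
  proof (rule represents_foot_exp)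
    show "list_all2 (represents st)
      (map (\<lambda>k. sub_exp (item_exp CARD('d) CARD('p) (guess_exp t i i' k 0))
        (item_exp CARD('d) CARD('p) (guess_exp t i i' k 1))) [0..<Suc (Suc (CARD('d) * CARD('p)))])
      (map (\<lambda>k. lift I (?h k 0) - lift I (?h k 1)) [0..<Suc (Suc (CARD('d) * CARD('p)))])"
      using represents_sub_exp[OF it it, of "guess_exp t i i' k 0" "guess_exp t i i' k 1" for k]
      by (simp add: list_all2_conv_all_nth g del: upt_Suc)
  qed simp
  note n = this
  show ?thesis
    using rval_dot_exp[OF n it, of "NGet ''j'' []"] rval_dot_exp[OF n it, of "guess_exp t i i' 0 1"]
    by (auto simp: side_exp_def side_def g)
qed

text \<open>The weight types enter the program as constants, which is why they have to come from a
  fixed finite set. Two inequalities express equality of reals.\<close>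

definition weight_exp :: "int^'p::finite^'s::finite \<Rightarrow> bexp" where
  "weight_exp w = conj_exp (map (\<lambda>(k, i).
     let a = RGet ''W'' [NGet ''j'' [], NConst k, NConst i]; b = RConst (w $ elt k $ elt i)
     in BAnd (RLe a b) (RLe b a)) (grid CARD('s) CARD('p)))"

lemma all_less_card: "(\<forall>k<CARD('a::finite). P k) \<longleftrightarrow> (\<forall>x::'a. P (idx x))"
  by (metis idx_elt idx_less)

lemma bval_weight_exp:
  fixes I :: "('d::finite, 'p::finite, 's::finite) problem"
  assumes "data_state I st" "nats st ''j'' [] \<in> {1..items I}"
  shows "bval st (weight_exp w) \<longleftrightarrow> weight I (nats st ''j'' []) = w"
proof -
  let ?j = "nats st ''j'' []"
  have W: "reals st ''W'' = reals (input_state I) ''W''" using assms(1) by (simp add: data_state_def)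
  have "bval st (weight_exp w) \<longleftrightarrow> (\<forall>k<CARD('s). \<forall>i<CARD('p).
      reals st ''W'' [?j, k, i] = of_int (w $ elt k $ elt i))"
    unfolding weight_exp_def Let_def bval_conj_exp_grid by (simp add: order.eq_iff)
  also have "\<dots> \<longleftrightarrow> (\<forall>(k::'s) (i::'p). weight I ?j $ k $ i = w $ k $ i)"
    unfolding all_less_card W using assms(2) by (simp add: W_array)
  finally show ?thesis by (simp add: vec_eq_iff)
qed

definition accepts_exp :: "nat \<Rightarrow> (int^'p::finite^'s::finite) list \<Rightarrow> nat \<Rightarrow> bexp" where
  "accepts_exp d ws i = conj_exp (map (\<lambda>(t, i').
     BNot (BAnd (weight_exp (ws ! t)) (BNot (side_exp d CARD('p) t i i')))) (grid (length ws) i))"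

lemma bval_accepts_exp:
  fixes I :: "('d::finite, 'p::finite, 's::finite) problem"
  assumes "data_state I st" "nats st ''j'' [] \<in> {1..items I}"
  shows "bval st (accepts_exp CARD('d) ws i) \<longleftrightarrow> accepts I ws (nats st ''G'') (nats st ''j'' []) i"
  using bval_side_exp[OF assms(1)] bval_weight_exp[OF assms]
  unfolding accepts_exp_def accepts_def bval_conj_exp_grid by simp

text \<open>Clusters are tried upwards and a later accepted one overwrites an earlier one, in
  agreement with the preference of \<open>place\<close> for large numbers.\<close>

fun place_com :: "nat \<Rightarrow> (int^'p::finite^'s::finite) list \<Rightarrow> nat \<Rightarrow> com" where
  "place_com d ws 0 = NSet ''c'' [NGet ''j'' []] (NConst 0)"
| "place_com d ws (Suc m) = Seq (place_com d ws m)
     (Cond (accepts_exp d ws m) (NSet ''c'' [NGet ''j'' []] (NConst m)) Skip)"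

lemma sem_place_com:
  fixes I :: "('d::finite, 'p::finite, 's::finite) problem"
  assumes "data_state I st" "nats st ''j'' [] \<in> {1..items I}"
  shows "sem orc (place_com CARD('d) ws m) st =
    set_nat ''c'' [nats st ''j'' []] (place I ws (nats st ''G'') m (nats st ''j'' [])) st"
proof (induction m)
  case (Suc m)
  have "set_nat x js v (set_nat x js u st) = set_nat x js v st" for x js u v
    by (simp add: set_nat_def)
  then show ?case
    using assms by (simp add: Suc bval_accepts_exp)
qed simp

lemma loop_free_place_com [simp]: "loop_free (place_com d ws m)"
  by (induction m) auto

definition j_cluster :: nexp where
  "j_cluster = NGet ''c'' [NGet ''j'' []]"

fun acc_com :: "string \<Rightarrow> string \<Rightarrow> nat \<Rightarrow> com" where
  "acc_com a y 0 = Skip"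
| "acc_com a y (Suc k) = Seq (acc_com a y k) (RSet a [NConst k, j_cluster]
     (RAdd (RGet a [NConst k, j_cluster]) (RGet y [NGet ''j'' [], NConst k, j_cluster])))"

lemma loop_free_acc_com [simp]: "loop_free (acc_com a y q)"
  by (induction q) auto

lemma sem_acc_com:
  assumes "a \<noteq> y"
  shows "sem orc (acc_com a y q) st = set_array a (\<lambda>is. case is of [k, i] \<Rightarrow>
      if k < q \<and> i = nats st ''c'' [nats st ''j'' []]
      then reals st a is + reals st y [nats st ''j'' [], k, i] else reals st a is
    | _ \<Rightarrow> reals st a is) st"
proof (induction q)
  case 0
  have "(\<lambda>is. case is of [k, i] \<Rightarrow>
      if k < 0 \<and> i = nats st ''c'' [nats st ''j'' []]
      then reals st a is + reals st y [nats st ''j'' [], k, i] else reals st a is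
    | _ \<Rightarrow> reals st a is) = reals st a"
    by (rule ext) (simp split: list.split)
  then show ?case by (simp only: acc_com.simps sem.simps set_array_eq)
next
  case (Suc q)
  show ?case
    using assms
    by (auto simp: Suc set_real_eq_set_array j_cluster_def less_Suc_eq fun_eq_iff
        intro!: arg_cong2[of _ _ _ _ "\<lambda>h s. set_array a h s"] split: list.split)
qed

text \<open>The items below \<open>v\<close> are those processed when the loop counter reaches
  \<open>v\<close>. Taking the array as a whole allows states to be compared by equality.\<close>

definition partial_total :: "('d::finite, 'p::finite, 's::finite) problem \<Rightarrow> (int^'p^'s) list \<Rightarrow> string \<Rightarrow>
    guess \<Rightarrow> nat \<Rightarrow> nat list \<Rightarrow> real" where
  "partial_total I ws y g v is = (case is of [k, i] \<Rightarrow>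
     \<Sum>j\<in>{1..<v}. if place I ws g CARD('p) j = i then reals (input_state I) y [j, k, i] else 0
   | _ \<Rightarrow> 0)"

lemma partial_total_1: "partial_total I ws y g 1 = (\<lambda>_. 0)"
  by (rule ext) (simp add: partial_total_def split: list.split)

text \<open>Only the rows below \<open>q\<close> are updated, yet the arrays agree everywhere,
  because the remaining rows of the input array are 0.\<close>

lemma sem_acc_com_partial_total:
  fixes I :: "('d::finite, 'p::finite, 's::finite) problem"
  assumes "data_state I st" "a \<in> {''X'', ''Y''}" "y \<in> {''C'', ''W''}"
    and "nats st ''j'' [] = v" "1 \<le> v" "nats st ''c'' [v] = place I ws g CARD('p) v"
    and "reals st a = partial_total I ws y g v"
    and "\<And>j k i. q \<le> k \<Longrightarrow> reals (input_state I) y [j, k, i] = 0"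
  shows "sem orc (acc_com a y q) st = set_array a (partial_total I ws y g (Suc v)) st"
proof -
  have ay: "a \<noteq> y" using assms(2,3) by auto
  have "y \<notin> {''J'', ''X'', ''Y'', ''best''}" using assms(3) by auto
  with assms(1) have y: "reals st y = reals (input_state I) y" unfolding data_state_def by blast
  have iv: "{1..<Suc v} = insert v {1..<v}" using assms(5) by auto
  have "(case is of [k, i] \<Rightarrow>
      if k < q \<and> i = nats st ''c'' [nats st ''j'' []]
      then reals st a is + reals st y [nats st ''j'' [], k, i] else reals st a is
    | _ \<Rightarrow> reals st a is) = partial_total I ws y g (Suc v) is" for "is"
    unfolding y assms(4,6,7) partial_total_def iv
    using assms(8) by (auto split: list.split simp: not_less)
  then show ?thesis unfolding sem_acc_com[OF ay] by presburger
qed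

lemma partial_total_utility:
  fixes I :: "('d::finite, 'p::finite, 's::finite) problem"
  shows "(\<chi> k i. partial_total I ws ''C'' g (Suc (items I)) [idx k, idx i]) =
    total_utility I (decoded I ws g)"
proof -
  have e: "elt (place I ws g CARD('p) j) = i \<longleftrightarrow> place I ws g CARD('p) j = idx i" for j and i :: 'p
    using place_less[of "CARD('p)" I ws g j] by (metis elt_idx idx_elt zero_less_card_finite)
  have "partial_total I ws ''C'' g (Suc (items I)) [idx k, idx i] =
      total_utility I (decoded I ws g) $ k $ i" for k :: 'd and i :: 'p
    unfolding decoded_def total_utility_clusters partial_total_def e
    by (auto intro!: sum.cong simp: C_array atLeastLessThanSuc_atLeastAtMost)
  then show ?thesis by (simp add: vec_eq_iff)
qed

definition bounds_exp :: "nat \<Rightarrow> nat \<Rightarrow> bexp" where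
  "bounds_exp s p = conj_exp (map (\<lambda>(k, i).
     BAnd (RLe (RGet ''Bmin'' [NConst i, NConst k]) (RGet ''X'' [NConst k, NConst i]))
       (RLe (RGet ''X'' [NConst k, NConst i]) (RGet ''Bmax'' [NConst i, NConst k]))) (grid s p))"

lemma bval_bounds_exp:
  fixes I :: "('d::finite, 'p::finite, 's::finite) problem"
  assumes "data_state I st" "reals st ''X'' = partial_total I ws ''W'' g (Suc (items I))"
  shows "bval st (bounds_exp CARD('s) CARD('p)) \<longleftrightarrow> feasible I (decoded I ws g)"
proof -
  have e: "elt (place I ws g CARD('p) j) = i \<longleftrightarrow> place I ws g CARD('p) j = idx i" for j and i :: 'p
    using place_less[of "CARD('p)" I ws g j] by (metis elt_idx idx_elt zero_less_card_finite)
  have X: "reals st ''X'' [idx k, idx i] =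
      of_int (\<Sum>j\<in>{1..items I}. if elt (place I ws g CARD('p) j) = i then weight I j $ k $ i else 0)"
    for k :: 's and i :: 'p
    unfolding assms(2) partial_total_def e of_int_sum
    by (auto intro!: sum.cong simp: W_array atLeastLessThanSuc_atLeastAtMost)
  have "bval st (bounds_exp CARD('s) CARD('p)) \<longleftrightarrow> (\<forall>k<CARD('s). \<forall>i<CARD('p).
      reals st ''Bmin'' [i, k] \<le> reals st ''X'' [k, i] \<and> reals st ''X'' [k, i] \<le> reals st ''Bmax'' [i, k])"
    unfolding bounds_exp_def bval_conj_exp_grid by simp
  also have "\<dots> \<longleftrightarrow> (\<forall>(k::'s) (i::'p). of_int (lower I i $ k) \<le> reals st ''X'' [idx k, idx i] \<and>
      reals st ''X'' [idx k, idx i] \<le> of_int (upper I i $ k))"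
    using assms(1) unfolding all_less_card by (simp add: data_state_def Bmin_array Bmax_array)
  also have "\<dots> \<longleftrightarrow> feasible I (decoded I ws g)"
    unfolding X of_int_le_iff decoded_def feasible_clusters by blast
  finally show ?thesis .
qed

fun copy_com :: "string \<Rightarrow> string \<Rightarrow> (nat \<times> nat) list \<Rightarrow> com" where
  "copy_com a y [] = Skip"
| "copy_com a y ((k, i) # cs) = Seq (RSet a (map NConst [k, i]) (RGet y (map NConst [k, i]))) (copy_com a y cs)"

lemma loop_free_copy_com [simp]: "loop_free (copy_com a y cs)"
  by (induction a y cs rule: copy_com.induct) auto

lemma sem_copy_com:
  "a \<noteq> y \<Longrightarrow> sem orc (copy_com a y cs) st = set_array a (\<lambda>is.
     if is \<in> (\<lambda>(k, i). [k, i]) ` set cs then reals st y is else reals st a is) st"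
proof (induction a y cs arbitrary: st rule: copy_com.induct)
  case (1 a y)
  then show ?case by (simp add: set_array_eq)
next
  case (2 a y k i cs)
  then show ?case
    by (auto simp: set_real_eq_set_array fun_eq_iff intro!: arg_cong2[of _ _ _ _ "\<lambda>h s. set_array a h s"])
qed

section \<open>Enumeration of all guesses\<close>

text \<open>The counters are the cells of \<open>''G''\<close>, so the array of counters is at any
  time the current guess. The nesting depth is fixed for a given program, which keeps the number of
  rounds polynomial.\<close>

fun loops :: "nat list list \<Rightarrow> com \<Rightarrow> com" where
  "loops [] c = c"
| "loops (y # ys) c = For ''G'' y 0 (loops ys c)"

text \<open>
  If the body preserves \<open>cov\<close> and establishes it for the guess \<open>gs x\<close>, then \<open>cov\<close> holds after
  the enumeration. The logical variable \<open>b\<close> records whether \<open>cov\<close> was true before.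
\<close>

lemma ptriple_loops:
  fixes N :: "'x \<Rightarrow> nat"
  assumes body: "ptriple sz (\<lambda>(x, g, b). N x) (\<lambda>(x, g, b). orc x)
      (\<lambda>(x, g, b) st. Inv x st \<and> nats st ''G'' = g \<and> (b \<longrightarrow> cov x st)) c
      (\<lambda>(x, g, b) st. Inv x st \<and> nats st ''G'' = g \<and> (b \<or> (\<forall>y\<in>D. g y = gs x y) \<longrightarrow> cov x st))"
    and Inv_G: "\<And>x st y v. Inv x (set_nat ''G'' y v st) = Inv x st"
    and cov_G: "\<And>x st y v. cov x (set_nat ''G'' y v st) = cov x st"
    and n: "\<And>x st. Inv x st \<Longrightarrow> nats st ''n'' [] = n x \<and> n x \<le> N x \<and> (\<forall>y. gs x y \<le> n x)"
  shows "distinct ys \<Longrightarrow> set ys \<subseteq> D \<Longrightarrow> ptriple sz (\<lambda>(x, g, b). N x) (\<lambda>(x, g, b). orc x)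
      (\<lambda>(x, g, b) st. Inv x st \<and> (\<forall>y. y \<notin> set ys \<longrightarrow> nats st ''G'' y = g y) \<and> (b \<longrightarrow> cov x st))
      (loops ys c)
      (\<lambda>(x, g, b) st. Inv x st \<and> (\<forall>y. y \<notin> set ys \<longrightarrow> nats st ''G'' y = g y) \<and>
         (b \<or> (\<forall>y\<in>D - set ys. g y = gs x y) \<longrightarrow> cov x st))"
proof (induction ys)
  case Nil
  show ?case
    unfolding loops.simps
  proof (rule ptriple_conseq[OF body], goal_cases)
    case (1 x st)
    then show ?case by (intro exI[of _ x]) (auto simp: fun_eq_iff)
  qed
next
  case (Cons z zs)
  then have z: "z \<notin> set zs" "z \<in> D" by auto
  have IH: "ptriple sz (\<lambda>(x, g, b). N x) (\<lambda>(x, g, b). orc x)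
      (\<lambda>(x, g, b) st. Inv x st \<and> (\<forall>y. y \<notin> set zs \<longrightarrow> nats st ''G'' y = g y) \<and> (b \<longrightarrow> cov x st))
      (loops zs c)
      (\<lambda>(x, g, b) st. Inv x st \<and> (\<forall>y. y \<notin> set zs \<longrightarrow> nats st ''G'' y = g y) \<and>
         (b \<or> (\<forall>y\<in>D - set zs. g y = gs x y) \<longrightarrow> cov x st))"
    by (rule Cons.IH) (use Cons.prems in auto)
  \<comment> \<open>The outer counters already agree with the target, and an earlier round had the
    right value at \<open>z\<close>.\<close>
  let ?hit = "\<lambda>x g v. gs x z < v \<and> (\<forall>y\<in>D - set (z # zs). g y = gs x y)"
  let ?I = "\<lambda>(x, g, b) v st. Inv x st \<and> (\<forall>y. y \<notin> set (z # zs) \<longrightarrow> nats st ''G'' y = g y) \<and>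
      (b \<or> ?hit x g v \<longrightarrow> cov x st)"
  show ?case
    unfolding loops.simps
  proof (rule ptriple_For[where I = ?I and n = "\<lambda>(x, g, b). n x"])
    show "ptriple sz (\<lambda>(x, v). case x of (x, g, b) \<Rightarrow> N x) (\<lambda>(x, v). case x of (x, g, b) \<Rightarrow> orc x)
      (\<lambda>(x, v) st. 0 \<le> v \<and> v \<le> (case x of (x, g, b) \<Rightarrow> n x) \<and> nats st ''G'' z = v \<and> ?I x v st)
      (loops zs c) (\<lambda>(x, v) st. nats st ''G'' z = v \<and> ?I x (Suc v) (set_nat ''G'' z (Suc v) st))"
    proof (rule ptriple_conseq[OF IH], goal_cases)
      case (1 xv st)
      obtain x g b v where xv: "xv = ((x, g, b), v)" by (metis surj_pair)
      with 1 have 1: "v \<le> n x" "nats st ''G'' z = v" "Inv x st"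
        "\<forall>y. y \<notin> set (z # zs) \<longrightarrow> nats st ''G'' y = g y" "b \<or> ?hit x g v \<longrightarrow> cov x st"
        by auto
      have cov: "cov x st'" if "b \<or> ?hit x g (Suc v)" "Inv x st'"
        "(b \<or> ?hit x g v) \<or> (\<forall>y\<in>D - set zs. (g(z := v)) y = gs x y) \<longrightarrow> cov x st'" for st'
      proof -
        have "(b \<or> ?hit x g v) \<or> (\<forall>y\<in>D - set zs. (g(z := v)) y = gs x y)"
          using that(1) by (auto simp: less_Suc_eq)
        with that(3) show ?thesis by blast
      qed
      \<comment> \<open>The ghost guess now fixes counter \<open>z\<close> at \<open>v\<close>, and
        the ghost flag also records whether the target was met in an earlier round.\<close>
      show ?case
      proof (intro exI[of _ "(x, g(z := v), b \<or> ?hit x g v)"] conjI allI impI)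
        show "(case (x, g(z := v), b \<or> ?hit x g v) of (x, g, b) \<Rightarrow> \<lambda>st. Inv x st \<and>
            (\<forall>y. y \<notin> set zs \<longrightarrow> nats st ''G'' y = g y) \<and> (b \<longrightarrow> cov x st)) st"
          using 1 by auto
      next
        fix st'
        assume 2: "(case (x, g(z := v), b \<or> ?hit x g v) of (x, g, b) \<Rightarrow> \<lambda>st. Inv x st \<and>
            (\<forall>y. y \<notin> set zs \<longrightarrow> nats st ''G'' y = g y) \<and>
            (b \<or> (\<forall>y\<in>D - set zs. g y = gs x y) \<longrightarrow> cov x st)) st'"
        then have 3: "Inv x st'" "\<forall>y. y \<notin> set zs \<longrightarrow> nats st' ''G'' y = (g(z := v)) y"
          "(b \<or> ?hit x g v) \<or> (\<forall>y\<in>D - set zs. (g(z := v)) y = gs x y) \<longrightarrow> cov x st'"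
          unfolding prod.case by blast+
        have "nats st' ''G'' z = v" using 3(2) z(1) by simp
        show "(case xv of (x, v) \<Rightarrow> \<lambda>st. nats st ''G'' z = v \<and>
            ?I x (Suc v) (set_nat ''G'' z (Suc v) st)) st'"
          using \<open>nats st' ''G'' z = v\<close> 3(1,2) cov[OF _ 3(1,3)] unfolding xv by (auto simp: Inv_G cov_G)
      qed (simp_all add: xv)
    qed
  qed (use n in \<open>auto simp: Inv_G cov_G less_Suc_eq_le split: prod.splits\<close>)
qed

text \<open>\<open>remdups\<close> secures distinctness: an inner loop must not overwrite the
  counter of an outer one.\<close>

definition guess_cells :: "nat \<Rightarrow> nat \<Rightarrow> nat \<Rightarrow> nat list list" where
  "guess_cells m p D = remdups [[t, i, i', k, l]. t \<leftarrow> [0..<m], i \<leftarrow> [0..<p], i' \<leftarrow> [0..<p],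
     k \<leftarrow> [0..<D], l \<leftarrow> [0..<2]]"

lemma set_guess_cells:
  "t < m \<Longrightarrow> i < p \<Longrightarrow> i' < p \<Longrightarrow> k < D \<Longrightarrow> l < 2 \<Longrightarrow> [t, i, i', k, l] \<in> set (guess_cells m p D)"
  by (force simp: guess_cells_def)

lemma side_cong:
  fixes I :: "('d::finite, 'p::finite, 's::finite) problem"
  assumes "\<And>k l. k < Suc (Suc (CARD('d) * CARD('p))) \<Longrightarrow> l < 2 \<Longrightarrow> h k l = h' k l"
  shows "side I h j = side I h' j"
proof -
  have "normal_vec I h = normal_vec I h'"
    unfolding normal_vec_def by (rule arg_cong[of _ _ foot], rule map_cong) (simp_all add: assms del: upt_Suc)
  then show ?thesis using assms[of 0 1] by (simp add: side_def)
qed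

text \<open>A guess is a function on all index lists, but only finitely many cells are enumerated.
  Hence it suffices that the enumeration meets the target guess on these cells.\<close>

lemma decoded_cong:
  fixes I :: "('d::finite, 'p::finite, 's::finite) problem"
  assumes "\<forall>y\<in>set (guess_cells (length ws) CARD('p) (Suc (Suc (CARD('d) * CARD('p))))). g y = g' y"
  shows "decoded I ws g = decoded I ws g'"
proof -
  have "accepts I ws g j i = accepts I ws g' j i" if "i < CARD('p)" for j i
  proof -
    have "side I (\<lambda>k l. g [t, i, i', k, l]) j = side I (\<lambda>k l. g' [t, i, i', k, l]) j"
      if "t < length ws" "i' < i" for t i'
      using that \<open>i < CARD('p)\<close> by (intro side_cong bspec[OF assms] set_guess_cells) auto
    then show ?thesis unfolding accepts_def by blast
  qed
  then have "m \<le> CARD('p) \<Longrightarrow> place I ws g m j = place I ws g' m j" for m j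
    by (induction m) auto
  then show ?thesis by (simp add: decoded_def)
qed

section \<open>The program\<close>

definition item_com :: "nat \<Rightarrow> (int^'p::finite^'s::finite) list \<Rightarrow> com" where
  "item_com d ws = Seq (place_com d ws CARD('p))
     (Seq (acc_com ''Y'' ''C'' d) (acc_com ''X'' ''W'' CARD('s)))"

definition reset_com :: "nat \<Rightarrow> nat \<Rightarrow> nat \<Rightarrow> com" where
  "reset_com d p s = Seq (copy_com ''Y'' ''Z'' (grid d p)) (copy_com ''X'' ''Z'' (grid s p))"

text \<open>\<open>''q''\<close> first holds the answer of the oracle and then the verdict. While
  nothing is stored, \<open>''best''\<close> is meaningless and the answer is disregarded.\<close>

definition decide_com :: "nat \<Rightarrow> nat \<Rightarrow> com" where
  "decide_com p s = Seq (Query ''q'' [] ''best'' ''Y'')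
     (Cond (BAnd (bounds_exp s p)
         (BNot (BAnd (NLe (NConst 1) (NGet ''feasible'' [])) (NLe (NGet ''q'' []) (NConst 0)))))
       (NSet ''q'' [] (NConst 1)) (NSet ''q'' [] (NConst 0)))"

text \<open>The verdict is tested inside the body, so that the whole program consists of
  unconditional loops and loop-free parts.\<close>

definition save_com :: com where
  "save_com = Cond (NLe (NConst 1) (NGet ''q'' [])) (NSet ''cluster'' [NGet ''j'' []] j_cluster) Skip"

definition best_com :: "nat \<Rightarrow> nat \<Rightarrow> com" where
  "best_com d p = Cond (NLe (NConst 1) (NGet ''q'' []))
     (Seq (NSet ''feasible'' [] (NConst 1)) (copy_com ''best'' ''Y'' (grid d p))) Skip"

definition guess_com :: "nat \<Rightarrow> (int^'p::finite^'s::finite) list \<Rightarrow> com" where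
  "guess_com d ws = Seq (reset_com d CARD('p) CARD('s)) (Seq (For ''j'' [] 1 (item_com d ws))
     (Seq (decide_com CARD('p) CARD('s)) (Seq (For ''j'' [] 1 save_com) (best_com d CARD('p)))))"

definition J_com :: com where
  "J_com = RSet ''J'' [NGet ''j'' []] (RAdd (RGet ''J'' [NSub (NGet ''j'' []) (NConst 1)]) (RConst 1))"

definition partition_com :: "nat \<Rightarrow> (int^'p::finite^'s::finite) list \<Rightarrow> com" where
  "partition_com d ws = Seq (For ''j'' [] 1 J_com)
     (loops (guess_cells (length ws) CARD('p) (Suc (Suc (d * CARD('p))))) (guess_com d ws))"

definition matrix_of :: "(nat list \<Rightarrow> real) \<Rightarrow> real^'p::finite^'d::finite" where
  "matrix_of a = (\<chi> k i. a [idx k, idx i])"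

lemma comparison_oracle_iff: "comparison_oracle f a b \<longleftrightarrow> f (matrix_of a) \<le> f (matrix_of b)"
  by (simp add: comparison_oracle_def matrix_of_def)

definition sound :: "('d::finite, 'p::finite, 's::finite) problem \<Rightarrow> state \<Rightarrow> bool" where
  "sound I st \<longleftrightarrow> nats st ''feasible'' [] = 0 \<or> nats st ''feasible'' [] = 1 \<and>
     feasible I (output_partition (items I) st) \<and>
     matrix_of (reals st ''best'') = total_utility I (output_partition (items I) st)"

text \<open>Used for one \<open>\<pi>\<close> fixed in advance, the partition decoded from the
  target guess. If that partition is optimal, this turns \<open>sound\<close> into optimality at the
  end.\<close>

definition covered :: "('d::finite, 'p::finite, 's::finite) problem \<Rightarrow> (real^'p^'d \<Rightarrow> real) \<Rightarrow>
    ('p \<Rightarrow> nat set) \<Rightarrow> state \<Rightarrow> bool" where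
  "covered I f \<pi> st \<longleftrightarrow> (feasible I \<pi> \<longrightarrow> nats st ''feasible'' [] = 1 \<and>
     f (total_utility I \<pi>) \<le> f (matrix_of (reals st ''best'')))"

definition better :: "('d::finite, 'p::finite, 's::finite) problem \<Rightarrow> (real^'p^'d \<Rightarrow> real) \<Rightarrow>
    ('p \<Rightarrow> nat set) \<Rightarrow> state \<Rightarrow> bool" where
  "better I f \<pi> st \<longleftrightarrow> feasible I \<pi> \<and> (nats st ''feasible'' [] = 0 \<or>
     f (matrix_of (reals st ''best'')) \<le> f (total_utility I \<pi>))"

lemma output_partition_set_nat [simp]:
  "x \<noteq> ''cluster'' \<Longrightarrow> output_partition n (set_nat x is v st) = output_partition n st"
  by (simp add: output_partition_def fun_eq_iff)

lemma output_partition_set_array [simp]: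
  "output_partition n (set_array a h st) = output_partition n st"
  by (simp add: output_partition_def fun_eq_iff)

lemma output_partition_decoded:
  fixes I :: "('d::finite, 'p::finite, 's::finite) problem"
  assumes "\<forall>j\<in>{1..items I}. nats st ''cluster'' [j] = place I ws g CARD('p) j"
  shows "output_partition (items I) st = decoded I ws g"
proof
  fix i :: 'p
  have "elt (place I ws g CARD('p) j) = i \<longleftrightarrow> place I ws g CARD('p) j = idx i" for j
    using place_less[of "CARD('p)" I ws g j] by (metis elt_idx idx_elt zero_less_card_finite)
  then show "output_partition (items I) st i = decoded I ws g i"
    using assms by (auto simp: output_partition_def decoded_def clusters_def)
qed

abbreviation cells :: "nat \<Rightarrow> nat \<Rightarrow> nat list set" where
  "cells m n \<equiv> (\<lambda>(k, i). [k, i]) ` set (grid m n)"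

text \<open>Since the totals vanish outside these cells, clearing finitely many cells restores the
  zero array.\<close>

lemma partial_total_outside:
  fixes I :: "('d::finite, 'p::finite, 's::finite) problem"
  shows "is \<notin> cells CARD('d) CARD('p) \<Longrightarrow> partial_total I ws ''C'' g v is = 0"
    and "is \<notin> cells CARD('s) CARD('p) \<Longrightarrow> partial_total I ws ''W'' g v is = 0"
proof -
  have *: "[k, i] \<notin> cells m n \<Longrightarrow> \<not> (k < m \<and> i < n)" for k i m n by (auto simp: set_grid image_iff)
  show "is \<notin> cells CARD('d) CARD('p) \<Longrightarrow> partial_total I ws ''C'' g v is = 0"
    by (auto simp: partial_total_def C_array intro!: sum.neutral dest!: *
        split: list.split if_splits)
  show "is \<notin> cells CARD('s) CARD('p) \<Longrightarrow> partial_total I ws ''W'' g v is = 0"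
    by (auto simp: partial_total_def W_array intro!: sum.neutral dest!: *
        split: list.split if_splits)
qed

lemma matrix_of_cells:
  "matrix_of (\<lambda>is. if is \<in> cells CARD('d) CARD('p) then h is else h' is) =
     (matrix_of h :: real^'p::finite^'d::finite)"
  by (auto simp: matrix_of_def vec_eq_iff set_grid image_iff)

section \<open>Correctness and running time\<close>

lemma le_sum3:
  fixes h :: "'a \<Rightarrow> 'b \<Rightarrow> 'c \<Rightarrow> nat"
  assumes "finite A" "finite B" "finite C" "a \<in> A" "b \<in> B" "c \<in> C"
  shows "h a b c \<le> (\<Sum>a\<in>A. \<Sum>b\<in>B. \<Sum>c\<in>C. h a b c)"
proof -
  have "h a b c \<le> (\<Sum>c\<in>C. h a b c)" using assms by (intro member_le_sum) auto
  also have "\<dots> \<le> (\<Sum>b\<in>B. \<Sum>c\<in>C. h a b c)"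
    using assms by (intro member_le_sum[of b B "\<lambda>b. \<Sum>c\<in>C. h a b c"]) auto
  also have "\<dots> \<le> (\<Sum>a\<in>A. \<Sum>b\<in>B. \<Sum>c\<in>C. h a b c)"
    using assms by (intro member_le_sum[of a A "\<lambda>a. \<Sum>b\<in>B. \<Sum>c\<in>C. h a b c"]) auto
  finally show ?thesis .
qed

context size_measure
begin

text \<open>\<open>gs\<close> is the target guess; its values have to lie in the range of the
  loops.\<close>

definition admissible :: "('d::finite, 'p::finite, 's::finite) problem \<Rightarrow> guess \<Rightarrow> bool" where
  "admissible I gs \<longleftrightarrow> (\<forall>j\<in>{1..items I}. \<forall>k i. utility I j $ k $ i \<in> K) \<and> (\<forall>y. gs y \<le> items I)"

lemma small_size: "x \<in> K \<Longrightarrow> sz x \<le> n \<Longrightarrow> small (real n) x"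
  unfolding small_def using mu_le_sz[of x] by linarith

lemma small_utility:
  fixes I :: "('d::finite, 'p::finite, 's::finite) problem"
  assumes "admissible I gs" "j \<in> {1..items I}"
  shows "small (input_size sz I) (utility I j $ k $ i)"
proof (rule small_size)
  show "utility I j $ k $ i \<in> K" using assms by (simp add: admissible_def)
  show "sz (utility I j $ k $ i) \<le> input_size sz I"
    using le_sum3[of "{1..items I}" UNIV UNIV j k i "\<lambda>j k i. sz (utility I j $ k $ i)"] assms(2)
    unfolding input_size_def by simp
qed

lemma small_weight:
  fixes I :: "('d::finite, 'p::finite, 's::finite) problem"
  assumes "j \<in> {1..items I}"
  shows "small (input_size sz I) (of_int (weight I j $ k $ i))"
proof (rule small_size[OF K_int])
  show "sz (of_int (weight I j $ k $ i)) \<le> input_size sz I"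
    using le_sum3[of "{1..items I}" UNIV UNIV j k i "\<lambda>j k i. sz (of_int (weight I j $ k $ i))"] assms
    unfolding input_size_def by simp
qed

lemma small_bounds:
  fixes I :: "('d::finite, 'p::finite, 's::finite) problem"
  shows "small (input_size sz I) (of_int (lower I i $ k))"
    and "small (input_size sz I) (of_int (upper I i $ k))"
proof -
  have "sz (of_int (lower I i $ k)) + sz (of_int (upper I i $ k)) \<le> input_size sz I"
    using le_sum3[of "{()}" UNIV UNIV "()" i k
        "\<lambda>u i k. sz (of_int (lower I i $ k)) + sz (of_int (upper I i $ k))"]
    unfolding input_size_def by simp
  then show "small (input_size sz I) (of_int (lower I i $ k))"
    "small (input_size sz I) (of_int (upper I i $ k))"
    by (simp_all add: small_size[OF K_int])
qed

lemma input_state_other: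
  "x \<notin> {''C'', ''W'', ''Bmin'', ''Bmax''} \<Longrightarrow> reals (input_state I) x = (\<lambda>_. 0)"
  unfolding input_state_def state.select_convs by (rule ext) (simp split: list.split)

lemma input_state_cases:
  obtains (C) j k i where "js = [j, k, i]" "x = ''C''" | (W) j k i where "js = [j, k, i]" "x = ''W''"
  | (Bmin) i k where "js = [i, k]" "x = ''Bmin''" | (Bmax) i k where "js = [i, k]" "x = ''Bmax''"
  | (other) "reals (input_state I) x js = 0"
proof -
  have "reals (input_state I) x js = 0 \<or> (\<exists>j k i. js = [j, k, i] \<and> (x = ''C'' \<or> x = ''W'')) \<or>
      (\<exists>i k. js = [i, k] \<and> (x = ''Bmin'' \<or> x = ''Bmax''))"
    unfolding input_state_def state.select_convs by (simp split: list.split)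
  then show thesis using that by metis
qed

lemma small_input:
  fixes I :: "('d::finite, 'p::finite, 's::finite) problem"
  assumes "admissible I gs"
  shows "small (input_size sz I) (reals (input_state I) x is)"
  by (cases rule: input_state_cases[where I = I and x = x and js = "is"])
    (simp_all add: C_array W_array Bmin_array Bmax_array small_0 small_weight small_bounds
      small_utility[OF assms])

lemma small_J_array: "m \<le> n \<Longrightarrow> small (real n) (J_array m is)"
  by (auto simp: J_array_def small_0 intro: small_mono[OF small_of_nat] split: list.split)

lemma small_square: "small (real n) x \<Longrightarrow> small (real (Suc n ^ 2)) x"
  by (erule small_mono) (simp add: power2_eq_square)

text \<open>At most N summands, each of height at most N, where N is the input size. This is the
  origin of the exponent 2 in the memory bounds below.\<close>

lemma small_partial_total:
  fixes I :: "('d::finite, 'p::finite, 's::finite) problem"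
  assumes "admissible I gs" "v \<le> Suc (items I)"
  shows "small (real (Suc (input_size sz I) ^ 2)) (partial_total I ws y g v is)"
proof -
  let ?N = "input_size sz I"
  have "small (real (Suc ?N ^ 2)) (\<Sum>j\<in>{1..<v}. if place I ws g CARD('p) j = i
      then reals (input_state I) y [j, k, i] else 0)" for k i
  proof (rule small_mono[OF small_sum])
    show "small (real ?N) (if place I ws g CARD('p) j = i then reals (input_state I) y [j, k, i] else 0)" for j
      by (simp add: small_input[OF assms(1)] small_0)
    have "card {1..<v} * ?N \<le> ?N * ?N"
      using assms(2) by (intro mult_right_mono) (auto simp: input_size_def)
    also have "\<dots> \<le> Suc ?N ^ 2" by (simp add: power2_eq_square)
    finally show "real (card {1..<v}) * real ?N \<le> real (Suc ?N ^ 2)"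
      by (metis of_nat_le_iff of_nat_mult)
  qed simp
  then show ?thesis by (simp add: partial_total_def small_0 split: list.split)
qed

text \<open>The size bound does not depend on how many guesses were processed: totals are recomputed
  from the input in each round, and \<open>''best''\<close> only receives copies of them.\<close>

definition invariant :: "('d::finite, 'p::finite, 's::finite) problem \<Rightarrow> guess \<Rightarrow> state \<Rightarrow> bool" where
  "invariant I gs st \<longleftrightarrow> admissible I gs \<and> data_state I st \<and>
     (\<forall>a\<in>{''X'', ''Y'', ''best''}. \<forall>is. small (real (Suc (input_size sz I) ^ 2)) (reals st a is)) \<and>
     (\<forall>is. is \<notin> cells CARD('d) CARD('p) \<longrightarrow> reals st ''Y'' is = 0) \<and>
     (\<forall>is. is \<notin> cells CARD('s) CARD('p) \<longrightarrow> reals st ''X'' is = 0)"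

lemma invariant_set_nat [simp]:
  "x \<noteq> ''n'' \<Longrightarrow> invariant I gs (set_nat x is v st) = invariant I gs st"
  by (simp add: invariant_def)

lemma invariant_bounded:
  assumes "invariant I gs st"
  shows "bounded_state (real (Suc (input_size sz I) ^ 2)) st"
  unfolding bounded_state_def
proof (intro allI)
  fix x "is"
  have adm: "admissible I gs" using assms by (simp add: invariant_def)
  consider "x \<in> {''X'', ''Y'', ''best''}" | "x = ''J''" | "x \<notin> {''J'', ''X'', ''Y'', ''best''}" by blast
  then show "small (real (Suc (input_size sz I) ^ 2)) (reals st x is)"
  proof cases
    case 1
    then show ?thesis using assms unfolding invariant_def by blast
  next
    case 2
    have "items I \<le> input_size sz I" by (simp add: input_size_def)
    then have "small (real (Suc (input_size sz I) ^ 2)) (J_array (items I) is)"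
      by (intro small_square small_J_array)
    moreover have "reals st ''J'' = J_array (items I)"
      using assms by (simp add: invariant_def data_state_def)
    ultimately show ?thesis unfolding 2 by simp
  next
    case 3
    then have "reals st x = reals (input_state I) x"
      using assms unfolding invariant_def data_state_def by blast
    then show ?thesis using small_square[OF small_input[OF adm]] by simp
  qed
qed

section \<open>Correctness of one round of the enumeration\<close>

text \<open>\<open>gs\<close> is the target guess, \<open>g\<close> the current one, and
  \<open>b\<close> records whether the target was covered before the round.\<close>

definition stage :: "(int^'p::finite^'s::finite) list \<Rightarrow> nat \<Rightarrow>
    (('d::finite, 'p, 's) problem \<times> (real^'p^'d \<Rightarrow> real) \<times> guess) \<times> guess \<times> bool \<Rightarrow> state \<Rightarrow> bool" where
  "stage ws v = (\<lambda>((I, f, gs), g, b) st. invariant I gs st \<and> sound I st \<and> nats st ''G'' = g \<and>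
     (b \<longrightarrow> covered I f (decoded I ws gs) st) \<and>
     reals st ''Y'' = partial_total I ws ''C'' g v \<and> reals st ''X'' = partial_total I ws ''W'' g v \<and>
     (\<forall>j\<in>{1..<v}. nats st ''c'' [j] = place I ws g CARD('p) j))"

abbreviation guess_size :: "(('d::finite, 'p::finite, 's::finite) problem \<times> 'f \<times> guess) \<times> guess \<times> bool \<Rightarrow> nat" where
  "guess_size \<equiv> \<lambda>((I, f, gs), g, b). input_size sz I"

abbreviation guess_oracle :: "(('d::finite, 'p::finite, 's::finite) problem \<times> (real^'p^'d \<Rightarrow> real) \<times> guess) \<times>
    guess \<times> bool \<Rightarrow> oracle2" where
  "guess_oracle \<equiv> \<lambda>((I, f, gs), g, b). comparison_oracle f"

lemma sound_set_nat [simp]: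
  "x \<notin> {''feasible'', ''cluster''} \<Longrightarrow> sound I (set_nat x is v st) = sound I st"
  by (auto simp: sound_def)

lemma sound_set_array [simp]: "a \<noteq> ''best'' \<Longrightarrow> sound I (set_array a h st) = sound I st"
  by (simp add: sound_def)

lemma covered_set_nat [simp]: "x \<noteq> ''feasible'' \<Longrightarrow> covered I f \<pi> (set_nat x is v st) = covered I f \<pi> st"
  by (simp add: covered_def)

lemma covered_set_array [simp]: "a \<noteq> ''best'' \<Longrightarrow> covered I f \<pi> (set_array a h st) = covered I f \<pi> st"
  by (simp add: covered_def)

lemma better_set_nat [simp]: "x \<noteq> ''feasible'' \<Longrightarrow> better I f \<pi> (set_nat x is v st) = better I f \<pi> st"
  by (simp add: better_def)

lemma stage_set_nat [simp]:
  "x \<notin> {''n'', ''feasible'', ''cluster'', ''G'', ''c''} \<Longrightarrow> stage ws v y (set_nat x is u st) = stage ws v y st"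
  by (auto simp: stage_def split: prod.split)

lemma reset_correct:
  fixes ws :: "(int^'p::finite^'s::finite) list"
  shows "ptriple sz guess_size guess_oracle
    (\<lambda>((I :: ('d::finite, 'p, 's) problem, f, gs), g, b) st. (invariant I gs st \<and> sound I st) \<and>
       nats st ''G'' = g \<and> (b \<longrightarrow> covered I f (decoded I ws gs) st))
    (reset_com CARD('d) CARD('p) CARD('s)) (stage ws 1)"
proof (rule ptriple_loop_free[where e = 2], goal_cases)
  case 1
  show ?case by (simp add: reset_com_def)
next
  case (2 x st)
  then show ?case by (auto intro: invariant_bounded split: prod.splits simp del: of_nat_power of_nat_Suc)
next
  case (3 x st)
  obtain I f gs g b where x: "x = ((I, f, gs), g, b)" by (metis surj_pair)
  from 3 have inv: "invariant I gs st" "sound I st" "nats st ''G'' = g"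
    "b \<longrightarrow> covered I f (decoded I ws gs) st" by (auto simp: x)
  then have Z: "reals st ''Z'' = (\<lambda>_. 0)" by (simp add: invariant_def data_state_def Z_array)
  have Y: "(\<lambda>is. if is \<in> cells CARD('d) CARD('p) then 0 else reals st ''Y'' is) = (\<lambda>_. 0)"
    and X: "(\<lambda>is. if is \<in> cells CARD('s) CARD('p) then 0 else reals st ''X'' is) = (\<lambda>_. 0)"
    using inv(1) by (auto simp: invariant_def)
  have "sem (guess_oracle x) (reset_com CARD('d) CARD('p) CARD('s)) st =
      set_array ''X'' (\<lambda>_. 0) (set_array ''Y'' (\<lambda>_. 0) st)"
    by (simp add: reset_com_def sem_copy_com Z X Y cong: if_cong)
  moreover have "stage ws 1 x (set_array ''X'' (\<lambda>_. 0) (set_array ''Y'' (\<lambda>_. 0) st))"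
    using inv unfolding x stage_def partial_total_1 by (simp add: invariant_def small_0)
  ultimately show ?case by simp
qed

lemma item_correct:
  fixes ws :: "(int^'p::finite^'s::finite) list"
  shows "ptriple sz (\<lambda>(x, v). guess_size x) (\<lambda>(x, v). guess_oracle x)
    (\<lambda>(x :: (('d::finite, 'p, 's) problem \<times> (real^'p^'d \<Rightarrow> real) \<times> guess) \<times> guess \<times> bool, v) st.
       1 \<le> v \<and> v \<le> items (fst (fst x)) \<and> nats st ''j'' [] = v \<and> stage ws v x st)
    (item_com CARD('d) ws)
    (\<lambda>(x, v) st. nats st ''j'' [] = v \<and> stage ws (Suc v) x (set_nat ''j'' [] (Suc v) st))"
proof (rule ptriple_loop_free[where e = 2], goal_cases)
  case 1
  show ?case by (simp add: item_com_def)
next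
  case (2 x st)
  then show ?case by (auto intro: invariant_bounded simp: stage_def split: prod.splits
        simp del: of_nat_power of_nat_Suc)
next
  case (3 xv st)
  obtain I f gs g b v where x: "xv = (((I, f, gs), g, b), v)" by (metis surj_pair)
  from 3 have v: "1 \<le> v" "v \<le> items I" "nats st ''j'' [] = v" and st: "stage ws v ((I, f, gs), g, b) st"
    by (auto simp: x)
  from st have inv: "invariant I gs st" and G: "nats st ''G'' = g"
    and Y: "reals st ''Y'' = partial_total I ws ''C'' g v"
    and X: "reals st ''X'' = partial_total I ws ''W'' g v"
    and c: "\<And>j. 1 \<le> j \<Longrightarrow> j < v \<Longrightarrow> nats st ''c'' [j] = place I ws g CARD('p) j"
    by (auto simp: stage_def)
  from inv have data: "data_state I st" by (simp add: invariant_def)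
  let ?st1 = "set_nat ''c'' [v] (place I ws g CARD('p) v) st"
  let ?Y = "partial_total I ws ''C'' g (Suc v)" and ?X = "partial_total I ws ''W'' g (Suc v)"
  let ?st2 = "set_array ''Y'' ?Y ?st1"
  let ?st3 = "set_array ''X'' ?X ?st2"
  let ?orc = "case xv of (x, v) \<Rightarrow> guess_oracle x"
  have "sem ?orc (place_com CARD('d) ws CARD('p)) st = ?st1"
    using sem_place_com[OF data, of ?orc ws "CARD('p)"] v G by simp
  moreover have "sem ?orc (acc_com ''Y'' ''C'' CARD('d)) ?st1 = ?st2"
    by (rule sem_acc_com_partial_total) (use data v Y in \<open>auto simp: C_array\<close>)
  moreover have "sem ?orc (acc_com ''X'' ''W'' CARD('s)) ?st2 = ?st3"
    by (rule sem_acc_com_partial_total) (use data v X in \<open>auto simp: W_array\<close>)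
  ultimately have sem: "sem ?orc (item_com CARD('d) ws) st = ?st3" by (simp add: item_com_def)
  have adm: "admissible I gs" using inv by (simp add: invariant_def)
  have "invariant I gs ?st3"
    using inv small_partial_total[OF adm, of "Suc v" ws] v(2)
    by (simp add: invariant_def partial_total_outside)
  moreover have "nats ?st3 ''c'' [j] = place I ws g CARD('p) j" if "1 \<le> j" "j < Suc v" for j
    using that c[of j] by (auto simp: less_Suc_eq)
  ultimately have "stage ws (Suc v) ((I, f, gs), g, b) ?st3"
    using st unfolding stage_def by simp
  then show ?case unfolding sem unfolding x using v by simp
qed

lemma decide_correct:
  fixes ws :: "(int^'p::finite^'s::finite) list"
  shows "ptriple sz guess_size guess_oracle
    (\<lambda>((I :: ('d::finite, 'p, 's) problem, f, gs), g, b). stage ws (Suc (items I)) ((I, f, gs), g, b))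
    (decide_com CARD('p) CARD('s))
    (\<lambda>((I, f, gs), g, b) st. stage ws (Suc (items I)) ((I, f, gs), g, b) st \<and>
       nats st ''q'' [] = (if better I f (decoded I ws g) st then 1 else 0))"
proof (rule ptriple_loop_free[where e = 2], goal_cases)
  case 1
  show ?case by (simp add: decide_com_def)
next
  case (2 x st)
  then show ?case by (auto intro: invariant_bounded simp: stage_def split: prod.splits
        simp del: of_nat_power of_nat_Suc)
next
  case (3 x st)
  obtain I f gs g b where x: "x = ((I, f, gs), g, b)" by (metis surj_pair)
  from 3 have st: "stage ws (Suc (items I)) ((I, f, gs), g, b) st" by (simp add: x)
  then have data: "data_state I st" and sd: "sound I st"
    and Y: "reals st ''Y'' = partial_total I ws ''C'' g (Suc (items I))"
    and X: "reals st ''X'' = partial_total I ws ''W'' g (Suc (items I))"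
    by (auto simp: stage_def invariant_def)
  have Ym: "matrix_of (reals st ''Y'') = total_utility I (decoded I ws g)"
    unfolding Y matrix_of_def by (rule partial_total_utility)
  let ?u = "if f (matrix_of (reals st ''best'')) \<le> f (total_utility I (decoded I ws g)) then 1 else 0"
  let ?st1 = "set_nat ''q'' [] ?u st"
  have "bval ?st1 (bounds_exp CARD('s) CARD('p)) \<longleftrightarrow> feasible I (decoded I ws g)"
    by (rule bval_bounds_exp) (use data X in auto)
  moreover have "nats st ''feasible'' [] = 0 \<or> nats st ''feasible'' [] = 1"
    using sd by (auto simp: sound_def)
  moreover have "set_nat ''q'' [] u (set_nat ''q'' [] u' st) = set_nat ''q'' [] u st" for u u'
    by (simp add: set_nat_def)
  ultimately have "sem (guess_oracle x) (decide_com CARD('p) CARD('s)) st =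
      set_nat ''q'' [] (if better I f (decoded I ws g) st then 1 else 0) st"
    by (auto simp: decide_com_def x comparison_oracle_iff Ym better_def)
  then show ?case using st by (simp add: x)
qed

text \<open>While the stored clusters are being overwritten, \<open>sound\<close> may fail, so it is
  kept only if nothing is overwritten. \<open>better\<close> depends on the state only through
  \<open>''feasible''\<close> and \<open>''best''\<close>, which the saving loop leaves alone, so
  the verdict remains valid until \<open>best_com\<close>.\<close>

definition saving :: "(int^'p::finite^'s::finite) list \<Rightarrow> nat \<Rightarrow>
    (('d::finite, 'p, 's) problem \<times> (real^'p^'d \<Rightarrow> real) \<times> guess) \<times> guess \<times> bool \<Rightarrow> state \<Rightarrow> bool" where
  "saving ws v = (\<lambda>((I, f, gs), g, b) st. invariant I gs st \<and> nats st ''G'' = g \<and>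
     (b \<longrightarrow> covered I f (decoded I ws gs) st) \<and>
     reals st ''Y'' = partial_total I ws ''C'' g (Suc (items I)) \<and>
     (\<forall>j\<in>{1..items I}. nats st ''c'' [j] = place I ws g CARD('p) j) \<and>
     (if better I f (decoded I ws g) st
      then nats st ''q'' [] = 1 \<and> (\<forall>j\<in>{1..<v}. nats st ''cluster'' [j] = place I ws g CARD('p) j)
      else nats st ''q'' [] = 0 \<and> sound I st))"

lemma save_correct:
  fixes ws :: "(int^'p::finite^'s::finite) list"
  shows "ptriple sz (\<lambda>(x, v). guess_size x) (\<lambda>(x, v). guess_oracle x)
    (\<lambda>(x :: (('d::finite, 'p, 's) problem \<times> (real^'p^'d \<Rightarrow> real) \<times> guess) \<times> guess \<times> bool, v) st.
       1 \<le> v \<and> v \<le> items (fst (fst x)) \<and> nats st ''j'' [] = v \<and> saving ws v x st)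
    save_com
    (\<lambda>(x, v) st. nats st ''j'' [] = v \<and> saving ws (Suc v) x (set_nat ''j'' [] (Suc v) st))"
proof (rule ptriple_loop_free[where e = 2], goal_cases)
  case 1
  show ?case by (simp add: save_com_def)
next
  case (2 x st)
  then show ?case by (auto intro: invariant_bounded simp: saving_def split: prod.splits
        simp del: of_nat_power of_nat_Suc)
next
  case (3 xv st)
  obtain I f gs g b v where x: "xv = (((I, f, gs), g, b), v)" by (metis surj_pair)
  from 3 show ?case
    by (auto simp: x saving_def save_com_def j_cluster_def less_Suc_eq split: if_splits)
qed

lemma best_correct:
  fixes ws :: "(int^'p::finite^'s::finite) list"
  shows "ptriple sz guess_size guess_oracle
    (\<lambda>((I :: ('d::finite, 'p, 's) problem, f, gs), g, b). saving ws (Suc (items I)) ((I, f, gs), g, b))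
    (best_com CARD('d) CARD('p))
    (\<lambda>((I, f, gs), g, b) st. (invariant I gs st \<and> sound I st) \<and> nats st ''G'' = g \<and>
       (b \<or> (\<forall>y\<in>set (guess_cells (length ws) CARD('p) (Suc (Suc (CARD('d) * CARD('p))))). g y = gs y)
         \<longrightarrow> covered I f (decoded I ws gs) st))"
proof (rule ptriple_loop_free[where e = 2], goal_cases)
  case 1
  show ?case by (simp add: best_com_def)
next
  case (2 x st)
  then show ?case by (auto intro: invariant_bounded simp: saving_def split: prod.splits
        simp del: of_nat_power of_nat_Suc)
next
  case (3 x st)
  obtain I f gs g b where x: "x = ((I, f, gs), g, b)" by (metis surj_pair)
  from 3 have st: "saving ws (Suc (items I)) ((I, f, gs), g, b) st" by (simp add: x)
  let ?D = "set (guess_cells (length ws) CARD('p) (Suc (Suc (CARD('d) * CARD('p)))))"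
  let ?\<pi> = "decoded I ws g"
  have inv: "invariant I gs st" and G: "nats st ''G'' = g"
    and b: "b \<longrightarrow> covered I f (decoded I ws gs) st"
    and Y: "reals st ''Y'' = partial_total I ws ''C'' g (Suc (items I))"
    using st by (auto simp: saving_def)
  have same: "decoded I ws gs = ?\<pi>" if "\<forall>y\<in>?D. g y = gs y"
    using decoded_cong[of ws g gs I] that by simp
  have Ym: "matrix_of (reals st ''Y'') = total_utility I ?\<pi>"
    unfolding Y matrix_of_def by (rule partial_total_utility)
  show ?case
  proof (cases "better I f ?\<pi> st")
    case True
    with st have q: "nats st ''q'' [] = 1"
      and cl: "\<forall>j\<in>{1..items I}. nats st ''cluster'' [j] = place I ws g CARD('p) j"
      by (auto simp: saving_def atLeastLessThanSuc_atLeastAtMost)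
    let ?best = "\<lambda>is. if is \<in> cells CARD('d) CARD('p) then reals st ''Y'' is else reals st ''best'' is"
    let ?st = "set_array ''best'' ?best (set_nat ''feasible'' [] 1 st)"
    have sem: "sem (guess_oracle x) (best_com CARD('d) CARD('p)) st = ?st"
      by (simp add: best_com_def q sem_copy_com cong: if_cong)
    have m: "matrix_of ?best = total_utility I ?\<pi>" unfolding matrix_of_cells by (rule Ym)
    have "invariant I gs ?st" using inv by (simp add: invariant_def)
    moreover have "sound I ?st"
      using output_partition_decoded[OF cl] True m by (simp add: sound_def better_def)
    moreover have "covered I f (decoded I ws gs) ?st" if "b \<or> (\<forall>y\<in>?D. g y = gs y)"
      using that
    proof
      assume b
      \<comment> \<open>The new total is at least as good as the stored one, so what was covered
        remains covered.\<close>
      with b True show ?thesis by (auto simp: covered_def better_def m)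
    next
      assume "\<forall>y\<in>?D. g y = gs y"
      then show ?thesis using True by (simp add: same covered_def m)
    qed
    ultimately show ?thesis unfolding sem unfolding x using G by simp
  next
    case False
    with st have q: "nats st ''q'' [] = 0" and sd: "sound I st" by (auto simp: saving_def)
    have sem: "sem (guess_oracle x) (best_com CARD('d) CARD('p)) st = st"
      by (simp add: best_com_def q)
    have "covered I f (decoded I ws gs) st" if "b \<or> (\<forall>y\<in>?D. g y = gs y)"
      using that
    proof
      assume "\<forall>y\<in>?D. g y = gs y"
      \<comment> \<open>Not being better means being infeasible, or that something strictly better
        is already stored.\<close>
      then show ?thesis using False sd by (auto simp: same covered_def better_def sound_def)
    qed (use b in blast)
    then show ?thesis unfolding sem unfolding x using inv sd G by simp
  qed
qed

lemma guess_correct: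
  fixes ws :: "(int^'p::finite^'s::finite) list"
  shows "ptriple sz guess_size guess_oracle
    (\<lambda>((I :: ('d::finite, 'p, 's) problem, f, gs), g, b) st. (invariant I gs st \<and> sound I st) \<and>
       nats st ''G'' = g \<and> (b \<longrightarrow> covered I f (decoded I ws gs) st))
    (guess_com CARD('d) ws)
    (\<lambda>((I, f, gs), g, b) st. (invariant I gs st \<and> sound I st) \<and> nats st ''G'' = g \<and>
       (b \<or> (\<forall>y\<in>set (guess_cells (length ws) CARD('p) (Suc (Suc (CARD('d) * CARD('p))))). g y = gs y)
         \<longrightarrow> covered I f (decoded I ws gs) st))"
  unfolding guess_com_def
proof (intro ptriple_seq)
  have inv_n: "nats st ''n'' [] = items I \<and> items I \<le> input_size sz I" if "invariant I gs st"
    for I :: "('d, 'p, 's) problem" and gs st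
    using that by (simp add: invariant_def data_state_def input_size_def)
  show "ptriple sz guess_size guess_oracle (stage ws 1) (For ''j'' [] 1 (item_com CARD('d) ws))
    (\<lambda>((I :: ('d, 'p, 's) problem, f, gs), g, b). stage ws (Suc (items I)) ((I, f, gs), g, b))"
  proof (rule ptriple_For[where I = "\<lambda>x v. stage ws v x" and n = "\<lambda>x. items (fst (fst x))"])
    show "ptriple sz (\<lambda>(x, v). guess_size x) (\<lambda>(x, v). guess_oracle x)
      (\<lambda>(x :: (('d, 'p, 's) problem \<times> (real^'p^'d \<Rightarrow> real) \<times> guess) \<times> guess \<times> bool, v) st.
         1 \<le> v \<and> v \<le> items (fst (fst x)) \<and> nats st ''j'' [] = v \<and> stage ws v x st)
      (item_com CARD('d) ws)
      (\<lambda>(x, v) st. nats st ''j'' [] = v \<and> stage ws (Suc v) x (set_nat ''j'' [] (Suc v) st))"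
      by (rule item_correct)
  qed (use inv_n in \<open>auto simp: stage_def split: prod.splits\<close>)
  show "ptriple sz guess_size guess_oracle
    (\<lambda>((I :: ('d, 'p, 's) problem, f, gs), g, b) st. stage ws (Suc (items I)) ((I, f, gs), g, b) st \<and>
       nats st ''q'' [] = (if better I f (decoded I ws g) st then 1 else 0))
    (For ''j'' [] 1 save_com)
    (\<lambda>((I, f, gs), g, b). saving ws (Suc (items I)) ((I, f, gs), g, b))"
  proof (rule ptriple_For[where I = "\<lambda>x v. saving ws v x" and n = "\<lambda>x. items (fst (fst x))"])
    show "ptriple sz (\<lambda>(x, v). guess_size x) (\<lambda>(x, v). guess_oracle x)
      (\<lambda>(x :: (('d, 'p, 's) problem \<times> (real^'p^'d \<Rightarrow> real) \<times> guess) \<times> guess \<times> bool, v) st.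
         1 \<le> v \<and> v \<le> items (fst (fst x)) \<and> nats st ''j'' [] = v \<and> saving ws v x st)
      save_com
      (\<lambda>(x, v) st. nats st ''j'' [] = v \<and> saving ws (Suc v) x (set_nat ''j'' [] (Suc v) st))"
      by (rule save_correct)
  qed (use inv_n in \<open>auto simp: saving_def stage_def sound_def split: prod.splits\<close>)
qed (rule reset_correct decide_correct best_correct)+

section \<open>Correctness of the whole program\<close>

lemma J_correct:
  "ptriple sz (\<lambda>((I, f, gs), v). input_size sz I) (\<lambda>((I, f, gs), v). comparison_oracle f)
    (\<lambda>((I :: ('d::finite, 'p::finite, 's::finite) problem, f :: real^'p^'d \<Rightarrow> real, gs), v) st.
       1 \<le> v \<and> v \<le> items I \<and> nats st ''j'' [] = v \<and> admissible I gs \<and>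
       reals st = (reals (input_state I))(''J'' := J_array (v - 1)) \<and>
       nats st ''n'' [] = items I \<and> nats st ''feasible'' [] = 0)
    J_com
    (\<lambda>((I, f, gs), v) st. nats st ''j'' [] = v \<and> admissible I gs \<and>
       reals (set_nat ''j'' [] (Suc v) st) = (reals (input_state I))(''J'' := J_array (Suc v - 1)) \<and>
       nats (set_nat ''j'' [] (Suc v) st) ''n'' [] = items I \<and>
       nats (set_nat ''j'' [] (Suc v) st) ''feasible'' [] = 0)"
proof (rule ptriple_loop_free[where e = 2], goal_cases)
  case 1
  show ?case by (simp add: J_com_def)
next
  case (2 x st)
  obtain I f gs v where x: "x = ((I, f, gs), v)" by (metis surj_pair)
  from 2 have v: "v \<le> items I" and adm: "admissible I gs"
    and r: "reals st = (reals (input_state I))(''J'' := J_array (v - 1))" by (auto simp: x)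
  have "v - 1 \<le> input_size sz I" using v by (simp add: input_size_def)
  then have "small (real (Suc (input_size sz I) ^ 2)) (reals st y is)" for y "is"
    using small_square[OF small_input[OF adm, of y "is"]] small_square[OF small_J_array[of "v - 1" "input_size sz I" "is"]]
    by (simp add: r del: of_nat_power of_nat_Suc)
  then show ?case by (simp add: x bounded_state_def del: of_nat_power of_nat_Suc)
next
  case (3 x st)
  obtain I f gs v where x: "x = ((I, f, gs), v)" by (metis surj_pair)
  from 3 have v: "1 \<le> v" "nats st ''j'' [] = v"
    and r: "reals st = (reals (input_state I))(''J'' := J_array (v - 1))" by (auto simp: x)
  \<comment> \<open>For \<open>v = 1\<close> the entry that is read has index 0 and value 0.\<close>
  have "(J_array (v - 1))([v] := J_array (v - 1) [v - 1] + 1) = J_array v"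
    using v(1) by (auto simp: J_array_def fun_eq_iff split: list.split)
  then have "sem (case x of ((I, f, gs), v) \<Rightarrow> comparison_oracle f) J_com st = set_array ''J'' (J_array v) st"
    using v(2) by (simp add: J_com_def set_real_eq_set_array r)
  moreover have "reals (set_array ''J'' (J_array v) st) = (reals (input_state I))(''J'' := J_array v)"
    by (simp add: fun_eq_iff r)
  ultimately show ?case using 3 v by (auto simp: x)
qed

lemma partition_com_correct:
  fixes ws :: "(int^'p::finite^'s::finite) list"
  shows "ptriple sz (\<lambda>(I, f, gs). input_size sz I) (\<lambda>(I, f, gs). comparison_oracle f)
    (\<lambda>(I :: ('d::finite, 'p, 's) problem, f :: real^'p^'d \<Rightarrow> real, gs) st.
       admissible I gs \<and> st = input_state I)
    (partition_com CARD('d) ws)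
    (\<lambda>(I, f, gs) st. sound I st \<and> covered I f (decoded I ws gs) st)"
  unfolding partition_com_def
proof (rule ptriple_seq)
  let ?J = "\<lambda>(I :: ('d, 'p, 's) problem, f :: real^'p^'d \<Rightarrow> real, gs) v (st :: state). admissible I gs \<and>
    reals st = (reals (input_state I))(''J'' := J_array (v - 1)) \<and>
    nats st ''n'' [] = items I \<and> nats st ''feasible'' [] = 0"
  let ?D = "guess_cells (length ws) CARD('p) (Suc (Suc (CARD('d) * CARD('p))))"
  let ?Inv = "\<lambda>(I :: ('d, 'p, 's) problem, f :: real^'p^'d \<Rightarrow> real, gs) st. invariant I gs st \<and> sound I st"
  have J0: "J_array 0 = (\<lambda>_. 0)" by (auto simp: J_array_def fun_eq_iff split: list.split)
  show "ptriple sz (\<lambda>(I, f, gs). input_size sz I) (\<lambda>(I, f, gs). comparison_oracle f)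
    (\<lambda>(I :: ('d, 'p, 's) problem, f :: real^'p^'d \<Rightarrow> real, gs) st.
       admissible I gs \<and> st = input_state I)
    (For ''j'' [] 1 J_com) ?Inv"
  proof (rule ptriple_For[where I = ?J and n = "\<lambda>(I, f, gs). items I"])
    show "ptriple sz (\<lambda>(x, v). case x of (I, f, gs) \<Rightarrow> input_size sz I)
      (\<lambda>(x, v). case x of (I, f, gs) \<Rightarrow> comparison_oracle f)
      (\<lambda>(x, v) st. 1 \<le> v \<and> v \<le> (case x of (I, f, gs) \<Rightarrow> items I) \<and> nats st ''j'' [] = v \<and> ?J x v st)
      J_com (\<lambda>(x, v) st. nats st ''j'' [] = v \<and> ?J x (Suc v) (set_nat ''j'' [] (Suc v) st))"
      by (rule ptriple_conseq[OF J_correct]) (auto split: prod.splits)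
  next
    fix x st
    assume "(case x of (I :: ('d, 'p, 's) problem, f :: real^'p^'d \<Rightarrow> real, gs) \<Rightarrow> \<lambda>st.
       admissible I gs \<and> st = input_state I) st"
    moreover have "(reals (input_state I))(''J'' := J_array 0) = reals (input_state I)"
      for I :: "('d, 'p, 's) problem"
      using input_state_other[of "''J''" I] by (simp add: J0 fun_upd_idem)
    ultimately show "?J x 1 (set_nat ''j'' [] 1 st)"
      by (auto simp: input_state_def split: prod.splits)
  next
    fix x v st assume "?J x v st"
    then show "nats st ''n'' [] = (case x of (I, f, gs) \<Rightarrow> items I) \<and>
      (case x of (I, f, gs) \<Rightarrow> items I) \<le> (case x of (I, f, gs) \<Rightarrow> input_size sz I)"
      by (auto simp: input_size_def split: prod.splits)
  next
    fix x st assume "?J x (Suc (case x of (I, f, gs) \<Rightarrow> items I)) st"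
    then show "?Inv x st"
      by (auto simp: invariant_def data_state_def sound_def input_state_other small_0 split: prod.splits)
  qed simp
  have "ptriple sz (\<lambda>(x, g, b). (\<lambda>(I, f, gs). input_size sz I) x)
    (\<lambda>(x, g, b). (\<lambda>(I, f, gs). comparison_oracle f) x)
    (\<lambda>(x, g, b) st. ?Inv x st \<and> (\<forall>y. y \<notin> set ?D \<longrightarrow> nats st ''G'' y = g y) \<and>
      (b \<longrightarrow> (\<lambda>(I, f, gs). covered I f (decoded I ws gs)) x st))
    (loops ?D (guess_com CARD('d) ws))
    (\<lambda>(x, g, b) st. ?Inv x st \<and> (\<forall>y. y \<notin> set ?D \<longrightarrow> nats st ''G'' y = g y) \<and>
      (b \<or> (\<forall>y\<in>set ?D - set ?D. g y = (\<lambda>(I, f, gs). gs) x y) \<longrightarrow>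
        (\<lambda>(I, f, gs). covered I f (decoded I ws gs)) x st))"
  proof (rule ptriple_loops[where n = "\<lambda>(I, f, gs). items I"])
    show "ptriple sz (\<lambda>(x, g, b). (\<lambda>(I, f, gs). input_size sz I) x)
      (\<lambda>(x, g, b). (\<lambda>(I, f, gs). comparison_oracle f) x)
      (\<lambda>(x, g, b) st. ?Inv x st \<and> nats st ''G'' = g \<and>
        (b \<longrightarrow> (\<lambda>(I, f, gs). covered I f (decoded I ws gs)) x st))
      (guess_com CARD('d) ws)
      (\<lambda>(x, g, b) st. ?Inv x st \<and> nats st ''G'' = g \<and>
        (b \<or> (\<forall>y\<in>set ?D. g y = (\<lambda>(I, f, gs). gs) x y) \<longrightarrow>
          (\<lambda>(I, f, gs). covered I f (decoded I ws gs)) x st))"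
      by (rule ptriple_conseq[OF guess_correct[of ws]]) (auto split: prod.splits)
  qed (auto simp: invariant_def data_state_def admissible_def input_size_def guess_cells_def split: prod.splits)
  then show "ptriple sz (\<lambda>(I, f, gs). input_size sz I) (\<lambda>(I, f, gs). comparison_oracle f) ?Inv
    (loops ?D (guess_com CARD('d) ws))
    (\<lambda>(I, f, gs) st. sound I st \<and> covered I f (decoded I ws gs) st)"
  proof (rule ptriple_conseq, goal_cases)
    case (1 x st)
    \<comment> \<open>Nothing is claimed to be covered at the start. After all loops no enumerated
      cell remains to be matched, so the condition on \<open>g\<close> is vacuous and the target is
      covered.\<close>
    then show ?case
      by (intro exI[of _ "(x, nats st ''G'', False)"]) (auto split: prod.splits)
  qed
qed

text \<open>The program does not see \<open>gs\<close>: it is a logical variable, instantiated by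
  \<open>guess_exists\<close>, or by 0 if there is no feasible partition.\<close>

lemma partition_com_solves:
  fixes ws :: "(int^'p::finite^'s::finite) list"
  shows "solves_in_poly_time sz K (set ws) TYPE('d::finite) (partition_com CARD('d) ws)"
proof -
  obtain a where a: "\<And>(I :: ('d, 'p, 's) problem) (f :: real^'p^'d \<Rightarrow> real) gs. admissible I gs \<Longrightarrow>
      \<exists>t st'. exec (comparison_oracle f) sz (partition_com CARD('d) ws) (input_state I) t st' \<and>
        t \<le> a * Suc (input_size sz I) ^ a \<and> sound I st' \<and> covered I f (decoded I ws gs) st'"
    using partition_com_correct[of ws] unfolding ptriple_def by fastforce
  define q :: "nat poly" where "q = smult a ([:1, 1:] ^ a)"
  have q: "poly q m = a * Suc m ^ a" for m by (simp add: q_def)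
  show ?thesis
    unfolding solves_in_poly_time_def
  proof (intro exI[of _ q] allI impI)
    fix I :: "('d, 'p, 's) problem" and f :: "real^'p^'d \<Rightarrow> real"
    assume ws: "\<forall>j\<in>{1..items I}. weight I j \<in> set ws"
      and ut: "\<forall>j\<in>{1..items I}. \<forall>k i. utility I j $ k $ i \<in> K" and f: "convex_on UNIV f"
    have "\<exists>gs. (\<forall>y. gs y \<le> items I) \<and> ((\<exists>\<pi>. feasible I \<pi>) \<longrightarrow> optimal I f (decoded I ws gs))"
    proof (cases "\<exists>\<pi>. feasible I \<pi>")
      case True
      then obtain \<pi> where "feasible I \<pi>" ..
      then obtain gs where "\<And>y. gs y \<le> items I" "optimal I f (decoded I ws gs)"
        using guess_exists[OF _ f] ws by metis
      then show ?thesis by blast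
    next
      case False
      then show ?thesis by (intro exI[of _ "\<lambda>_. 0"]) auto
    qed
    then obtain gs where gs: "\<And>y. gs y \<le> items I"
      "\<And>\<pi>. feasible I \<pi> \<Longrightarrow> optimal I f (decoded I ws gs)" by blast
    have "admissible I gs" using ut gs(1) by (simp add: admissible_def)
    from a[OF this, of f] obtain t st where
      ex: "exec (comparison_oracle f) sz (partition_com CARD('d) ws) (input_state I) t st"
        "t \<le> a * Suc (input_size sz I) ^ a" and st: "sound I st" "covered I f (decoded I ws gs) st"
      by blast
    have "correct_output I f st"
    proof (cases "\<exists>\<pi>. feasible I \<pi>")
      case True
      then have opt: "optimal I f (decoded I ws gs)" using gs(2) by blast
      then have 1: "nats st ''feasible'' [] = 1"
        "f (total_utility I (decoded I ws gs)) \<le> f (matrix_of (reals st ''best''))"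
        using st(2) by (auto simp: covered_def optimal_def)
      with st(1) have 2: "feasible I (output_partition (items I) st)"
        "matrix_of (reals st ''best'') = total_utility I (output_partition (items I) st)"
        by (auto simp: sound_def)
      have "f (total_utility I \<rho>) \<le> f (total_utility I (output_partition (items I) st))"
        if "feasible I \<rho>" for \<rho>
        using opt that 1(2) unfolding 2(2) optimal_def by (meson order.trans)
      then show ?thesis using True 1(1) 2(1) by (simp add: correct_output_def optimal_def)
    next
      case False
      then show ?thesis using st(1) by (auto simp: correct_output_def sound_def)
    qed
    with ex show "\<exists>t st. exec (comparison_oracle f) sz (partition_com CARD('d) ws) (input_state I) t st \<and>
        t \<le> poly q (input_size sz I) \<and> correct_output I f st"
      unfolding q by blast
  qed
qed

end

section \<open>The two cost models\<close>

text \<open>Every real costs 1, so no growth has to be controlled and \<open>mu\<close> can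
  vanish.\<close>

lemma unit_size_measure: "size_measure (\<lambda>_. 1) UNIV (\<lambda>_. 0) 1"
  by unfold_locales auto

lemma bit_size_measure: "size_measure bit_size \<rat> log_height 3"
proof
  fix x y :: real
  assume "x \<in> \<rat>" "y \<in> \<rat>"
  then obtain r s where rs: "x = of_rat r" "y = of_rat s" by (metis Rats_cases)
  show "log_height (x + y) \<le> log_height x + log_height y"
    unfolding rs of_rat_add[symmetric] by (rule log_height_mono[OF height_add])
  show "log_height (x - y) \<le> log_height x + log_height y"
    unfolding rs of_rat_diff[symmetric] by (rule log_height_mono[OF height_diff])
  show "log_height (x * y) \<le> log_height x + log_height y"
    unfolding rs of_rat_mult[symmetric] by (rule log_height_mono[OF height_mult])
  show "log_height (x / y) \<le> log_height x + log_height y"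
    unfolding rs of_rat_divide[symmetric] by (rule log_height_mono[OF height_divide])
  show "bit_size x \<le> real 3 * (1 + log_height x)"
    unfolding rs using bit_size_le_log_height[of r] by simp
  show "log_height x \<le> bit_size x"
    unfolding rs by (rule log_height_le_bit_size)
next
  show "log_height 0 = 0" "log_height 1 \<le> 1"
    using log_height_of_rat[of 0] log_height_of_rat[of 1] by (simp_all add: height_def)
qed auto

text \<open>One program serves both cost models, because its definition does not refer to the size
  measure.\<close>

theorem theorem3:
  fixes \<Omega> :: "(int^'p::finite^'s::finite) set"
  assumes "finite \<Omega>"
  shows "\<exists>c. solves_in_poly_time (\<lambda>_. 1) UNIV \<Omega> TYPE('d::finite) c \<and>
             solves_in_poly_time bit_size \<rat> \<Omega> TYPE('d) c"
proof -
  obtain ws where "set ws = \<Omega>" using finite_list[OF assms] ..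
  then show ?thesis
    using size_measure.partition_com_solves[OF unit_size_measure, of ws]
      size_measure.partition_com_solves[OF bit_size_measure, of ws] by blast
qed

end
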